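(* Fix a computable presentation $K$ of the algebraic closure $\overline{\mathbb{Q}}$ of $\mathbb{Q}$, with domain $\omega$. For each $e$, let $K_e$ be the subfield of $K$ generated by the set $W_e\subseteq\omega$ (the closure of $W_e$ under the field operations), and let $F^{\mathrm{alg}}_{\cong}=\{(i,j): K_i\cong K_j\}$. For each $e$, let $L_e$ be an algebraically closed field of characteristic $0$ of transcendence degree $|\omega\setminus W_e|$ (possibly infinite), and let $F^{AC}_{\cong}=\{(i,j):L_i\cong L_j\}$. Then the equivalence relation $F^{\mathrm{alg}}_{\cong}$ on $\omega$, which is $\Pi^0_2$-complete as a set (under $1$-reducibility), is complete under finitary reducibility $\leq_c^{<\omega}$ among all $\Pi^0_2$ equivalence relations. However, the equivalence relation $F^{AC}_{\cong}$ on $\omega$, which is $\Pi^0_3$-complete as a set, is complete under ternary reducibility $\leq_c^3$ among all $\Pi^0_3$ equivalence relations, but is not complete under $4$-ary reducibility $\leq_c^4$ among them.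
   Context: $W_e$ is the $e$-th c.e. set. For equivalence relations $E,F$ on $\omega$ and $n\ge1$, $E\leq_c^nF$ means there is a total computable function mapping each $(x_0,\dots,x_{n-1})\in\omega^n$ to $(y_0,\dots,y_{n-1})\in\omega^n$ with $x_i\,E\,x_j\iff y_i\,F\,y_j$ for all $i<j<n$; $E\leq_c^{<\omega}F$ means such functions exist uniformly in $n$ (one computable function taking $n$ and an $n$-tuple). An equivalence relation $E$ is complete under a reducibility $\le$ among a class of equivalence relations if $E$ belongs to the class and every member $R$ of the class satisfies $R\le E$. A $\Pi^0_k$ equivalence relation is an equivalence relation on $\omega$ that is a $\Pi^0_k$ subset of $\omega\times\omega$. *)

theory Defs
  imports "HOL-Algebra.Algebraic_Closure" "HOL-Algebra.Generated_Fields"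
          "HOL-Library.Nat_Bijection" "HOL-Library.Equipollence"
begin

datatype rcode = Z | S | Proj nat | Comp rcode "rcode list" | Prim rcode rcode | Mn rcode

inductive rc_eval :: "rcode \<Rightarrow> nat list \<Rightarrow> nat \<Rightarrow> bool" where
  zero: "rc_eval Z xs 0"
| succ: "rc_eval S (x # xs) (Suc x)"
| proj: "i < length xs \<Longrightarrow> rc_eval (Proj i) xs (xs ! i)"
| comp: "\<lbrakk> length ys = length gs; \<forall>i < length gs. rc_eval (gs ! i) xs (ys ! i);
           rc_eval f ys z \<rbrakk> \<Longrightarrow> rc_eval (Comp f gs) xs z"
| prim0: "rc_eval f xs y \<Longrightarrow> rc_eval (Prim f g) (0 # xs) y"
| primS: "\<lbrakk> rc_eval (Prim f g) (n # xs) y; rc_eval g (y # n # xs) z \<rbrakk>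
           \<Longrightarrow> rc_eval (Prim f g) (Suc n # xs) z"
| mn: "\<lbrakk> rc_eval f (n # xs) 0; \<forall>m < n. \<exists>y. 0 < y \<and> rc_eval f (m # xs) y \<rbrakk>
           \<Longrightarrow> rc_eval (Mn f) xs n"

fun rc_encode :: "rcode \<Rightarrow> nat" where
  "rc_encode Z = prod_encode (0, 0)"
| "rc_encode S = prod_encode (1, 0)"
| "rc_encode (Proj i) = prod_encode (2, i)"
| "rc_encode (Comp f gs) = prod_encode (3, prod_encode (rc_encode f, list_encode (map rc_encode gs)))"
| "rc_encode (Prim f g) = prod_encode (4, prod_encode (rc_encode f, rc_encode g))"
| "rc_encode (Mn f) = prod_encode (5, rc_encode f)"

text \<open>The e-th code; numbers that code nothing denote the nowhere defined function.\<close>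
definition rc_decode :: "nat \<Rightarrow> rcode" where
  "rc_decode e = (if \<exists>c. rc_encode c = e then (SOME c. rc_encode c = e) else Mn S)"

definition W :: "nat \<Rightarrow> nat set" where
  "W e = {x. \<exists>y. rc_eval (rc_decode e) [x] y}"

definition computable1 :: "(nat \<Rightarrow> nat) \<Rightarrow> bool" where
  "computable1 f \<longleftrightarrow> (\<exists>c. \<forall>x. rc_eval c [x] (f x))"

definition computable2 :: "(nat \<Rightarrow> nat \<Rightarrow> nat) \<Rightarrow> bool" where
  "computable2 f \<longleftrightarrow> (\<exists>c. \<forall>x y. rc_eval c [x, y] (f x y))"

definition computable_pred :: "nat \<Rightarrow> (nat list \<Rightarrow> bool) \<Rightarrow> bool" where
  "computable_pred n P \<longleftrightarrow>
     (\<exists>c. \<forall>xs. length xs = n \<longrightarrow> rc_eval c xs (if P xs then 1 else 0))"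

definition Pi2_set :: "nat set \<Rightarrow> bool" where
  "Pi2_set A \<longleftrightarrow> (\<exists>P. computable_pred 3 P \<and> (\<forall>x. x \<in> A \<longleftrightarrow> (\<forall>a. \<exists>b. P [x, a, b])))"

definition Pi3_set :: "nat set \<Rightarrow> bool" where
  "Pi3_set A \<longleftrightarrow> (\<exists>P. computable_pred 4 P \<and>
      (\<forall>x. x \<in> A \<longleftrightarrow> (\<forall>a. \<exists>b. \<forall>d. P [x, a, b, d])))"

definition pair_code :: "(nat \<times> nat) set \<Rightarrow> nat set" where
  "pair_code R = prod_encode ` R"

definition one_reducible :: "nat set \<Rightarrow> nat set \<Rightarrow> bool" where
  "one_reducible A B \<longleftrightarrow> (\<exists>f. inj f \<and> computable1 f \<and> (\<forall>x. x \<in> A \<longleftrightarrow> f x \<in> B))"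

definition Pi2_complete_set :: "nat set \<Rightarrow> bool" where
  "Pi2_complete_set A \<longleftrightarrow> Pi2_set A \<and> (\<forall>B. Pi2_set B \<longrightarrow> one_reducible B A)"

definition Pi3_complete_set :: "nat set \<Rightarrow> bool" where
  "Pi3_complete_set A \<longleftrightarrow> Pi3_set A \<and> (\<forall>B. Pi3_set B \<longrightarrow> one_reducible B A)"

definition Pi2_eqrel :: "(nat \<times> nat) set \<Rightarrow> bool" where
  "Pi2_eqrel E \<longleftrightarrow> equiv UNIV E \<and> Pi2_set (pair_code E)"

definition Pi3_eqrel :: "(nat \<times> nat) set \<Rightarrow> bool" where
  "Pi3_eqrel E \<longleftrightarrow> equiv UNIV E \<and> Pi3_set (pair_code E)"

definition nary_reducible :: "nat \<Rightarrow> (nat \<times> nat) set \<Rightarrow> (nat \<times> nat) set \<Rightarrow> bool" where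
  "nary_reducible n E F \<longleftrightarrow>
     (\<exists>c. \<forall>xs. length xs = n \<longrightarrow>
        (\<exists>ys. rc_eval c [list_encode xs] (list_encode ys) \<and> length ys = n \<and>
             (\<forall>i j. i < j \<and> j < n \<longrightarrow> ((xs ! i, xs ! j) \<in> E \<longleftrightarrow> (ys ! i, ys ! j) \<in> F))))"

definition finitary_reducible :: "(nat \<times> nat) set \<Rightarrow> (nat \<times> nat) set \<Rightarrow> bool" where
  "finitary_reducible E F \<longleftrightarrow>
     (\<exists>c. \<forall>n xs. length xs = n \<longrightarrow>
        (\<exists>ys. rc_eval c [n, list_encode xs] (list_encode ys) \<and> length ys = n \<and>
             (\<forall>i j. i < j \<and> j < n \<longrightarrow> ((xs ! i, xs ! j) \<in> E \<longleftrightarrow> (ys ! i, ys ! j) \<in> F))))"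

definition char0 :: "('a, 'b) ring_scheme \<Rightarrow> bool" where
  "char0 R \<longleftrightarrow> (\<forall>n::nat. n > 0 \<longrightarrow> add_pow R n \<one>\<^bsub>R\<^esub> \<noteq> \<zero>\<^bsub>R\<^esub>)"

definition prime_subfield :: "('a, 'b) ring_scheme \<Rightarrow> 'a set" where
  "prime_subfield R = generate_field R {}"

definition is_Qbar :: "('a, 'b) ring_scheme \<Rightarrow> bool" where
  "is_Qbar R \<longleftrightarrow> algebraically_closed R \<and> char0 R \<and>
     (\<forall>x \<in> carrier R. ring.algebraic R (prime_subfield R) x)"

definition computable_presentation_of_Qbar :: "nat ring \<Rightarrow> bool" where
  "computable_presentation_of_Qbar K \<longleftrightarrow> carrier K = UNIV \<and> is_Qbar K \<and>
     computable2 (ring.add K) \<and> computable2 (monoid.mult K)"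

definition subfield_W :: "nat ring \<Rightarrow> nat \<Rightarrow> nat ring" where
  "subfield_W K e = K\<lparr>carrier := generate_field K (W e)\<rparr>"

definition F_alg :: "nat ring \<Rightarrow> (nat \<times> nat) set" where
  "F_alg K = {(i, j). subfield_W K i \<simeq> subfield_W K j}"

definition alg_independent :: "('a, 'b) ring_scheme \<Rightarrow> 'a set \<Rightarrow> bool" where
  "alg_independent R B \<longleftrightarrow> B \<subseteq> carrier R \<and>
     (\<forall>b \<in> B. ring.transcendental R (generate_field R (B - {b})) b)"

definition transcendence_basis :: "('a, 'b) ring_scheme \<Rightarrow> 'a set \<Rightarrow> bool" where
  "transcendence_basis R B \<longleftrightarrow> alg_independent R B \<and>
     (\<forall>x \<in> carrier R. ring.algebraic R (generate_field R B) x)"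

definition has_trdeg :: "('a, 'b) ring_scheme \<Rightarrow> 'c set \<Rightarrow> bool" where
  "has_trdeg R T \<longleftrightarrow> (\<exists>B. transcendence_basis R B \<and> B \<approx> T)"

definition ACF0_with_trdeg :: "('a, 'b) ring_scheme \<Rightarrow> 'c set \<Rightarrow> bool" where
  "ACF0_with_trdeg R T \<longleftrightarrow> algebraically_closed R \<and> char0 R \<and> has_trdeg R T"

definition F_AC :: "(nat \<Rightarrow> ('a, 'b) ring_scheme) \<Rightarrow> (nat \<times> nat) set" where
  "F_AC L = {(i, j). L i \<simeq> L j}"

end

theory Submission
  imports Defs "HOL-Computational_Algebra.Primes"
begin

text \<open>
  \<^bold>\<open>Algebraic fields.\<close> Every element of a subfield \<open>E\<close> is a root of one of countably many polynomials, each with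
  finitely many roots. By compactness \<open>E\<close> embeds into \<open>F\<close> iff every finite tuple of \<open>E\<close> can be mapped into
  \<open>F\<close> preserving the relations \<open>x + y = z\<close>, \<open>x y = z\<close>, \<open>x = 1\<close>, which is a \<open>\<Pi>\<^sub>2\<close> condition; and mutually
  embeddable fields are isomorphic, since embeddings permute roots. For hardness, a c.e. set \<open>V\<close> is coded into
  the field generated by the square roots of the primes indexed by \<open>V\<close>. Given \<open>n\<close> nodes and a \<open>\<Pi>\<^sub>2\<close> equivalence
  relation approximated from above by c.e. graphs, \<open>V\<close> lists the nodes reachable at every level of approximation.

  \<^bold>\<open>Algebraically closed fields.\<close> By Steinitz, \<open>L\<^sub>i\<close> and \<open>L\<^sub>j\<close> are isomorphic iff the complements of \<open>W\<^sub>i\<close> and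
  \<open>W\<^sub>j\<close> are equinumerous. Such complements realize the cardinality of any \<open>\<Sigma>\<^sub>2\<close> set. Among three nodes there is at most one
  nontrivial class, whose members receive infinite complements. Among four nodes there may be two such
  classes: in the diagonal relation the opponent can only keep pace on a pair by making both
  complements infinite, and doing so on two inequivalent pairs makes all four fields isomorphic.
\<close>

text \<open>The relation that defeats 4-ary reductions has to stay inside the class Pi3.
  Equinumerosity of the complements of two c.e. sets is in general no better than Pi3, so a relation
  that simply contradicted the opponent's answer on a pair would be Sigma3. The diagonal relation
  therefore reacts to finite matches only: that a complement equals a given finite set is Pi2, so a
  finite match is Sigma3 and its absence Pi3. The price is that the opponent survives on one pair by
  making both complements infinite; a second pair takes this escape away, hence the number 4. The
  positive results meet a different obstacle: a complement is only Pi1, while the sizes wanted are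
  those of Sigma2 sets, so an existential witness must be made unique before it can be projected
  away without changing the count. Inductive definitions are treated once and for all: what has
  finite derivations from c.e. rules is c.e. Program evaluation, field generation and reachability
  are instances.\<close>

section \<open>Computable functions on coded tuples\<close>

text \<open>Closure rules whose conclusions match terms built by composition, so that
  \<open>intro comp\<close> proves computability, decidability or enumerability by following the
  syntax.\<close>

named_theorems comp

abbreviation pfst :: "nat \<Rightarrow> nat" where "pfst p \<equiv> fst (prod_decode p)"
abbreviation psnd :: "nat \<Rightarrow> nat" where "psnd p \<equiv> snd (prod_decode p)"
abbreviation pair :: "nat \<Rightarrow> nat \<Rightarrow> nat" where "pair a b \<equiv> prod_encode (a, b)"

lemma pair_collapse [simp]: "pair (pfst p) (psnd p) = p"
  by simp

lemma rc_eval_Comp1: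
  "\<lbrakk> rc_eval g xs y; rc_eval f [y] z \<rbrakk> \<Longrightarrow> rc_eval (Comp f [g]) xs z"
  by (rule rc_eval.comp[where ys="[y]"]) auto

lemma rc_eval_Comp2:
  "\<lbrakk> rc_eval g1 xs y1; rc_eval g2 xs y2; rc_eval f [y1, y2] z \<rbrakk> \<Longrightarrow> rc_eval (Comp f [g1, g2]) xs z"
  by (rule rc_eval.comp[where ys="[y1, y2]"]) (auto simp: less_Suc_eq)

lemma rc_eval_Proj: "i < length xs \<Longrightarrow> y = xs ! i \<Longrightarrow> rc_eval (Proj i) xs y"
  using rc_eval.proj by simp

lemma computable1_id [comp]: "computable1 (\<lambda>x. x)"
  unfolding computable1_def by (rule exI[of _ "Proj 0"]) (auto intro: rc_eval_Proj)

text \<open>Beyond supplying constants, numeral programs let \<open>ce_index\<close> wire a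
  parameter into a program.\<close>

primrec const_code :: "nat \<Rightarrow> rcode" where
  "const_code 0 = Z"
| "const_code (Suc n) = Comp S [const_code n]"

lemma rc_eval_const_code: "rc_eval (const_code n) xs n"
  by (induction n) (auto intro: rc_eval.intros rc_eval_Comp1)

lemma computable1_const [comp]: "computable1 (\<lambda>x. n)"
  unfolding computable1_def using rc_eval_const_code by blast

lemma computable1_compose:
  assumes "computable1 h" "computable1 f" shows "computable1 (\<lambda>x. h (f x))"
  using assms unfolding computable1_def by (meson rc_eval_Comp1)

lemma computable1_compose2:
  assumes "computable2 h" "computable1 f" "computable1 g" shows "computable1 (\<lambda>x. h (f x) (g x))"
  using assms unfolding computable1_def computable2_def by (meson rc_eval_Comp2)

lemma computable1_Suc [comp]:
  assumes "computable1 f" shows "computable1 (\<lambda>x. Suc (f x))"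
  using assms unfolding computable1_def by (meson rc_eval_Comp1 rc_eval.succ)

lemma computable2_compose1:
  assumes "computable1 h" "computable2 f" shows "computable2 (\<lambda>x y. h (f x y))"
  using assms unfolding computable1_def computable2_def by (meson rc_eval_Comp1)

lemma computable2_compose2:
  assumes "computable2 h" "computable2 f" "computable2 g" shows "computable2 (\<lambda>x y. h (f x y) (g x y))"
  using assms unfolding computable2_def by (meson rc_eval_Comp2)

lemma computable2_proj1: "computable2 (\<lambda>x y. x)"
  unfolding computable2_def by (rule exI[of _ "Proj 0"]) (auto intro: rc_eval_Proj)

lemma computable2_proj2: "computable2 (\<lambda>x y. y)"
  unfolding computable2_def by (rule exI[of _ "Proj 1"]) (auto intro: rc_eval_Proj)

lemma computable2_const: "computable2 (\<lambda>x y. n)"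
  by (rule computable2_compose1[OF computable1_const computable2_proj1])

lemma computable1_rec_nat_const:
  assumes "computable2 g" shows "computable1 (\<lambda>n. rec_nat a (\<lambda>k r. g r k) n)"
proof -
  from assms obtain c where c: "\<And>r k. rc_eval c [r, k] (g r k)" unfolding computable2_def by blast
  have "rc_eval (Prim (const_code a) c) [n] (rec_nat a (\<lambda>k r. g r k) n)" for n
  proof (induction n)
    case 0 show ?case using rc_eval.prim0[OF rc_eval_const_code] by simp
  next
    case (Suc n) show ?case using rc_eval.primS[OF Suc] c by simp
  qed
  thus ?thesis unfolding computable1_def by blast
qed

text \<open>The step depends on the parameter \<open>x\<close> as well and so has three arguments,
  one more than \<open>computable2\<close> covers; hence its program \<open>c\<close> is given
  outright.\<close>

lemma computable2_rec_nat_ternary: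
  assumes "computable1 f" and g: "\<And>r k x. rc_eval c [r, k, x] (g r k x)"
  shows "computable2 (\<lambda>n x. rec_nat (f x) (\<lambda>k r. g r k x) n)"
proof -
  from assms obtain d where d: "\<And>x. rc_eval d [x] (f x)" unfolding computable1_def by blast
  have "rc_eval (Prim d c) [n, x] (rec_nat (f x) (\<lambda>k r. g r k x) n)" for n x
  proof (induction n)
    case 0 show ?case using rc_eval.prim0[OF d] by simp
  next
    case (Suc n) show ?case using rc_eval.primS[OF Suc] g by simp
  qed
  thus ?thesis unfolding computable2_def by blast
qed

lemma computable2_add: "computable2 (+)"
proof -
  have "rc_eval (Comp S [Proj 0]) [r, k, x] (Suc r)" for r k x
    by (rule rc_eval_Comp1[OF rc_eval_Proj rc_eval.succ]) auto
  from computable2_rec_nat_ternary[OF computable1_id this]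
  have "computable2 (\<lambda>n x. rec_nat x (\<lambda>k r. Suc r) n)" .
  moreover have "rec_nat x (\<lambda>k r. Suc r) n = n + x" for n x :: nat by (induction n) auto
  ultimately show ?thesis by simp
qed

lemma computable2_mult: "computable2 (*)"
proof -
  obtain c where c: "\<And>x y. rc_eval c [x, y] (x + y)" using computable2_add unfolding computable2_def by blast
  have "rc_eval (Comp c [Proj 0, Proj 2]) [r, k, x] (r + x)" for r k x
    by (rule rc_eval_Comp2[OF rc_eval_Proj rc_eval_Proj c]) auto
  from computable2_rec_nat_ternary[OF computable1_const this]
  have "computable2 (\<lambda>n x. rec_nat 0 (\<lambda>k r. r + x) n)" .
  moreover have "rec_nat 0 (\<lambda>k r. r + x) n = n * x" for n x :: nat by (induction n) auto
  ultimately show ?thesis by simp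
qed

lemma computable1_pred: "computable1 (\<lambda>n. n - 1)"
proof -
  have "rec_nat 0 (\<lambda>k r. k) n = n - 1" for n :: nat by (cases n) auto
  thus ?thesis using computable1_rec_nat_const[OF computable2_proj2, of 0] by simp
qed

lemma computable2_diff: "computable2 (-)"
proof -
  obtain c where c: "\<And>x. rc_eval c [x] (x - 1)" using computable1_pred unfolding computable1_def by blast
  have "rc_eval (Comp c [Proj 0]) [r, k, x] (r - 1)" for r k x
    by (rule rc_eval_Comp1[OF rc_eval_Proj c]) auto
  \<comment> \<open>\<open>Prim\<close> recurses on the first argument, so subtraction arises with
    its arguments exchanged and is turned round at the end.\<close>
  from computable2_rec_nat_ternary[OF computable1_id this]
  have "computable2 (\<lambda>n x. rec_nat x (\<lambda>k r. r - 1) n)" .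
  moreover have "rec_nat x (\<lambda>k r. r - 1) n = x - n" for n x :: nat by (induction n) auto
  ultimately have "computable2 (\<lambda>n x :: nat. x - n)" by simp
  from computable2_compose2[OF this computable2_proj2 computable2_proj1] show ?thesis .
qed

lemmas computable1_add [comp] = computable1_compose2[OF computable2_add]
lemmas computable1_mult [comp] = computable1_compose2[OF computable2_mult]
lemmas computable1_diff [comp] = computable1_compose2[OF computable2_diff]

section \<open>Decidable predicates\<close>

definition dec :: "(nat \<Rightarrow> bool) \<Rightarrow> bool" where
  "dec P \<longleftrightarrow> computable1 (\<lambda>x. of_bool (P x))"

lemma dec_le [comp]:
  assumes "computable1 f" "computable1 g" shows "dec (\<lambda>x. f x \<le> g x)"
proof -
  have eq: "of_bool (f x \<le> g x) = 1 - (f x - g x)" for x by auto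
  show ?thesis unfolding dec_def eq by (intro comp assms)
qed

lemma dec_not [comp]: "dec P \<Longrightarrow> dec (\<lambda>x. \<not> P x)"
proof -
  assume P: "dec P"
  have eq: "(of_bool (\<not> P x) :: nat) = 1 - of_bool (P x)" for x by auto
  show "dec (\<lambda>x. \<not> P x)" unfolding dec_def eq by (intro comp P[unfolded dec_def])
qed

lemma dec_conj [comp]: "dec P \<Longrightarrow> dec Q \<Longrightarrow> dec (\<lambda>x. P x \<and> Q x)"
proof -
  assume PQ: "dec P" "dec Q"
  have eq: "(of_bool (P x \<and> Q x) :: nat) = of_bool (P x) * of_bool (Q x)" for x by auto
  show "dec (\<lambda>x. P x \<and> Q x)" unfolding dec_def eq by (intro comp PQ[unfolded dec_def])
qed

lemma dec_disj [comp]: "dec P \<Longrightarrow> dec Q \<Longrightarrow> dec (\<lambda>x. P x \<or> Q x)"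
  using dec_not[OF dec_conj[OF dec_not[of P] dec_not[of Q]]] by simp

lemma dec_imp [comp]: "dec P \<Longrightarrow> dec Q \<Longrightarrow> dec (\<lambda>x. P x \<longrightarrow> Q x)"
  unfolding imp_conv_disj by (intro comp)

lemma dec_less [comp]:
  assumes "computable1 f" "computable1 g" shows "dec (\<lambda>x. f x < g x)"
  using dec_not[OF dec_le[OF assms(2,1)]] by (simp add: not_le)

lemma dec_eq [comp]:
  assumes "computable1 f" "computable1 g" shows "dec (\<lambda>x. f x = g x)"
  using dec_conj[OF dec_le[OF assms] dec_le[OF assms(2,1)]] by (simp add: eq_iff)

lemma computable1_if [comp]:
  assumes "dec P" "computable1 f" "computable1 g"
  shows "computable1 (\<lambda>x. if P x then f x else g x)"
proof -
  have eq: "(if P x then f x else g x) = of_bool (P x) * f x + (1 - of_bool (P x)) * g x" for x by auto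
  show ?thesis unfolding eq by (intro comp assms assms(1)[unfolded dec_def])
qed

lemma dec_compose: "dec P \<Longrightarrow> computable1 f \<Longrightarrow> dec (\<lambda>x. P (f x))"
  unfolding dec_def by (rule computable1_compose)

section \<open>Inverting the Cantor pairing function\<close>

lemma computable1_triangle: "computable1 triangle"
proof -
  have "computable2 (\<lambda>r k. r + (1 + k) :: nat)"
    by (intro computable2_compose2[OF computable2_add] computable2_proj1 computable2_proj2
        computable2_const)
  from computable1_rec_nat_const[OF this, of 0]
  have "computable1 (rec_nat 0 (\<lambda>k r. r + (1 + k)))" .
  moreover have "rec_nat 0 (\<lambda>k r. r + (1 + k)) n = triangle n" for n by (induction n) auto
  ultimately show ?thesis by (metis (no_types, lifting) ext)
qed

lemma computable2_prod_encode: "computable2 (\<lambda>a b. pair a b)"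
  unfolding prod_encode_def prod.case
  by (intro computable2_compose2[OF computable2_add] computable2_proj1 computable2_proj2
        computable2_compose1[OF computable1_triangle])

lemmas computable1_pair [comp] = computable1_compose2[OF computable2_prod_encode]

lemma triangle_mono: "m \<le> n \<Longrightarrow> triangle m \<le> triangle n"
  by (induction n) (auto simp: le_Suc_eq)

text \<open>\<open>prod_encode (a, b)\<close> is \<open>triangle (a + b) + a\<close>, so
  \<open>diag p\<close> is the index of the antidiagonal through \<open>p\<close>, the largest
  \<open>k\<close> with \<open>triangle k \<le> p\<close>. It obeys a recursion in \<open>p\<close>,
  and both components follow from it by subtraction.\<close>

definition diag :: "nat \<Rightarrow> nat" where "diag p = pfst p + psnd p"

lemma triangle_diag: "triangle (diag p) \<le> p" "p < triangle (Suc (diag p))"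
proof -
  have "p = triangle (diag p) + pfst p"
    using prod_decode_inverse[of p] unfolding prod_encode_def diag_def by (simp add: split_beta)
  thus "triangle (diag p) \<le> p" "p < triangle (Suc (diag p))" unfolding diag_def by auto
qed

lemma diag_unique: "triangle k \<le> p \<Longrightarrow> p < triangle (Suc k) \<Longrightarrow> diag p = k"
proof -
  assume k: "triangle k \<le> p" "p < triangle (Suc k)"
  have "\<not> Suc k \<le> diag p" using triangle_mono[of "Suc k" "diag p"] triangle_diag(1)[of p] k by linarith
  moreover have "\<not> Suc (diag p) \<le> k" using triangle_mono[of "Suc (diag p)" k] triangle_diag(2)[of p] k by linarith
  ultimately show "diag p = k" by linarith
qed

lemma diag_Suc: "diag (Suc p) = (if triangle (Suc (diag p)) = Suc p then Suc (diag p) else diag p)"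
  using triangle_diag[of p] by (auto intro!: diag_unique)

lemma computable1_diag: "computable1 diag"
proof -
  \<comment> \<open>The rules for binary functions know only arithmetic, so the case distinction is
    written with truncated differences, whose sum is 0 exactly when the two numbers agree.\<close>
  have eq: "(if triangle (Suc r) = Suc p then Suc r else r)
      = r + (1 - ((triangle (Suc r) - Suc p) + (Suc p - triangle (Suc r))))" for r p
    by auto
  have "computable2 (\<lambda>r p. if triangle (Suc r) = Suc p then Suc r else r)"
    unfolding eq
    by (intro computable2_compose2[OF computable2_add] computable2_proj1 computable2_proj2
        computable2_compose1[OF computable1_triangle] computable2_compose2[OF computable2_diff]
        computable2_const computable2_compose1[OF computable1_Suc[OF computable1_id]])
  from computable1_rec_nat_const[OF this, of 0]
  have "computable1 (rec_nat 0 (\<lambda>p r. if triangle (Suc r) = Suc p then Suc r else r))" .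
  moreover have "rec_nat 0 (\<lambda>p r. if triangle (Suc r) = Suc p then Suc r else r) p = diag p" for p
  proof (induction p)
    case 0
    have "diag 0 = 0" by (rule diag_unique) auto
    then show ?case by simp
  next
    case (Suc p) thus ?case by (simp add: diag_Suc del: triangle_Suc)
  qed
  ultimately show ?thesis by (metis (no_types, lifting) ext)
qed

lemma computable1_pfst_id: "computable1 (\<lambda>p. pfst p)"
proof -
  have eq: "pfst p = p - triangle (diag p)" for p
    using prod_decode_inverse[of p] unfolding prod_encode_def diag_def by (simp add: split_beta)
  show ?thesis unfolding eq
    by (intro comp computable1_compose[OF computable1_triangle] computable1_diag)
qed

lemmas computable1_pfst [comp] = computable1_compose[OF computable1_pfst_id]

lemma computable1_psnd_id: "computable1 (\<lambda>p. psnd p)"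
proof -
  have "psnd p = diag p - pfst p" for p unfolding diag_def by simp
  moreover have "computable1 (\<lambda>p. diag p - pfst p)" by (intro comp computable1_diag)
  ultimately show ?thesis by simp
qed

lemmas computable1_psnd [comp] = computable1_compose[OF computable1_psnd_id]

lemma computable2_iff: "computable2 h \<longleftrightarrow> computable1 (\<lambda>p. h (pfst p) (psnd p))"
proof
  assume "computable2 h"
  from computable1_compose2[OF this] show "computable1 (\<lambda>p. h (pfst p) (psnd p))"
    using computable1_pfst_id computable1_psnd_id by blast
next
  assume "computable1 (\<lambda>p. h (pfst p) (psnd p))"
  from computable2_compose1[OF this computable2_prod_encode] show "computable2 h" by simp
qed

text \<open>The step sees counter, accumulator and parameter and is presented as a unary function of
  the coded triple; this brings recursion with parameters within reach of
  \<open>comp\<close>.\<close>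

lemma computable1_rec_nat [comp]:
  assumes "computable1 f" "computable1 h" "computable1 (\<lambda>q. g (pfst q) (pfst (psnd q)) (psnd (psnd q)))"
  shows "computable1 (\<lambda>x. rec_nat (f x) (\<lambda>k r. g k r x) (h x))"
proof -
  obtain c where c: "\<And>q. rc_eval c [q] (g (pfst q) (pfst (psnd q)) (psnd (psnd q)))"
    using assms(3) unfolding computable1_def by blast
  obtain d where d: "\<And>x y. rc_eval d [x, y] (pair x y)"
    using computable2_prod_encode unfolding computable2_def by blast
  have "rc_eval (Comp c [Comp d [Proj 1, Comp d [Proj 0, Proj 2]]]) [r, k, x] (g k r x)" for r k x
    using c[of "pair k (pair r x)"]
    by (auto intro!: rc_eval_Comp1 rc_eval_Comp2 rc_eval_Proj d)
  from computable1_compose2[OF computable2_rec_nat_ternary[OF assms(1) this] assms(2) computable1_id]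
  show ?thesis .
qed

lemma dec_bex [comp]:
  assumes "dec (\<lambda>p. P (pfst p) (psnd p))" "computable1 h"
  shows "dec (\<lambda>x. \<exists>k<h x. P k x)"
proof -
  have "(rec_nat 0 (\<lambda>k r. if P k x then 1 else r) n :: nat) = of_bool (\<exists>k<n. P k x)" for x n
    by (induction n) (auto simp: less_Suc_eq)
  moreover have "dec (\<lambda>q. P (pfst q) (psnd (psnd q)))"
    using dec_compose[OF assms(1), of "\<lambda>q. pair (pfst q) (psnd (psnd q))"]
    by (simp add: comp)
  hence "computable1 (\<lambda>x. rec_nat 0 (\<lambda>k r. if P k x then 1 else r) (h x))"
    by (intro comp assms(2))
  ultimately show ?thesis unfolding dec_def by presburger
qed

lemma dec_ball [comp]:
  assumes "dec (\<lambda>p. P (pfst p) (psnd p))" "computable1 h"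
  shows "dec (\<lambda>x. \<forall>k<h x. P k x)"
  using dec_not[OF dec_bex[OF dec_not[OF assms(1)] assms(2)]] by simp

lemma computable1_Least:
  assumes "dec (\<lambda>p. P (pfst p) (psnd p))" and ex: "\<And>x. \<exists>k. P k x"
  shows "computable1 (\<lambda>x. LEAST k. P k x)"
proof -
  \<comment> \<open>\<open>Mn\<close> searches for a zero, so it is run on the characteristic
    function of the negation.\<close>
  from dec_not[OF assms(1)] obtain c where c: "\<And>q. rc_eval c [q] (of_bool (\<not> P (pfst q) (psnd q)))"
    unfolding dec_def computable1_def by blast
  obtain d where d: "\<And>x y. rc_eval d [x, y] (pair x y)"
    using computable2_prod_encode unfolding computable2_def by blast
  have e: "rc_eval (Comp c [d]) [k, x] (of_bool (\<not> P k x))" for k x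
    using c[of "pair k x"] by (auto intro!: rc_eval_Comp1 d)
  have "rc_eval (Mn (Comp c [d])) [x] (LEAST k. P k x)" for x
  proof (rule rc_eval.mn)
    have "P (LEAST k. P k x) x" by (rule LeastI_ex[OF ex])
    thus "rc_eval (Comp c [d]) [LEAST k. P k x, x] 0" using e[of "LEAST k. P k x" x] by simp
    show "\<forall>m<LEAST k. P k x. \<exists>y>0. rc_eval (Comp c [d]) [m, x] y"
      using e[of _ x] not_less_Least[of _ "\<lambda>k. P k x"] by (metis of_bool_eq(2) zero_less_one)
  qed
  thus ?thesis unfolding computable1_def by blast
qed

section \<open>Lists coded by numbers\<close>

definition clen :: "nat \<Rightarrow> nat" where "clen l = length (list_decode l)"
text \<open>Reading past the end gives 0. Access is thus total, and lists of witnesses can be read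
  without checking their length.\<close>

definition cnth :: "nat \<Rightarrow> nat \<Rightarrow> nat" where
  "cnth l i = (if i < clen l then list_decode l ! i else 0)"

text \<open>On codes of lists, \<open>psnd (r - 1)\<close> is the tail; the empty list, coded by 0, is its own tail.\<close>
definition cdrop :: "nat \<Rightarrow> nat \<Rightarrow> nat" where "cdrop i l = rec_nat l (\<lambda>_ r. psnd (r - 1)) i"

lemma prod_decode_0: "prod_decode 0 = (0, 0)"
  by (simp add: prod_decode_def prod_decode_aux.simps)

lemma list_decode_psnd: "list_decode (psnd (l - 1)) = tl (list_decode l)"
  by (cases l) (simp_all add: prod_decode_0 split_beta)

lemma list_decode_cdrop: "list_decode (cdrop i l) = drop i (list_decode l)"
  by (induction i) (auto simp: cdrop_def list_decode_psnd drop_Suc tl_drop simp del: One_nat_def)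

lemma list_decode_eq_Nil: "list_decode l = [] \<longleftrightarrow> l = 0"
  by (metis list_decode.simps(1) list_decode_inverse)

lemma cdrop_eq_0: "cdrop i l = 0 \<longleftrightarrow> clen l \<le> i"
  using list_decode_cdrop[of i l] list_decode_eq_Nil[of "cdrop i l"] unfolding clen_def by auto

lemma computable1_cdrop [comp]:
  assumes "computable1 f" "computable1 g" shows "computable1 (\<lambda>x. cdrop (f x) (g x))"
  unfolding cdrop_def by (intro comp assms)

lemma computable1_clen_id: "computable1 clen"
proof -
  have "clen l = (LEAST i. cdrop i l = 0)" for l
    unfolding cdrop_eq_0 by (rule Least_equality[symmetric]) auto
  moreover have "computable1 (\<lambda>l. LEAST i. cdrop i l = 0)"
  proof (rule computable1_Least)
    show "dec (\<lambda>p. cdrop (pfst p) (psnd p) = 0)" by (intro comp)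
    show "\<exists>i. cdrop i l = 0" for l unfolding cdrop_eq_0 by auto
  qed
  ultimately show ?thesis by presburger
qed

lemmas computable1_clen [comp] = computable1_compose[OF computable1_clen_id]

text \<open>The default 0 of \<open>cnth\<close> is what the arithmetic yields on the code of the
  empty list, so one formula covers both cases.\<close>

lemma cnth_eq: "cnth l i = pfst (cdrop i l - 1)"
proof (cases "i < clen l")
  case True
  then obtain n where n: "cdrop i l = Suc n" using cdrop_eq_0[of i l] by (meson leD not0_implies_Suc)
  have "list_decode (cdrop i l) ! 0 = list_decode l ! i"
    unfolding list_decode_cdrop using True unfolding clen_def by simp
  thus ?thesis using n True by (simp add: cnth_def split_beta)
next
  case False
  then have "cdrop i l = 0" using cdrop_eq_0[of i l] by simp
  thus ?thesis using False by (simp add: cnth_def prod_decode_0)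
qed

lemma computable1_cnth [comp]:
  assumes "computable1 f" "computable1 g" shows "computable1 (\<lambda>x. cnth (f x) (g x))"
  unfolding cnth_eq by (intro comp assms)

definition ccons :: "nat \<Rightarrow> nat \<Rightarrow> nat" where "ccons x l = Suc (pair x l)"

lemma ccons_list_encode [simp]: "ccons x (list_encode xs) = list_encode (x # xs)"
  by (simp add: ccons_def)

lemma list_decode_ccons [simp]: "list_decode (ccons x l) = x # list_decode l"
  by (simp add: ccons_def)

lemma computable1_ccons [comp]:
  assumes "computable1 f" "computable1 g" shows "computable1 (\<lambda>x. ccons (f x) (g x))"
  unfolding ccons_def by (intro comp assms)

lemma clen_list_encode [simp]: "clen (list_encode xs) = length xs"
  by (simp add: clen_def)

lemma cnth_list_encode [simp]: "i < length xs \<Longrightarrow> cnth (list_encode xs) i = xs ! i"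
  by (simp add: cnth_def)

lemma computable1_list_encode_map [comp]:
  assumes "computable1 (\<lambda>p. F (pfst p) (psnd p))" "computable1 h"
  shows "computable1 (\<lambda>x. list_encode (map (\<lambda>i. F i x) [0..<h x]))"
proof -
  \<comment> \<open>Consing builds a list from its right end: stage \<open>k\<close> adds entry
    \<open>n - Suc k\<close>, so \<open>m\<close> stages produce the last \<open>m\<close>
    entries.\<close>
  have eq: "rec_nat 0 (\<lambda>k r. ccons (F (n - Suc k) x) r) m = list_encode (map (\<lambda>i. F i x) [n - m..<n])"
    if "m \<le> n" for n m x
    using that
  proof (induction m)
    case (Suc m)
    hence "[n - Suc m..<n] = (n - Suc m) # [n - m..<n]"
      by (metis Suc_diff_Suc Suc_le_lessD diff_Suc_less le_zero_eq not_less upt_rec zero_less_Suc)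
    with Suc show ?case by (simp del: upt_Suc)
  qed simp
  have "computable1 (\<lambda>q. F (h (psnd (psnd q)) - Suc (pfst q)) (psnd (psnd q)))"
    using computable1_compose[OF assms(1), of "\<lambda>q. pair (h (psnd (psnd q)) - Suc (pfst q)) (psnd (psnd q))"]
    by (simp add: comp computable1_compose[OF assms(2)])
  hence "computable1 (\<lambda>x. rec_nat 0 (\<lambda>k r. ccons (F (h x - Suc k) x) r) (h x))"
    by (intro comp assms(2))
  thus ?thesis using eq by simp
qed

section \<open>Computably enumerable predicates\<close>

text \<open>Projections of decidable relations. Membership in \<open>W e\<close> is of this kind by
  \<open>ce_W\<close>, and \<open>ce_index\<close> shows conversely that every such predicate has an
  index.\<close>

definition ce :: "(nat \<Rightarrow> bool) \<Rightarrow> bool" where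
  "ce P \<longleftrightarrow> (\<exists>Q. dec (\<lambda>p. Q (pfst p) (psnd p)) \<and> (\<forall>x. P x \<longleftrightarrow> (\<exists>w. Q w x)))"

lemma ceI: "dec (\<lambda>p. Q (pfst p) (psnd p)) \<Longrightarrow> (\<And>x. P x \<longleftrightarrow> (\<exists>w. Q w x)) \<Longrightarrow> ce P"
  unfolding ce_def by blast

lemma ceE:
  assumes "ce P"
  obtains Q where "dec (\<lambda>p. Q (pfst p) (psnd p))" "\<And>x. P x \<longleftrightarrow> (\<exists>w. Q w x)"
  using assms unfolding ce_def by blast

lemma dec_compose2:
  assumes "dec (\<lambda>p. Q (pfst p) (psnd p))" "computable1 f" "computable1 g"
  shows "dec (\<lambda>x. Q (f x) (g x))"
  using dec_compose[OF assms(1) computable1_pair[OF assms(2,3)]] by simp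

lemma dec_imp_ce: "dec P \<Longrightarrow> ce P"
  by (rule ceI[where Q="\<lambda>w. P"]) (auto intro: dec_compose computable1_psnd_id)

lemmas ce_eq [comp] = dec_imp_ce[OF dec_eq]
lemmas ce_less [comp] = dec_imp_ce[OF dec_less]
lemmas ce_neq [comp] = dec_imp_ce[OF dec_not[OF dec_eq]]

lemma ce_compose:
  assumes "ce P" "computable1 f" shows "ce (\<lambda>x. P (f x))"
proof -
  obtain Q where Q: "dec (\<lambda>p. Q (pfst p) (psnd p))" "\<And>x. P x \<longleftrightarrow> (\<exists>w. Q w x)"
    by (rule ceE[OF assms(1)]) blast
  show ?thesis
    by (rule ceI[where Q="\<lambda>w x. Q w (f x)"])
       (use Q(2) in \<open>auto intro!: dec_compose2[OF Q(1)] computable1_compose[OF assms(2)] comp\<close>)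
qed

lemma ce_compose2:
  assumes "ce (\<lambda>p. P (pfst p) (psnd p))" "computable1 f" "computable1 g"
  shows "ce (\<lambda>x. P (f x) (g x))"
  using ce_compose[OF assms(1) computable1_pair[OF assms(2,3)]] by simp

lemma ex_pair: "(\<exists>w. R (pfst w) (psnd w)) \<longleftrightarrow> (\<exists>a b. R a b)"
  by (metis fst_conv snd_conv prod_encode_inverse)

lemma ce_conj [comp]:
  assumes "ce P" "ce P'" shows "ce (\<lambda>x. P x \<and> P' x)"
proof -
  obtain Q where Q: "dec (\<lambda>p. Q (pfst p) (psnd p))" "\<And>x. P x \<longleftrightarrow> (\<exists>w. Q w x)"
    by (rule ceE[OF assms(1)]) blast
  obtain Q' where Q': "dec (\<lambda>p. Q' (pfst p) (psnd p))" "\<And>x. P' x \<longleftrightarrow> (\<exists>w. Q' w x)"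
    by (rule ceE[OF assms(2)]) blast
  show ?thesis
  proof (rule ceI)
    show "dec (\<lambda>p. Q (pfst (pfst p)) (psnd p) \<and> Q' (psnd (pfst p)) (psnd p))"
      by (intro comp dec_compose2[OF Q(1)] dec_compose2[OF Q'(1)])
    show "P x \<and> P' x \<longleftrightarrow> (\<exists>w. Q (pfst w) x \<and> Q' (psnd w) x)" for x
      unfolding Q(2) Q'(2) ex_pair[of "\<lambda>a b. Q a x \<and> Q' b x"] by blast
  qed
qed

lemma ce_ex [comp]:
  assumes "ce (\<lambda>p. P (pfst p) (psnd p))" shows "ce (\<lambda>x. \<exists>k. P k x)"
proof -
  obtain Q where Q: "dec (\<lambda>p. Q (pfst p) (psnd p))" "\<And>x. P (pfst x) (psnd x) \<longleftrightarrow> (\<exists>w. Q w x)"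
    by (rule ceE[OF assms(1)]) blast
  show ?thesis
  proof (rule ceI)
    show "dec (\<lambda>p. Q (pfst (pfst p)) (pair (psnd (pfst p)) (psnd p)))"
      by (intro comp dec_compose2[OF Q(1)])
    have "P k x \<longleftrightarrow> (\<exists>w. Q w (pair k x))" for k x using Q(2)[of "pair k x"] by simp
    thus "(\<exists>k. P k x) \<longleftrightarrow> (\<exists>w. Q (pfst w) (pair (psnd w) x))" for x
      unfolding ex_pair[of "\<lambda>a b. Q a (pair b x)"] by blast
  qed
qed

lemma ce_disj [comp]:
  assumes "ce P" "ce P'" shows "ce (\<lambda>x. P x \<or> P' x)"
proof -
  obtain Q where Q: "dec (\<lambda>p. Q (pfst p) (psnd p))" "\<And>x. P x \<longleftrightarrow> (\<exists>w. Q w x)"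
    by (rule ceE[OF assms(1)]) blast
  obtain Q' where Q': "dec (\<lambda>p. Q' (pfst p) (psnd p))" "\<And>x. P' x \<longleftrightarrow> (\<exists>w. Q' w x)"
    by (rule ceE[OF assms(2)]) blast
  show ?thesis
  proof (rule ceI)
    show "dec (\<lambda>p. Q (pfst p) (psnd p) \<or> Q' (pfst p) (psnd p))"
      by (intro comp Q Q')
    show "P x \<or> P' x \<longleftrightarrow> (\<exists>w. Q w x \<or> Q' w x)" for x
      unfolding Q(2) Q'(2) by blast
  qed
qed

lemma ce_bex [comp]:
  assumes "ce (\<lambda>p. P (pfst p) (psnd p))" "computable1 h"
  shows "ce (\<lambda>x. \<exists>k<h x. P k x)"
  by (intro comp assms computable1_compose[OF assms(2)])

text \<open>Finitely many searches are one search for the coded list of their witnesses.\<close>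

lemma ce_ball [comp]:
  assumes "ce (\<lambda>p. P (pfst p) (psnd p))" "computable1 h"
  shows "ce (\<lambda>x. \<forall>k<h x. P k x)"
proof -
  obtain Q where Q: "dec (\<lambda>p. Q (pfst p) (psnd p))" "\<And>x. P (pfst x) (psnd x) \<longleftrightarrow> (\<exists>w. Q w x)"
    by (rule ceE[OF assms(1)]) blast
  have PQ: "P k x \<longleftrightarrow> (\<exists>w. Q w (pair k x))" for k x using Q(2)[of "pair k x"] by simp
  show ?thesis
  proof (rule ceI)
    show "dec (\<lambda>p. \<forall>k<h (psnd p). Q (cnth (pfst p) k) (pair k (psnd p)))"
      by (intro comp dec_compose2[OF Q(1)] computable1_compose[OF assms(2)])
    show "(\<forall>k<h x. P k x) \<longleftrightarrow> (\<exists>w. \<forall>k<h x. Q (cnth w k) (pair k x))" for x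
    proof
      assume "\<forall>k<h x. P k x"
      then have "\<forall>k. \<exists>w. k < h x \<longrightarrow> Q w (pair k x)" using PQ by blast
      then obtain w where "\<forall>k. k < h x \<longrightarrow> Q (w k) (pair k x)" by metis
      then show "\<exists>w. \<forall>k<h x. Q (cnth w k) (pair k x)"
        by (intro exI[of _ "list_encode (map w [0..<h x])"]) auto
    qed (use PQ in blast)
  qed
qed

section \<open>Inductively generated predicates\<close>

inductive derivable :: "(nat \<Rightarrow> nat \<Rightarrow> bool) \<Rightarrow> nat \<Rightarrow> bool" for Step where
  step: "\<forall>y \<in> set (list_decode l). derivable Step y \<Longrightarrow> Step l x \<Longrightarrow> derivable Step x"

text \<open>A proof written backwards: an entry pairs a conclusion with its list of premises, and
  the premises are conclusions further down the list. Hence proofs can be concatenated and a final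
  inference can be consed on.\<close>

fun derivation :: "(nat \<Rightarrow> nat \<Rightarrow> bool) \<Rightarrow> nat list \<Rightarrow> bool" where
  "derivation Step [] \<longleftrightarrow> True"
| "derivation Step (p # ts) \<longleftrightarrow> derivation Step ts \<and> Step (psnd p) (pfst p) \<and>
     set (list_decode (psnd p)) \<subseteq> pfst ` set ts"

lemma derivation_append: "derivation Step xs \<Longrightarrow> derivation Step ys \<Longrightarrow> derivation Step (xs @ ys)"
  by (induction xs) auto

lemma derivation_imp_derivable: "derivation Step ts \<Longrightarrow> p \<in> set ts \<Longrightarrow> derivable Step (pfst p)"
proof (induction ts arbitrary: p)
  case (Cons q ts)
  show ?case
  proof (cases "p = q")
    case True
    have "\<forall>y\<in>set (list_decode (psnd q)). derivable Step y" using Cons by auto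
    with True Cons.prems(1) show ?thesis by (auto intro: derivable.step)
  qed (use Cons in auto)
qed simp

lemma derivable_imp_derivation: "derivable Step x \<Longrightarrow> \<exists>ts. derivation Step ts \<and> x \<in> pfst ` set ts"
proof (induction rule: derivable.induct)
  case (step l x)
  \<comment> \<open>The separate proofs of the premises are merged into a single one by induction
    along the premise list.\<close>
  have "\<exists>ts. derivation Step ts \<and> set ys \<subseteq> pfst ` set ts" if "set ys \<subseteq> set (list_decode l)" for ys
    using that
  proof (induction ys)
    case (Cons y ys)
    then obtain ts ts' where "derivation Step ts" "set ys \<subseteq> pfst ` set ts"
      "derivation Step ts'" "y \<in> pfst ` set ts'" using step.IH by (metis insert_subset list.simps(15))
    thus ?case by (intro exI[of _ "ts @ ts'"]) (auto simp: derivation_append)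
  qed (auto intro: exI[of _ "[]"])
  then obtain ts where "derivation Step ts" "set (list_decode l) \<subseteq> pfst ` set ts" by blast
  with step.hyps show ?case by (intro exI[of _ "pair x l # ts"]) auto
qed

text \<open>Only quantifiers bounded by lengths remain, the form that \<open>ce_ball\<close> and
  \<open>ce_bex\<close> can process.\<close>

lemma derivation_iff_nth:
  "derivation Step ts \<longleftrightarrow> (\<forall>k<length ts. Step (psnd (ts ! k)) (pfst (ts ! k)) \<and>
     (\<forall>i<length (list_decode (psnd (ts ! k))). \<exists>m<length ts. k < m \<and> pfst (ts ! m) = list_decode (psnd (ts ! k)) ! i))"
proof (induction ts)
  case (Cons p ts)
  have "set (list_decode (psnd p)) \<subseteq> pfst ` set ts \<longleftrightarrow>
    (\<forall>i<length (list_decode (psnd p)). \<exists>m<length ts. pfst (ts ! m) = list_decode (psnd p) ! i)"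
    unfolding subset_iff image_iff by (metis in_set_conv_nth)
  with Cons show ?case by (simp add: All_less_Suc2 Ex_less_Suc2) blast
qed simp

text \<open>A derivation is a finite object, and checking it is c.e. as soon as the single steps
  are. The rules may thus involve searches themselves, as membership in \<open>W e\<close> does in
  \<open>gen_step\<close>.\<close>

lemma ce_derivable:
  assumes "ce (\<lambda>p. Step (pfst p) (psnd p))" "computable1 f"
  shows "ce (\<lambda>x. derivable Step (f x))"
proof (rule ce_compose[OF _ assms(2)])
  have "derivable Step x \<longleftrightarrow> (\<exists>t. (\<forall>k<clen t. Step (psnd (cnth t k)) (pfst (cnth t k)) \<and>
     (\<forall>i<clen (psnd (cnth t k)). \<exists>m<clen t. k < m \<and> pfst (cnth t m) = cnth (psnd (cnth t k)) i)) \<and>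
     (\<exists>k<clen t. pfst (cnth t k) = x))" (is "_ \<longleftrightarrow> ?R x") for x
  proof -
    have "derivable Step x \<longleftrightarrow> (\<exists>ts. derivation Step ts \<and> (\<exists>k<length ts. pfst (ts ! k) = x))"
      using derivable_imp_derivation derivation_imp_derivable by (metis image_iff in_set_conv_nth)
    also have "\<dots> \<longleftrightarrow> (\<exists>t. derivation Step (list_decode t) \<and> (\<exists>k<length (list_decode t). pfst (list_decode t ! k) = x))"
      by (metis list_encode_inverse)
    also have "\<dots> \<longleftrightarrow> ?R x"
      unfolding derivation_iff_nth clen_def cnth_def by (simp cong: imp_cong conj_cong)
    finally show ?thesis .
  qed
  moreover have "ce ?R" by (intro comp ce_compose2[OF assms(1)])
  ultimately show "ce (derivable Step)" by presburger
qed

definition cmem :: "nat \<Rightarrow> nat \<Rightarrow> bool" where "cmem x l \<longleftrightarrow> (\<exists>i<clen l. cnth l i = x)"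

lemma cmem_iff: "cmem x l \<longleftrightarrow> x \<in> set (list_decode l)"
  unfolding cmem_def cnth_def clen_def by (auto simp: in_set_conv_nth)

lemma dec_cmem [comp]:
  assumes "computable1 f" "computable1 g" shows "dec (\<lambda>x. cmem (f x) (g x))"
  unfolding cmem_def by (intro comp assms computable1_compose[OF assms(1)] computable1_compose[OF assms(2)])

lemmas ce_cmem [comp] = dec_imp_ce[OF dec_cmem]

section \<open>The evaluation relation is computably enumerable\<close>

inductive_cases rc_eval_ZE: "rc_eval Z xs y"
inductive_cases rc_eval_SE: "rc_eval S xs y"
inductive_cases rc_eval_ProjE: "rc_eval (Proj i) xs y"
inductive_cases rc_eval_CompE: "rc_eval (Comp f gs) xs y"
inductive_cases rc_eval_Prim0E: "rc_eval (Prim f g) (0 # xs) y"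
inductive_cases rc_eval_PrimSE: "rc_eval (Prim f g) (Suc n # xs) y"
inductive_cases rc_eval_MnE: "rc_eval (Mn f) xs y"

lemma rc_eval_deterministic: "rc_eval c xs y \<Longrightarrow> rc_eval c xs z \<Longrightarrow> y = z"
proof (induction arbitrary: z rule: rc_eval.induct)
  case (comp ys gs xs f y z)
  from comp.prems obtain ys' where ys': "length ys' = length gs" "\<forall>i<length gs. rc_eval (gs ! i) xs (ys' ! i)"
    "rc_eval f ys' z" by (auto elim: rc_eval_CompE)
  have "ys = ys'" by (rule nth_equalityI) (use comp.hyps comp.IH ys' in auto)
  with comp.IH ys' show ?case by blast
next
  case (primS f g n xs y z z')
  from primS.prems obtain y' where "rc_eval (Prim f g) (n # xs) y'" "rc_eval g (y' # n # xs) z'"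
    by (auto elim: rc_eval_PrimSE)
  with primS.IH show ?case by blast
next
  case (mn f n xs z)
  from mn.prems have z: "rc_eval f (z # xs) 0" "\<forall>m<z. \<exists>y>0. rc_eval f (m # xs) y" by (auto elim: rc_eval_MnE)
  have "\<not> n < z" using z(2) mn.IH(1) by fastforce
  moreover have "\<not> z < n" using z(1) mn.IH(2) by fastforce
  ultimately show ?case by simp
next
  case zero thus ?case by (auto elim: rc_eval_ZE)
next
  case succ thus ?case by (auto elim: rc_eval_SE)
next
  case proj thus ?case by (auto elim: rc_eval_ProjE)
next
  case (prim0 f xs y g)
  from prim0.prems show ?case by (rule rc_eval_Prim0E) (rule prim0.IH)
qed

lemma inj_rc_encode: "rc_encode c = rc_encode d \<Longrightarrow> c = d"
proof (induction c arbitrary: d)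
  case (Comp f gs)
  then obtain f' gs' where d: "d = Comp f' gs'" by (cases d) auto
  with Comp.prems have "rc_encode f = rc_encode f'" "map rc_encode gs = map rc_encode gs'"
    using inj_list_encode[of UNIV] by (auto dest: injD)
  thus ?case using d Comp.IH by (auto intro: list.inj_map_strong[of gs gs' rc_encode rc_encode])
qed (case_tac d; auto)+

lemma rc_decode_encode [simp]: "rc_decode (rc_encode c) = c"
  unfolding rc_decode_def using inj_rc_encode by (auto intro: someI2)

abbreviation triple :: "nat \<Rightarrow> nat \<Rightarrow> nat \<Rightarrow> nat" where "triple a b c \<equiv> pair a (pair b c)"

text \<open>The rules of \<^const>\<open>rc_eval\<close> on triples of coded program, coded argument list, and value.\<close>
definition eval_step :: "nat \<Rightarrow> nat \<Rightarrow> bool" where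
  "eval_step l t \<longleftrightarrow>
     pfst (pfst t) = 0 \<and> psnd (psnd t) = 0 \<or>
     pfst (pfst t) = 1 \<and> (\<exists>x z. pfst (psnd t) = ccons x z \<and> psnd (psnd t) = Suc x) \<or>
     pfst (pfst t) = 2 \<and> psnd (pfst t) < clen (pfst (psnd t)) \<and> psnd (psnd t) = cnth (pfst (psnd t)) (psnd (pfst t)) \<or>
     pfst (pfst t) = 3 \<and> (\<exists>ys. clen ys = clen (psnd (psnd (pfst t))) \<and>
        (\<forall>i<clen (psnd (psnd (pfst t))). cmem (triple (cnth (psnd (psnd (pfst t))) i) (pfst (psnd t)) (cnth ys i)) l) \<and>
        cmem (triple (pfst (psnd (pfst t))) ys (psnd (psnd t))) l) \<or>
     pfst (pfst t) = 4 \<and> (\<exists>z. pfst (psnd t) = ccons 0 z \<and> cmem (triple (pfst (psnd (pfst t))) z (psnd (psnd t))) l) \<or>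
     pfst (pfst t) = 4 \<and> (\<exists>n z r. pfst (psnd t) = ccons (Suc n) z \<and> cmem (triple (pfst t) (ccons n z) r) l \<and>
        cmem (triple (psnd (psnd (pfst t))) (ccons r (ccons n z)) (psnd (psnd t))) l) \<or>
     pfst (pfst t) = 5 \<and> cmem (triple (psnd (pfst t)) (ccons (psnd (psnd t)) (pfst (psnd t))) 0) l \<and>
        (\<forall>m<psnd (psnd t). \<exists>r. 0 < r \<and> cmem (triple (psnd (pfst t)) (ccons m (pfst (psnd t))) r) l)"

text \<open>Here and in the next two rules the disjuncts with inner quantifiers are isolated, so
  that completeness only has to exhibit lists of premises.\<close>

lemma eval_step_Comp:
  "\<lbrakk> clen ys = clen gs; \<forall>i<clen gs. cmem (triple (cnth gs i) xs (cnth ys i)) l; cmem (triple f ys z) l \<rbrakk>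
    \<Longrightarrow> eval_step l (triple (pair 3 (pair f gs)) xs z)"
  unfolding eval_step_def prod_encode_inverse fst_conv snd_conv
  by (rule disjI2, rule disjI2, rule disjI2, rule disjI1) blast

lemma eval_step_PrimS:
  "\<lbrakk> cmem (triple (pair 4 (pair f g)) (ccons n z) r) l; cmem (triple g (ccons r (ccons n z)) y) l \<rbrakk>
    \<Longrightarrow> eval_step l (triple (pair 4 (pair f g)) (ccons (Suc n) z) y)"
  unfolding eval_step_def prod_encode_inverse fst_conv snd_conv
  by (rule disjI2, rule disjI2, rule disjI2, rule disjI2, rule disjI2, rule disjI1) blast

lemma eval_step_Mn:
  "\<lbrakk> cmem (triple f (ccons n xs) 0) l; \<forall>m<n. \<exists>r. 0 < r \<and> cmem (triple f (ccons m xs) r) l \<rbrakk>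
    \<Longrightarrow> eval_step l (triple (pair 5 f) xs n)"
  unfolding eval_step_def prod_encode_inverse fst_conv snd_conv
  by (rule disjI2, rule disjI2, rule disjI2, rule disjI2, rule disjI2, rule disjI2) blast

lemma list_encode_eq_ccons: "list_encode xs = ccons x z \<longleftrightarrow> xs = x # list_decode z"
  by (metis ccons_list_encode list_decode_ccons list_decode_inverse list_encode_inverse)

lemma eval_step_sound:
  "derivable eval_step t \<Longrightarrow> t = triple (rc_encode c) (list_encode xs) y \<Longrightarrow> rc_eval c xs y"
proof (induction arbitrary: c xs y rule: derivable.induct)
  case (step l t)
  have IH: "rc_eval c xs y" if "cmem (triple (rc_encode c) (list_encode xs) y) l" for c xs y
    using step.IH that unfolding cmem_iff by blast
  \<comment> \<open>The rules mention argument lists by arbitrary codes \<open>z\<close>; every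
    number decodes to a list.\<close>
  have IH': "rc_eval c (list_decode z) y" if "cmem (triple (rc_encode c) z y) l" for c z y
    using IH[of c "list_decode z"] that by simp
  show ?case
  proof (cases c)
    case Z thus ?thesis using step.hyps step.prems by (auto simp: eval_step_def intro: rc_eval.zero)
  next
    case S thus ?thesis using step.hyps step.prems
      by (auto simp: eval_step_def list_encode_eq_ccons intro: rc_eval.succ)
  next
    case Proj thus ?thesis using step.hyps step.prems by (auto simp: eval_step_def intro: rc_eval.proj)
  next
    case (Comp f gs)
    then obtain ys where ys: "clen ys = length gs"
      "\<forall>i<length gs. cmem (triple (rc_encode (gs ! i)) (list_encode xs) (cnth ys i)) l"
      "cmem (triple (rc_encode f) ys y) l"
      using step.hyps step.prems by (auto simp: eval_step_def)
    show ?thesis unfolding Comp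
      by (rule rc_eval.comp[where ys="list_decode ys"])
         (use ys IH IH' in \<open>auto simp: clen_def cnth_def\<close>)
  next
    case (Prim f g)
    with step.hyps step.prems consider
        (z) z where "list_encode xs = ccons 0 z" "cmem (triple (rc_encode f) z y) l"
      | (s) n z r where "list_encode xs = ccons (Suc n) z" "cmem (triple (rc_encode (Prim f g)) (ccons n z) r) l"
          "cmem (triple (rc_encode g) (ccons r (ccons n z)) y) l"
      by (auto simp: eval_step_def)
    thus ?thesis
    proof cases
      case z with IH' show ?thesis unfolding Prim by (auto simp: list_encode_eq_ccons intro: rc_eval.prim0)
    next
      case s with IH'[OF s(2)] IH'[OF s(3)] show ?thesis unfolding Prim
        by (auto simp: list_encode_eq_ccons intro: rc_eval.primS)
    qed
  next
    case (Mn f)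
    with step.hyps step.prems have "cmem (triple (rc_encode f) (list_encode (y # xs)) 0) l"
      "\<forall>m<y. \<exists>r>0. cmem (triple (rc_encode f) (list_encode (m # xs)) r) l"
      by (simp_all add: eval_step_def del: list_encode.simps flip: ccons_list_encode)
    thus ?thesis unfolding Mn using IH by (blast intro: rc_eval.mn)
  qed
qed

lemma eval_step_complete:
  "rc_eval c xs y \<Longrightarrow> derivable eval_step (triple (rc_encode c) (list_encode xs) y)"
proof (induction rule: rc_eval.induct)
  case (zero xs) show ?case by (rule derivable.step[of "list_encode []"]) (simp_all add: eval_step_def)
next
  case (succ x xs) show ?case
    by (rule derivable.step[of "list_encode []"]) (auto simp: eval_step_def list_encode_eq_ccons intro!: exI[of _ "list_encode xs"] simp del: list_encode.simps)
next
  case (proj i xs) thus ?case by (intro derivable.step[of "list_encode []"]) (simp_all add: eval_step_def)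
next
  case (comp ys gs xs f z)
  let ?l = "triple (rc_encode f) (list_encode ys) z #
    map (\<lambda>i. triple (rc_encode (gs ! i)) (list_encode xs) (ys ! i)) [0..<length gs]"
  show ?case
  proof (rule derivable.step[of "list_encode ?l"])
    show "\<forall>y\<in>set (list_decode (list_encode ?l)). derivable eval_step y"
      using comp.IH unfolding list_encode_inverse by auto
    have "\<forall>i<length gs. cmem (triple (cnth (list_encode (map rc_encode gs)) i) (list_encode xs) (cnth (list_encode ys) i)) (list_encode ?l)"
      "cmem (triple (rc_encode f) (list_encode ys) z) (list_encode ?l)"
      using comp.hyps(1) unfolding cmem_iff list_encode_inverse by auto
    moreover have "clen (list_encode ys) = clen (list_encode (map rc_encode gs))" using comp.hyps(1) by simp
    ultimately show "eval_step (list_encode ?l) (triple (rc_encode (Comp f gs)) (list_encode xs) z)"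
      unfolding rc_encode.simps by (intro eval_step_Comp[of "list_encode ys"]) (use comp.hyps(1) in auto)
  qed
next
  case (prim0 f xs y g)
  show ?case
    by (rule derivable.step[of "list_encode [triple (rc_encode f) (list_encode xs) y]"])
       (use prim0.IH in \<open>auto simp: eval_step_def cmem_iff list_encode_eq_ccons intro!: exI[of _ "list_encode xs"] simp del: list_encode.simps\<close>)
next
  case (primS f g n xs y z)
  let ?l = "[triple (rc_encode (Prim f g)) (list_encode (n # xs)) y, triple (rc_encode g) (list_encode (y # n # xs)) z]"
  show ?case
  proof (rule derivable.step[of "list_encode ?l"])
    show "\<forall>y\<in>set (list_decode (list_encode ?l)). derivable eval_step y"
      using primS.IH unfolding list_encode_inverse by auto
    have "list_encode (Suc n # xs) = ccons (Suc n) (list_encode xs)"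
      "cmem (triple (rc_encode (Prim f g)) (ccons n (list_encode xs)) y) (list_encode ?l)"
      "cmem (triple (rc_encode g) (ccons y (ccons n (list_encode xs))) z) (list_encode ?l)"
      unfolding cmem_iff list_encode_inverse by (simp_all del: list_encode.simps)
    thus "eval_step (list_encode ?l) (triple (rc_encode (Prim f g)) (list_encode (Suc n # xs)) z)"
      unfolding rc_encode.simps by (metis eval_step_PrimS)
  qed
next
  case (mn f n xs)
  \<comment> \<open>Minimisation needs a positive value at every smaller argument; these values are
    chosen as \<open>r\<close> so that the finitely many premises can be listed.\<close>
  from mn.IH(2) have "\<forall>m. \<exists>y. m < n \<longrightarrow> 0 < y \<and> derivable eval_step (triple (rc_encode f) (list_encode (m # xs)) y)"
    by blast
  then obtain r where r: "\<And>m. m < n \<Longrightarrow> 0 < r m \<and> derivable eval_step (triple (rc_encode f) (list_encode (m # xs)) (r m))"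
    by metis
  let ?l = "triple (rc_encode f) (list_encode (n # xs)) 0 #
    map (\<lambda>m. triple (rc_encode f) (list_encode (m # xs)) (r m)) [0..<n]"
  show ?case
  proof (rule derivable.step[of "list_encode ?l"])
    show "\<forall>y\<in>set (list_decode (list_encode ?l)). derivable eval_step y"
      using mn.IH(1) r unfolding list_encode_inverse by auto
    have "cmem (triple (rc_encode f) (ccons n (list_encode xs)) 0) (list_encode ?l)"
      "\<forall>m<n. \<exists>r. 0 < r \<and> cmem (triple (rc_encode f) (ccons m (list_encode xs)) r) (list_encode ?l)"
      using r unfolding cmem_iff list_encode_inverse ccons_list_encode
      by (auto simp del: list_encode.simps intro!: exI[of _ "r _"])
    thus "eval_step (list_encode ?l) (triple (rc_encode (Mn f)) (list_encode xs) n)"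
      unfolding rc_encode.simps by (rule eval_step_Mn)
  qed
qed

definition code_step :: "nat \<Rightarrow> nat \<Rightarrow> bool" where
  "code_step l c \<longleftrightarrow>
     pfst c = 0 \<and> psnd c = 0 \<or> pfst c = 1 \<and> psnd c = 0 \<or> pfst c = 2 \<or>
     pfst c = 3 \<and> cmem (pfst (psnd c)) l \<and> (\<forall>i<clen (psnd (psnd c)). cmem (cnth (psnd (psnd c)) i) l) \<or>
     pfst c = 4 \<and> cmem (pfst (psnd c)) l \<and> cmem (psnd (psnd c)) l \<or>
     pfst c = 5 \<and> cmem (psnd c) l"

lemma code_step_sound: "derivable code_step c \<Longrightarrow> c \<in> range rc_encode"
proof (induction rule: derivable.induct)
  case (step l c)
  have IH: "\<exists>d. rc_encode d = c" if "cmem c l" for c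
    using step.IH that unfolding cmem_iff by (metis rangeE)
  have c: "c = pair (pfst c) (psnd c)" by simp
  from step.hyps[unfolded code_step_def] show ?case
  proof (elim disjE conjE)
    assume "pfst c = 0" "psnd c = 0" thus ?thesis using c by (metis rangeI rc_encode.simps(1))
  next
    assume "pfst c = 1" "psnd c = 0" thus ?thesis using c by (metis rangeI rc_encode.simps(2))
  next
    assume "pfst c = 2" thus ?thesis using c by (metis rangeI rc_encode.simps(3))
  next
    assume 4: "pfst c = 3" "cmem (pfst (psnd c)) l" "\<forall>i<clen (psnd (psnd c)). cmem (cnth (psnd (psnd c)) i) l"
    obtain f where f: "rc_encode f = pfst (psnd c)" using IH 4 by blast
    have "x \<in> range rc_encode" if "x \<in> set (list_decode (psnd (psnd c)))" for x
    proof -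
      from that obtain i where "i < clen (psnd (psnd c))" "cnth (psnd (psnd c)) i = x"
        unfolding cmem_iff[symmetric] cmem_def by blast
      with 4(3) IH[of x] show ?thesis by blast
    qed
    hence "map rc_encode (map (inv_into UNIV rc_encode) (list_decode (psnd (psnd c)))) = list_decode (psnd (psnd c))"
      by (auto intro!: map_idI simp: f_inv_into_f)
    then obtain gs where "map rc_encode gs = list_decode (psnd (psnd c))" by blast
    hence "rc_encode (Comp f gs) = c" using 4(1) f c by simp
    thus ?thesis by blast
  next
    assume 5: "pfst c = 4" "cmem (pfst (psnd c)) l" "cmem (psnd (psnd c)) l"
    then obtain f g where "rc_encode f = pfst (psnd c)" "rc_encode g = psnd (psnd c)" using IH by blast
    hence "rc_encode (Prim f g) = c" using 5(1) c by simp
    thus ?thesis by blast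
  next
    assume 6: "pfst c = 5" "cmem (psnd c) l"
    then obtain f where "rc_encode f = psnd c" using IH by blast
    hence "rc_encode (Mn f) = c" using 6(1) c by simp
    thus ?thesis by blast
  qed
qed

lemma code_step_complete: "derivable code_step (rc_encode c)"
proof (induction c)
  case Z show ?case by (rule derivable.step[of "list_encode []"]) (simp_all add: code_step_def)
next
  case S show ?case by (rule derivable.step[of "list_encode []"]) (simp_all add: code_step_def)
next
  case Proj show ?case by (rule derivable.step[of "list_encode []"]) (simp_all add: code_step_def)
next
  case (Comp f gs)
  show ?case by (rule derivable.step[of "list_encode (rc_encode f # map rc_encode gs)"])
      (use Comp in \<open>auto simp: code_step_def cmem_iff simp del: list_encode.simps\<close>)
next
  case (Prim f g)
  show ?case by (rule derivable.step[of "list_encode [rc_encode f, rc_encode g]"])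
      (use Prim in \<open>auto simp: code_step_def cmem_iff simp del: list_encode.simps\<close>)
next
  case (Mn f)
  show ?case by (rule derivable.step[of "list_encode [rc_encode f]"])
      (use Mn in \<open>auto simp: code_step_def cmem_iff simp del: list_encode.simps\<close>)
qed

lemma rc_eval_decode_iff:
  "rc_eval (rc_decode e) (list_decode xs) y \<longleftrightarrow> derivable code_step e \<and> derivable eval_step (triple e xs y)"
proof (cases "e \<in> range rc_encode")
  case True
  then obtain c where c: "e = rc_encode c" by blast
  have "rc_eval c (list_decode xs) y \<longleftrightarrow> derivable eval_step (triple e xs y)"
    using eval_step_sound[of _ c "list_decode xs" y] eval_step_complete[of c "list_decode xs" y] c by auto
  thus ?thesis using c code_step_complete by simp
next
  case False
  hence "rc_decode e = Mn S" unfolding rc_decode_def by auto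
  \<comment> \<open>\<open>S\<close> never returns 0, so \<open>Mn S\<close> diverges on every
    input.\<close>
  moreover have "\<not> rc_eval (Mn S) zs y" for zs by (auto elim!: rc_eval_MnE rc_eval_SE)
  ultimately show ?thesis using False code_step_sound by auto
qed

text \<open>The enumeration theorem: program, input and output may all vary computably.\<close>

lemma ce_rc_eval [comp]:
  assumes "computable1 f" "computable1 g" "computable1 h"
  shows "ce (\<lambda>x. rc_eval (rc_decode (f x)) (list_decode (g x)) (h x))"
proof -
  have 1: "ce (\<lambda>p. eval_step (pfst p) (psnd p))" unfolding eval_step_def by (intro comp)
  have 2: "ce (\<lambda>p. code_step (pfst p) (psnd p))" unfolding code_step_def by (intro comp)
  show ?thesis unfolding rc_eval_decode_iff by (intro comp ce_derivable[OF 1] ce_derivable[OF 2] assms)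
qed

lemma ce_W [comp]:
  assumes "computable1 f" "computable1 g" shows "ce (\<lambda>x. f x \<in> W (g x))"
proof -
  have "f x \<in> W (g x) \<longleftrightarrow> (\<exists>y. rc_eval (rc_decode (g x)) (list_decode (ccons (f x) 0)) y)" for x
    unfolding W_def by simp
  moreover have "ce (\<lambda>x. \<exists>y. rc_eval (rc_decode (g x)) (list_decode (ccons (f x) 0)) y)"
    by (intro comp computable1_compose[OF assms(1)] computable1_compose[OF assms(2)])
  ultimately show ?thesis by presburger
qed

section \<open>Parametrisation of c.e. sets\<close>

lemma rc_encode_const_code:
  "rc_encode (const_code n) = rec_nat (rc_encode Z) (\<lambda>k r. pair 3 (pair (rc_encode S) (ccons r 0))) n"
  by (induction n) (simp_all add: ccons_def)

lemma inj_const_code: "const_code m = const_code n \<Longrightarrow> m = n"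
proof (induction m arbitrary: n)
  case 0 thus ?case by (cases n) auto
next
  case (Suc m) thus ?case by (cases n) auto
qed

text \<open>The program for parameter \<open>a\<close> searches for a witness with the numeral of
  \<open>a\<close> wired in, so its code is computable from \<open>a\<close>. Different parameters
  give different programs; this injectivity is what upgrades the later hardness proofs to one-one
  reducibility.\<close>

lemma ce_index:
  assumes "ce (\<lambda>p. P (pfst p) (psnd p))"
  obtains g where "computable1 g" "inj g" "\<And>a. W (g a) = {x. P x a}"
proof -
  obtain Q where Q: "dec (\<lambda>p. Q (pfst p) (psnd p))" "\<And>x. P (pfst x) (psnd x) \<longleftrightarrow> (\<exists>w. Q w x)"
    by (rule ceE[OF assms(1)]) blast
  have P: "P x a \<longleftrightarrow> (\<exists>w. Q w (pair x a))" for x a using Q(2)[of "pair x a"] by simp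
  from dec_not[OF Q(1)] obtain c where c: "\<And>q. rc_eval c [q] (of_bool (\<not> Q (pfst q) (psnd q)))"
    unfolding dec_def computable1_def by blast
  obtain d where d: "\<And>x y. rc_eval d [x, y] (pair x y)"
    using computable2_prod_encode unfolding computable2_def by blast
  define e where "e = Comp c [Comp d [Proj 0, Comp d [Proj 1, Proj 2]]]"
  have e: "rc_eval e [w, x, a] (of_bool (\<not> Q w (pair x a)))" for w x a
    unfolding e_def using c[of "pair w (pair x a)"]
    by (auto intro!: rc_eval_Comp1 rc_eval_Comp2 rc_eval_Proj d)
  define g where "g a = rc_encode (Comp (Mn e) [Proj 0, const_code a])" for a
  have "(\<exists>y. rc_eval (Comp (Mn e) [Proj 0, const_code a]) [x] y) \<longleftrightarrow> P x a" for x a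
  proof
    assume "\<exists>y. rc_eval (Comp (Mn e) [Proj 0, const_code a]) [x] y"
    then obtain y where "rc_eval (Comp (Mn e) [Proj 0, const_code a]) [x] y" by blast
    then obtain ys where ys: "length ys = length [Proj 0, const_code a]"
      "\<forall>i<length [Proj 0, const_code a]. rc_eval ([Proj 0, const_code a] ! i) [x] (ys ! i)"
      "rc_eval (Mn e) ys y" by (rule rc_eval_CompE)
    have 0: "rc_eval (Proj 0) [x] (ys ! 0)" and 1: "rc_eval (const_code a) [x] (ys ! 1)"
      using ys(2)[rule_format, of 0] ys(2)[rule_format, of 1] by simp_all
    have "ys ! 0 = x" using 0 by (auto elim: rc_eval_ProjE)
    moreover have "ys ! 1 = a" using rc_eval_deterministic[OF 1 rc_eval_const_code] .
    ultimately have "ys = [x, a]" using ys(1) by (auto simp: length_Suc_conv)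
    with ys(3) have "rc_eval e [y, x, a] 0" by (auto elim: rc_eval_MnE)
    with e[of y x a] have "Q y (pair x a)" using rc_eval_deterministic by fastforce
    thus "P x a" using P by blast
  next
    assume "P x a"
    with P have ex: "\<exists>w. Q w (pair x a)" by blast
    let ?w = "LEAST w. Q w (pair x a)"
    have "Q ?w (pair x a)" by (rule LeastI_ex[OF ex])
    hence "rc_eval e (?w # [x, a]) 0" using e[of ?w x a] by simp
    moreover have "\<forall>m<?w. \<exists>y>0. rc_eval e (m # [x, a]) y"
      using e[of _ x a] not_less_Least[of _ "\<lambda>w. Q w (pair x a)"] by (metis of_bool_eq(2) zero_less_one)
    ultimately have "rc_eval (Mn e) [x, a] ?w" by (rule rc_eval.mn)
    hence "rc_eval (Comp (Mn e) [Proj 0, const_code a]) [x] ?w"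
      by (intro rc_eval_Comp2[OF rc_eval_Proj rc_eval_const_code]) simp_all
    thus "\<exists>y. rc_eval (Comp (Mn e) [Proj 0, const_code a]) [x] y" by blast
  qed
  hence "W (g a) = {x. P x a}" for a by (simp only: W_def g_def rc_decode_encode)
  moreover have "inj g" unfolding g_def by (rule injI) (auto dest!: inj_rc_encode inj_const_code)
  moreover have "computable1 g"
    unfolding g_def rc_encode.simps list.map rc_encode_const_code ccons_list_encode[symmetric] by (intro comp)
  ultimately show ?thesis using that by blast
qed

section \<open>Quantifier normal forms\<close>

lemma Pi2_setI:
  assumes "ce (\<lambda>p. P (pfst p) (psnd p))" "\<And>x. x \<in> A \<longleftrightarrow> (\<forall>a. P a x)"
  shows "Pi2_set A"
proof -
  obtain Q where Q: "dec (\<lambda>p. Q (pfst p) (psnd p))" "\<And>x. P (pfst x) (psnd x) \<longleftrightarrow> (\<exists>w. Q w x)"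
    by (rule ceE[OF assms(1)]) blast
  from Q(1) obtain c where c: "\<And>q. rc_eval c [q] (of_bool (Q (pfst q) (psnd q)))"
    unfolding dec_def computable1_def by blast
  obtain d where d: "\<And>x y. rc_eval d [x, y] (pair x y)"
    using computable2_prod_encode unfolding computable2_def by blast
  have e: "rc_eval (Comp c [Comp d [Proj 2, Comp d [Proj 1, Proj 0]]]) [x, a, b] (of_bool (Q b (pair a x)))" for x a b
    using c[of "pair b (pair a x)"] by (auto intro!: rc_eval_Comp1 rc_eval_Comp2 rc_eval_Proj d)
  have "computable_pred 3 (\<lambda>l. Q (l ! 2) (pair (l ! 1) (l ! 0)))"
    unfolding computable_pred_def
  proof (intro exI allI impI)
    fix xs :: "nat list" assume "length xs = 3"
    then obtain x a b where "xs = [x, a, b]" by (auto simp: length_Suc_conv numeral_3_eq_3)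
    thus "rc_eval (Comp c [Comp d [Proj 2, Comp d [Proj 1, Proj 0]]]) xs (if Q (xs ! 2) (pair (xs ! 1) (xs ! 0)) then 1 else 0)"
      using e[of x a b] by (cases "Q b (pair a x)") simp_all
  qed
  moreover have "x \<in> A \<longleftrightarrow> (\<forall>a. \<exists>b. Q b (pair a x))" for x
    using assms(2) Q(2)[of "pair _ x"] by simp
  ultimately show ?thesis unfolding Pi2_set_def by (intro exI[of _ "\<lambda>l. Q (l ! 2) (pair (l ! 1) (l ! 0))"]) auto
qed

lemma Pi2_setE:
  assumes "Pi2_set A"
  obtains P where "ce (\<lambda>p. P (pfst p) (psnd p))" "\<And>x. x \<in> A \<longleftrightarrow> (\<forall>a. P a x)"
proof -
  from assms obtain R c where c: "\<And>xs. length xs = 3 \<Longrightarrow> rc_eval c xs (of_bool (R xs))"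
    and R: "\<And>x. x \<in> A \<longleftrightarrow> (\<forall>a. \<exists>b. R [x, a, b])"
    unfolding Pi2_set_def computable_pred_def of_bool_def by blast
  obtain d1 where d1: "\<And>x. rc_eval d1 [x] (pfst x)" using computable1_pfst_id unfolding computable1_def by blast
  obtain d2 where d2: "\<And>x. rc_eval d2 [x] (psnd x)" using computable1_psnd_id unfolding computable1_def by blast
  have "rc_eval (Comp c [Comp d2 [Comp d2 [Proj 0]], Comp d1 [Comp d2 [Proj 0]], Comp d1 [Proj 0]]) [q]
    (of_bool (R [psnd (psnd q), pfst (psnd q), pfst q]))" for q
    by (rule rc_eval.comp[OF _ _ c])
       (auto simp: less_Suc_eq intro!: rc_eval_Comp1 rc_eval_Proj d1 d2)
  hence "dec (\<lambda>q. R [psnd (psnd q), pfst (psnd q), pfst q])" unfolding dec_def computable1_def by blast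
  hence "ce (\<lambda>p. \<exists>b. R [psnd p, pfst p, b])" by (intro comp dec_imp_ce) 
  thus ?thesis using that[of "\<lambda>a x. \<exists>b. R [x, a, b]"] R by simp
qed

text \<open>The matrix is co-c.e. and enters through its c.e. negation \<open>N\<close>, because the
  rules in \<open>comp\<close> close c.e. predicates and not their complements. The search hidden in
  \<open>N\<close> becomes the innermost universal quantifier.\<close>

lemma Pi3_setI:
  assumes "ce (\<lambda>q. N (pfst q) (pfst (psnd q)) (psnd (psnd q)))" "\<And>x. x \<in> A \<longleftrightarrow> (\<forall>a. \<exists>b. \<not> N b a x)"
  shows "Pi3_set A"
proof -
  obtain Q where Q: "dec (\<lambda>p. Q (pfst p) (psnd p))" "\<And>x. N (pfst x) (pfst (psnd x)) (psnd (psnd x)) \<longleftrightarrow> (\<exists>w. Q w x)"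
    by (rule ceE[OF assms(1)]) blast
  from dec_not[OF Q(1)] obtain c where c: "\<And>q. rc_eval c [q] (of_bool (\<not> Q (pfst q) (psnd q)))"
    unfolding dec_def computable1_def by blast
  obtain d where d: "\<And>x y. rc_eval d [x, y] (pair x y)"
    using computable2_prod_encode unfolding computable2_def by blast
  have e: "rc_eval (Comp c [Comp d [Proj 3, Comp d [Proj 2, Comp d [Proj 1, Proj 0]]]]) [x, a, b, e]
      (of_bool (\<not> Q e (pair b (pair a x))))" for x a b e
    using c[of "pair e (pair b (pair a x))"] by (auto intro!: rc_eval_Comp1 rc_eval_Comp2 rc_eval_Proj d)
  have "computable_pred 4 (\<lambda>l. \<not> Q (l ! 3) (pair (l ! 2) (pair (l ! 1) (l ! 0))))"
    unfolding computable_pred_def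
  proof (intro exI allI impI)
    fix xs :: "nat list" assume "length xs = 4"
    then obtain x a b e where "xs = [x, a, b, e]" by (auto simp: length_Suc_conv numeral_eq_Suc)
    thus "rc_eval (Comp c [Comp d [Proj 3, Comp d [Proj 2, Comp d [Proj 1, Proj 0]]]]) xs
        (if \<not> Q (xs ! 3) (pair (xs ! 2) (pair (xs ! 1) (xs ! 0))) then 1 else 0)"
      using e[of x a b e] by (cases "Q e (pair b (pair a x))") simp_all
  qed
  moreover have "x \<in> A \<longleftrightarrow> (\<forall>a. \<exists>b. \<forall>e. \<not> Q e (pair b (pair a x)))" for x
    using assms(2) Q(2)[of "pair _ (pair _ x)"] by simp
  ultimately show ?thesis unfolding Pi3_set_def
    by (intro exI[of _ "\<lambda>l. \<not> Q (l ! 3) (pair (l ! 2) (pair (l ! 1) (l ! 0)))"]) auto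
qed

text \<open>The matrix is kept decidable, because \<open>Sigma2_cardinality\<close> must recognise
  single refutations \<open>d\<close>.\<close>

lemma Pi3_setE:
  assumes "Pi3_set A"
  obtains R where "dec (\<lambda>q. R (pfst q) (pfst (psnd q)) (pfst (psnd (psnd q))) (psnd (psnd (psnd q))))"
    "\<And>x. x \<in> A \<longleftrightarrow> (\<forall>a. \<exists>b. \<forall>d. R x a b d)"
proof -
  from assms obtain R c where c: "\<And>xs. length xs = 4 \<Longrightarrow> rc_eval c xs (of_bool (R xs))"
    and R: "\<And>x. x \<in> A \<longleftrightarrow> (\<forall>a. \<exists>b. \<forall>d. R [x, a, b, d])"
    unfolding Pi3_set_def computable_pred_def of_bool_def by blast
  obtain d1 where d1: "\<And>x. rc_eval d1 [x] (pfst x)" using computable1_pfst_id unfolding computable1_def by blast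
  obtain d2 where d2: "\<And>x. rc_eval d2 [x] (psnd x)" using computable1_psnd_id unfolding computable1_def by blast
  have "rc_eval (Comp c [Comp d1 [Proj 0], Comp d1 [Comp d2 [Proj 0]], Comp d1 [Comp d2 [Comp d2 [Proj 0]]],
      Comp d2 [Comp d2 [Comp d2 [Proj 0]]]]) [q]
    (of_bool (R [pfst q, pfst (psnd q), pfst (psnd (psnd q)), psnd (psnd (psnd q))]))" for q
    by (rule rc_eval.comp[OF _ _ c])
       (auto simp: less_Suc_eq intro!: rc_eval_Comp1 rc_eval_Proj d1 d2)
  hence "dec (\<lambda>q. R [pfst q, pfst (psnd q), pfst (psnd (psnd q)), psnd (psnd (psnd q))])"
    unfolding dec_def computable1_def by blast
  thus ?thesis using that[of "\<lambda>x a b d. R [x, a, b, d]"] R by simp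
qed

section \<open>Subfields of the algebraic numbers\<close>

text \<open>Koenig's lemma for functions with finitely many admissible values at each point. Points
  are visited in numerical order while \<open>good n g\<close> holds: every finite condition can be
  met by a function that agrees with \<open>g\<close> on the points of \<open>E\<close> below
  \<open>n\<close>.\<close>

lemma compactness:
  fixes ok :: "nat set \<Rightarrow> (nat \<Rightarrow> 'b) \<Rightarrow> bool"
  assumes mono: "\<And>D D' h. ok D h \<Longrightarrow> D' \<subseteq> D \<Longrightarrow> ok D' h"
    and cong: "\<And>D h h'. (\<And>x. x \<in> D \<Longrightarrow> h x = h' x) \<Longrightarrow> ok D h \<Longrightarrow> ok D h'"
    and ex: "\<And>D. finite D \<Longrightarrow> D \<subseteq> E \<Longrightarrow> \<exists>h. ok D h"
    and bounded: "\<And>x. x \<in> E \<Longrightarrow> \<exists>D V. finite D \<and> D \<subseteq> E \<and> finite V \<and> (\<forall>h. ok D h \<longrightarrow> h x \<in> V)"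
  shows "\<exists>h. \<forall>D. finite D \<longrightarrow> D \<subseteq> E \<longrightarrow> ok D h"
proof -
  define good where "good n g \<longleftrightarrow> (\<forall>D. finite D \<longrightarrow> D \<subseteq> E \<longrightarrow> (\<exists>h. ok D h \<and> (\<forall>x\<in>E. x < n \<longrightarrow> h x = g x)))" for n g
  have step: "\<exists>g'. good (Suc n) g' \<and> (\<forall>x<n. g' x = g x)" if g: "good n g" for n g
  proof (cases "n \<in> E")
    case False
    have "x < Suc n \<longleftrightarrow> x < n" if "x \<in> E" for x using that False by (auto simp: less_Suc_eq)
    hence "good (Suc n) g" using g unfolding good_def by (simp cong: ball_cong)
    thus ?thesis by blast
  next
    case True
    obtain D V where DV: "finite D" "D \<subseteq> E" "finite V" "\<And>h. ok D h \<Longrightarrow> h n \<in> V"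
      using bounded[OF True] by blast
    have "\<exists>v. good (Suc n) (g(n := v))"
    proof (rule ccontr)
      assume "\<nexists>v. good (Suc n) (g(n := v))"
      then have "\<exists>D'. finite D' \<and> D' \<subseteq> E \<and> (\<forall>h. ok D' h \<longrightarrow> \<not> (\<forall>x\<in>E. x < Suc n \<longrightarrow> h x = (g(n := v)) x))" for v
        unfolding good_def by presburger
      then obtain D' where D': "\<And>v. finite (D' v)" "\<And>v. D' v \<subseteq> E"
        "\<And>v h. ok (D' v) h \<Longrightarrow> \<not> (\<forall>x\<in>E. x < Suc n \<longrightarrow> h x = (g(n := v)) x)" by moura
      \<comment> \<open>If each value at \<open>n\<close> is refuted by a finite set, then the sets
        refuting the finitely many values in \<open>V\<close> unite to one finite set; but a
        function meeting it still has to take one of these values.\<close>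
      let ?D = "D \<union> (\<Union>v\<in>V. D' v)"
      have "finite ?D" using DV D' by auto
      moreover have "?D \<subseteq> E" using DV(2) D'(2) by (intro Un_least UN_least)
      ultimately
      obtain h where h: "ok ?D h" "\<forall>x\<in>E. x < n \<longrightarrow> h x = g x" using g unfolding good_def by blast
      have "ok D h" using mono[OF h(1)] by blast
      hence V: "h n \<in> V" using DV(4) by blast
      hence "ok (D' (h n)) h" using mono[OF h(1)] by blast
      from D'(3)[OF this] h(2) show False by (auto simp: less_Suc_eq)
    qed
    then obtain v where "good (Suc n) (g(n := v))" by blast
    thus ?thesis by (intro exI[of _ "g(n := v)"]) auto
  qed
  have "good 0 undefined" unfolding good_def using ex by auto
  have "\<exists>G. \<forall>n. good n (G n) \<and> (\<forall>x<n. G (Suc n) x = G n x)"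
  proof (intro dependent_nat_choice)
    show "\<exists>g. good 0 g" using \<open>good 0 undefined\<close> by blast
    show "\<exists>g'. good (Suc n) g' \<and> (\<forall>x<n. g' x = g x)" if "good n g" for g n by (rule step[OF that])
  qed
  then obtain G where G: "\<And>n. good n (G n)" "\<And>n x. x < n \<Longrightarrow> G (Suc n) x = G n x" by blast
  \<comment> \<open>Later stages keep what is decided, so the limit reads the value at
    \<open>x\<close> from the first stage that fixes it.\<close>
  define H where "H x = G (Suc x) x" for x
  have H: "G n x = H x" if "x < n" for n x
    using that
  proof (induction n)
    case (Suc n) thus ?case using G(2)[of x n] unfolding H_def by (cases "x = n") auto
  qed simp
  have "ok D H" if D: "finite D" "D \<subseteq> E" for D
  proof -
    have "\<exists>n. \<forall>x\<in>D. x < n" using D(1) finite_nat_set_iff_bounded by simp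
    then obtain n where n: "\<forall>x\<in>D. x < n" by (rule exE)
    obtain h where h: "ok D h" "\<forall>x\<in>E. x < n \<longrightarrow> h x = G n x" using G(1)[of n] D unfolding good_def by blast
    show "ok D H" by (rule cong[OF _ h(1)]) (use h(2) n D H in auto)
  qed
  thus ?thesis by blast
qed

text \<open>Only relations that live inside \<open>D\<close> are respected. When \<open>D\<close>
  contains enough elements, these clauses also force the images of zero, negatives and
  inverses.\<close>

definition (in ring) partial_hom :: "'a set \<Rightarrow> ('a \<Rightarrow> 'a) \<Rightarrow> bool" where
  "partial_hom D h \<longleftrightarrow> h ` D \<subseteq> carrier R \<and> (\<one> \<in> D \<longrightarrow> h \<one> = \<one>) \<and>
     (\<forall>x\<in>D. \<forall>y\<in>D. x \<oplus> y \<in> D \<longrightarrow> h (x \<oplus> y) = h x \<oplus> h y) \<and>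
     (\<forall>x\<in>D. \<forall>y\<in>D. x \<otimes> y \<in> D \<longrightarrow> h (x \<otimes> y) = h x \<otimes> h y)"

text \<open>A finite part of \<open>E\<close> already forces the image of \<open>a\<close> to be
  \<open>t h\<close>. The notion is closed under the field operations, so polynomial identities can
  be carried through partial maps without writing down the finite set of intermediate
  values.\<close>

definition (in ring) determined :: "'a set \<Rightarrow> 'a \<Rightarrow> (('a \<Rightarrow> 'a) \<Rightarrow> 'a) \<Rightarrow> bool" where
  "determined E a t \<longleftrightarrow> a \<in> carrier R \<and> (\<exists>D. finite D \<and> D \<subseteq> E \<and> a \<in> D \<and> (\<forall>h. partial_hom D h \<longrightarrow> h a = t h))"

context field
begin

lemma partial_hom_mono: "partial_hom D h \<Longrightarrow> D' \<subseteq> D \<Longrightarrow> partial_hom D' h"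
  unfolding partial_hom_def by blast

lemma partial_hom_closed: "partial_hom D h \<Longrightarrow> x \<in> D \<Longrightarrow> h x \<in> carrier R"
  unfolding partial_hom_def by blast

lemma partial_hom_add: "partial_hom D h \<Longrightarrow> x \<in> D \<Longrightarrow> y \<in> D \<Longrightarrow> x \<oplus> y \<in> D \<Longrightarrow> h (x \<oplus> y) = h x \<oplus> h y"
  unfolding partial_hom_def by blast

lemma partial_hom_mult: "partial_hom D h \<Longrightarrow> x \<in> D \<Longrightarrow> y \<in> D \<Longrightarrow> x \<otimes> y \<in> D \<Longrightarrow> h (x \<otimes> y) = h x \<otimes> h y"
  unfolding partial_hom_def by blast

lemma partial_hom_one: "partial_hom D h \<Longrightarrow> \<one> \<in> D \<Longrightarrow> h \<one> = \<one>"
  unfolding partial_hom_def by blast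

lemma partial_hom_zero: assumes "partial_hom D h" "\<zero> \<in> D" shows "h \<zero> = \<zero>"
proof -
  have "h \<zero> \<oplus> h \<zero> = h \<zero>" using partial_hom_add[OF assms(1) assms(2) assms(2)] assms(2) by simp
  thus ?thesis using partial_hom_closed[OF assms] by (metis add.l_cancel_one')
qed

lemma determinedI:
  "a \<in> carrier R \<Longrightarrow> finite D \<Longrightarrow> D \<subseteq> E \<Longrightarrow> a \<in> D \<Longrightarrow> (\<And>h. partial_hom D h \<Longrightarrow> h a = t h) \<Longrightarrow> determined E a t"
  unfolding determined_def by blast

lemma determinedE:
  assumes "determined E a t"
  obtains D where "a \<in> carrier R" "finite D" "D \<subseteq> E" "a \<in> D" "\<And>h. partial_hom D h \<Longrightarrow> h a = t h"
  using assms unfolding determined_def by blast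

lemma determined_self: "a \<in> E \<Longrightarrow> a \<in> carrier R \<Longrightarrow> determined E a (\<lambda>h. h a)"
  by (rule determinedI[of _ "{a}"]) auto

lemma determined_one: "\<one> \<in> E \<Longrightarrow> determined E \<one> (\<lambda>h. \<one>)"
  by (rule determinedI[of _ "{\<one>}"]) (auto intro: partial_hom_one)

lemma determined_zero: "\<zero> \<in> E \<Longrightarrow> determined E \<zero> (\<lambda>h. \<zero>)"
  by (rule determinedI[of _ "{\<zero>}"]) (auto intro: partial_hom_zero)

lemma determined_add:
  assumes "determined E a t" "determined E b u" "a \<oplus> b \<in> E"
  shows "determined E (a \<oplus> b) (\<lambda>h. t h \<oplus> u h)"
proof -
  obtain D where D: "a \<in> carrier R" "finite D" "D \<subseteq> E" "a \<in> D" "\<And>h. partial_hom D h \<Longrightarrow> h a = t h"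
    by (rule determinedE[OF assms(1)]) blast
  obtain D' where D': "b \<in> carrier R" "finite D'" "D' \<subseteq> E" "b \<in> D'" "\<And>h. partial_hom D' h \<Longrightarrow> h b = u h"
    by (rule determinedE[OF assms(2)]) blast
  show ?thesis
  proof (rule determinedI[of _ "D \<union> D' \<union> {a \<oplus> b}"])
    fix h assume h: "partial_hom (D \<union> D' \<union> {a \<oplus> b}) h"
    have "partial_hom D h" "partial_hom D' h" by (auto intro: partial_hom_mono[OF h])
    thus "h (a \<oplus> b) = t h \<oplus> u h" using partial_hom_add[OF h, of a b] D D' by simp
  qed (use D D' assms in auto)
qed

lemma determined_mult:
  assumes "determined E a t" "determined E b u" "a \<otimes> b \<in> E"
  shows "determined E (a \<otimes> b) (\<lambda>h. t h \<otimes> u h)"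
proof -
  obtain D where D: "a \<in> carrier R" "finite D" "D \<subseteq> E" "a \<in> D" "\<And>h. partial_hom D h \<Longrightarrow> h a = t h"
    by (rule determinedE[OF assms(1)]) blast
  obtain D' where D': "b \<in> carrier R" "finite D'" "D' \<subseteq> E" "b \<in> D'" "\<And>h. partial_hom D' h \<Longrightarrow> h b = u h"
    by (rule determinedE[OF assms(2)]) blast
  show ?thesis
  proof (rule determinedI[of _ "D \<union> D' \<union> {a \<otimes> b}"])
    fix h assume h: "partial_hom (D \<union> D' \<union> {a \<otimes> b}) h"
    have "partial_hom D h" "partial_hom D' h" by (auto intro: partial_hom_mono[OF h])
    thus "h (a \<otimes> b) = t h \<otimes> u h" using partial_hom_mult[OF h, of a b] D D' by simp
  qed (use D D' assms in auto)
qed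

lemma determined_a_inv:
  assumes "determined E a t" "\<ominus> a \<in> E" "\<zero> \<in> E"
  shows "determined E (\<ominus> a) (\<lambda>h. \<ominus> t h)"
proof -
  obtain D where D: "a \<in> carrier R" "finite D" "D \<subseteq> E" "a \<in> D" "\<And>h. partial_hom D h \<Longrightarrow> h a = t h"
    by (rule determinedE[OF assms(1)]) blast
  show ?thesis
  proof (rule determinedI[of _ "D \<union> {\<zero>, \<ominus> a}"])
    fix h assume h: "partial_hom (D \<union> {\<zero>, \<ominus> a}) h"
    have "partial_hom D h" by (auto intro: partial_hom_mono[OF h])
    moreover have "h a \<oplus> h (\<ominus> a) = \<zero>"
      using partial_hom_add[OF h, of a "\<ominus> a"] partial_hom_zero[OF h] D by (simp add: r_neg)
    moreover have "h a \<in> carrier R" "h (\<ominus> a) \<in> carrier R" using D by (auto intro: partial_hom_closed[OF h])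
    ultimately show "h (\<ominus> a) = \<ominus> t h" using D(5) by (metis a_comm minus_equality)
  qed (use D assms in auto)
qed

lemma determined_m_inv:
  assumes "determined E a t" "inv a \<in> E" "\<one> \<in> E" "a \<noteq> \<zero>"
  shows "determined E (inv a) (\<lambda>h. inv (t h))"
proof -
  obtain D where D: "a \<in> carrier R" "finite D" "D \<subseteq> E" "a \<in> D" "\<And>h. partial_hom D h \<Longrightarrow> h a = t h"
    by (rule determinedE[OF assms(1)]) blast
  have a: "a \<in> Units R" using D(1) assms(4) field_Units by blast
  show ?thesis
  proof (rule determinedI[of _ "D \<union> {\<one>, inv a}"])
    fix h assume h: "partial_hom (D \<union> {\<one>, inv a}) h"
    have "partial_hom D h" by (auto intro: partial_hom_mono[OF h])
    moreover have "h a \<otimes> h (inv a) = \<one>"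
      using partial_hom_mult[OF h, of a "inv a"] partial_hom_one[OF h] D a by simp
    moreover have "h a \<in> carrier R" "h (inv a) \<in> carrier R" using D by (auto intro: partial_hom_closed[OF h])
    ultimately show "h (inv a) = inv (t h)" using D(5) by (metis comm_inv_char)
  qed (use D assms a in auto)
qed

lemma determined_prime_subfield:
  assumes E: "subfield E R" and "c \<in> prime_subfield R" shows "determined E c (\<lambda>h. c)"
proof -
  have sub: "generate_field R {} \<subseteq> E" by (rule generate_field_min_subfield1[OF _ E]) auto
  note E' = subringE[OF subfieldE(1)[OF E]]
  from assms(2)[unfolded prime_subfield_def] show ?thesis
  proof (induction rule: generate_field.induct)
    case one show ?case using E' by (intro determined_one) auto
  next
    case (a_inv h) thus ?case using E' sub generate_field.a_inv[of h R "{}"] by (intro determined_a_inv) auto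
  next
    case (m_inv h) thus ?case using E' sub generate_field.m_inv[of h R "{}"] by (intro determined_m_inv) auto
  next
    case (eng_add h1 h2) thus ?case using sub generate_field.eng_add[of h1 R "{}" h2] by (intro determined_add) auto
  next
    case (eng_mult h1 h2) thus ?case using sub generate_field.eng_mult[of h1 R "{}" h2] by (intro determined_mult) auto
  qed simp
qed

text \<open>On a large enough finite set, partial homomorphisms send roots of \<open>p\<close> to
  roots of \<open>p\<close>. This leaves an algebraic element only finitely many images, as
  \<open>compactness\<close> requires, and also shows that endomorphisms permute roots.\<close>

lemma determined_eval:
  assumes E: "subfield E R" and p: "set p \<subseteq> prime_subfield R" and x: "x \<in> E"
  shows "determined E (eval p x) (\<lambda>h. eval p (h x))"
proof -
  note E' = subringE[OF subfieldE(1)[OF E]]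
  have sub: "prime_subfield R \<subseteq> E"
    unfolding prime_subfield_def by (rule generate_field_min_subfield1[OF _ E]) auto
  have pow_in: "x [^] n \<in> E" for n :: nat using x E' by (induction n) auto
  have pow: "determined E (x [^] n) (\<lambda>h. h x [^] n)" for n :: nat
  proof (induction n)
    case 0 show ?case using E' by (auto intro: determined_one)
  next
    case (Suc n)
    have "determined E (x [^] n \<otimes> x) (\<lambda>h. h x [^] n \<otimes> h x)"
      by (rule determined_mult[OF Suc determined_self]) (use x E' pow_in in auto)
    thus ?case by simp
  qed
  have "eval p x \<in> E \<and> determined E (eval p x) (\<lambda>h. eval p (h x))"
    using p
  proof (induction p)
    case Nil show ?case using E' by (auto intro: determined_zero)
  next
    case (Cons c p)
    have c: "c \<in> prime_subfield R" using Cons.prems by simp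
    have cx: "c \<otimes> x [^] length p \<in> E" using c sub pow_in E'(6) by blast
    hence in_E: "c \<otimes> x [^] length p \<oplus> eval p x \<in> E" using Cons E'(7) by auto
    thus ?case using Cons
      by (auto intro!: determined_add determined_mult determined_prime_subfield[OF E c] pow cx)
  qed
  thus ?thesis by blast
qed

lemma hom_imp_partial_hom:
  assumes "h \<in> ring_hom (R\<lparr>carrier := E\<rparr>) (R\<lparr>carrier := F\<rparr>)" "F \<subseteq> carrier R" "D \<subseteq> E"
  shows "partial_hom D h" "h ` D \<subseteq> F"
  using assms unfolding ring_hom_def partial_hom_def by (auto simp: subset_iff)

lemma finite_roots:
  assumes "p \<in> carrier (K[X])" "K \<subseteq> carrier R" "p \<noteq> []"
  shows "finite {y \<in> carrier R. eval p y = \<zero>}"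
proof -
  have "p \<in> carrier (poly_ring R)" using assms unfolding univ_poly_def polynomial_def by auto
  from finite_number_of_roots[OF this] show ?thesis by (rule finite_subset[rotated]) (auto simp: is_root_def assms)
qed

lemma prime_subfield_props: "subfield (prime_subfield R) R" "prime_subfield R \<subseteq> carrier R"
  unfolding prime_subfield_def
  using generate_field_is_subfield[of "{}"] generate_field_incl[of "{}"] by auto

end

lemma (in field) hom_from_partial_homs:
  assumes E: "subfield E R" and F: "subfield F R"
    and h: "\<And>D. finite D \<Longrightarrow> D \<subseteq> E \<Longrightarrow> partial_hom D h \<and> h ` D \<subseteq> F"
  shows "h \<in> ring_hom (R\<lparr>carrier := E\<rparr>) (R\<lparr>carrier := F\<rparr>)"
proof (rule ring_hom_memI)
  note E' = subringE[OF subfieldE(1)[OF E]]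
  show "h x \<in> carrier (R\<lparr>carrier := F\<rparr>)" if "x \<in> carrier (R\<lparr>carrier := E\<rparr>)" for x
    using h[of "{x}"] that by auto
  fix x y assume "x \<in> carrier (R\<lparr>carrier := E\<rparr>)" "y \<in> carrier (R\<lparr>carrier := E\<rparr>)"
  hence "partial_hom {x, y, x \<oplus> y, x \<otimes> y} h" using h[of "{x, y, x \<oplus> y, x \<otimes> y}"] E' by auto
  from partial_hom_add[OF this, of x y] partial_hom_mult[OF this, of x y]
  show "h (x \<otimes>\<^bsub>R\<lparr>carrier := E\<rparr>\<^esub> y) = h x \<otimes>\<^bsub>R\<lparr>carrier := F\<rparr>\<^esub> h y"
    "h (x \<oplus>\<^bsub>R\<lparr>carrier := E\<rparr>\<^esub> y) = h x \<oplus>\<^bsub>R\<lparr>carrier := F\<rparr>\<^esub> h y" by simp_all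
next
  show "h \<one>\<^bsub>R\<lparr>carrier := E\<rparr>\<^esub> = \<one>\<^bsub>R\<lparr>carrier := F\<rparr>\<^esub>"
    using h[of "{\<one>}"] partial_hom_one[of "{\<one>}" h] subringE(3)[OF subfieldE(1)[OF E]] by simp
qed

text \<open>Finite partial embeddings glue together because each algebraic element has finitely many
  possible images. The equation with \<open>R'\<close> fixes the element type to the naturals, along
  which \<open>compactness\<close> makes its choices.\<close>

lemma subfield_hom_exists:
  fixes R (structure) and R' :: "nat ring"
  assumes "field R" and R: "R = R'" and alg: "\<forall>x\<in>carrier R. ring.algebraic R (prime_subfield R) x"
    and E: "subfield E R" and F: "subfield F R"
    and ex: "\<And>D. finite D \<Longrightarrow> D \<subseteq> E \<Longrightarrow> \<exists>h. ring.partial_hom R D h \<and> h ` D \<subseteq> F"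
  shows "\<exists>h. h \<in> ring_hom (R\<lparr>carrier := E\<rparr>) (R\<lparr>carrier := F\<rparr>)"
proof -
  interpret field R by fact
  have EC: "E \<subseteq> carrier R" by (rule subfieldE(3)[OF E])
  have "\<exists>h. \<forall>D. finite D \<longrightarrow> D \<subseteq> E \<longrightarrow> partial_hom D h \<and> h ` D \<subseteq> F"
  proof (rule compactness)
    show "partial_hom D' h \<and> h ` D' \<subseteq> F" if "partial_hom D h \<and> h ` D \<subseteq> F" "D' \<subseteq> D" for D D' h
      using that partial_hom_mono by blast
    show "partial_hom D h' \<and> h' ` D \<subseteq> F" if eq: "\<And>x. x \<in> D \<Longrightarrow> h x = h' x" and "partial_hom D h \<and> h ` D \<subseteq> F" for D h h'
    proof -
      have "h ` D = h' ` D" using eq by (rule image_cong[OF refl])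
      thus ?thesis using that unfolding partial_hom_def by auto
    qed
    show "\<exists>h. partial_hom D h \<and> h ` D \<subseteq> F" if "finite D" "D \<subseteq> E" for D using ex[OF that] .
    fix x assume x: "x \<in> E"
    then obtain p where p: "p \<in> carrier ((prime_subfield R)[X])" "p \<noteq> []" "eval p x = \<zero>"
      using algebraicE[OF subfieldE(1)[OF prime_subfield_props(1)], of x] alg EC unfolding over_def by blast
    have "set p \<subseteq> prime_subfield R" using p(1) unfolding univ_poly_def polynomial_def by auto
    from determined_eval[OF E this x] obtain D where D: "finite D" "D \<subseteq> E" "eval p x \<in> D"
      "\<And>h. partial_hom D h \<Longrightarrow> h (eval p x) = eval p (h x)"
      by (rule determinedE) blast
    show "\<exists>D V. finite D \<and> D \<subseteq> E \<and> finite V \<and> (\<forall>h. partial_hom D h \<and> h ` D \<subseteq> F \<longrightarrow> h x \<in> V)"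
    proof (intro exI conjI allI impI)
      show "finite (insert x D)" "insert x D \<subseteq> E" using D x by auto
      show "finite {y \<in> carrier R. eval p y = \<zero>}" by (rule finite_roots[OF p(1) prime_subfield_props(2) p(2)])
      fix h assume h: "partial_hom (insert x D) h \<and> h ` insert x D \<subseteq> F"
      hence "partial_hom D h" using partial_hom_mono by blast
      hence "eval p (h x) = \<zero>" using D p partial_hom_zero by metis
      thus "h x \<in> {y \<in> carrier R. eval p y = \<zero>}" using h partial_hom_closed by blast
    qed
  qed
  thus ?thesis using hom_from_partial_homs[OF E F] by blast
qed

lemma (in field) subfield_iso_if_homs:
  assumes alg: "\<forall>x\<in>carrier R. algebraic (prime_subfield R) x"
    and E: "subfield E R" and F: "subfield F R"
    and f: "f \<in> ring_hom (R\<lparr>carrier := E\<rparr>) (R\<lparr>carrier := F\<rparr>)"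
    and g: "g \<in> ring_hom (R\<lparr>carrier := F\<rparr>) (R\<lparr>carrier := E\<rparr>)"
  shows "(R\<lparr>carrier := F\<rparr>) \<simeq> (R\<lparr>carrier := E\<rparr>)"
proof -
  note fields = subfield_iff(2)[OF E] subfield_iff(2)[OF F]
  have EC: "E \<subseteq> carrier R" by (rule subfieldE(3)[OF E])
  have inj: "inj_on f E" "inj_on g F"
    using non_trivial_field_hom_is_inj[OF f fields] non_trivial_field_hom_is_inj[OF g fields(2,1)] by auto
  have fE: "f ` E \<subseteq> F" and gF: "g ` F \<subseteq> E"
    using ring_hom_memE(1)[OF f] ring_hom_memE(1)[OF g] by auto
  have gf: "g \<circ> f \<in> ring_hom (R\<lparr>carrier := E\<rparr>) (R\<lparr>carrier := E\<rparr>)" by (rule ring_hom_trans[OF f g])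
  have "y \<in> g ` F" if y: "y \<in> E" for y
  proof -
    obtain p where p: "p \<in> carrier ((prime_subfield R)[X])" "p \<noteq> []" "eval p y = \<zero>"
      using algebraicE[OF subfieldE(1)[OF prime_subfield_props(1)], of y] alg EC y unfolding over_def by blast
    have set_p: "set p \<subseteq> prime_subfield R" using p(1) unfolding univ_poly_def polynomial_def by auto
    \<comment> \<open>The injective endomorphism \<open>g \<circ> f\<close> maps the finite set of
      roots of \<open>p\<close> in \<open>E\<close> into itself, hence onto itself, so the root
      \<open>y\<close> lies in the image of \<open>g\<close>.\<close>
    define Z' where "Z' = {z \<in> E. eval p z = \<zero>}"
    have "finite Z'" using finite_roots[OF p(1) prime_subfield_props(2) p(2)]
      by (rule finite_subset[rotated]) (use EC in \<open>auto simp: Z'_def\<close>)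
    moreover have "inj_on (g \<circ> f) Z'"
      by (rule inj_on_subset[OF comp_inj_on[OF inj(1)]]) (use inj(2) fE inj_on_subset in \<open>auto simp: Z'_def\<close>)
    moreover have "(g \<circ> f) z \<in> Z'" if z: "z \<in> Z'" for z
    proof -
      from z have zE: "z \<in> E" "eval p z = \<zero>" by (auto simp: Z'_def)
      from determined_eval[OF E set_p zE(1)] obtain D where D: "D \<subseteq> E" "eval p z \<in> D"
        "\<And>h. partial_hom D h \<Longrightarrow> h (eval p z) = eval p (h z)" by (rule determinedE) blast
      have ph: "partial_hom D (g \<circ> f)" by (rule hom_imp_partial_hom[OF gf EC D(1)])
      hence "eval p ((g \<circ> f) z) = \<zero>" using D(2,3) zE(2) partial_hom_zero by metis
      thus ?thesis using zE(1) fE gF unfolding Z'_def by auto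
    qed
    ultimately have "(g \<circ> f) ` Z' = Z'" by (intro endo_inj_surj) auto
    hence "y \<in> (g \<circ> f) ` Z'" using p(3) y unfolding Z'_def by auto
    thus ?thesis using fE unfolding Z'_def by auto
  qed
  hence "bij_betw g F E" using inj(2) gF unfolding bij_betw_def by blast
  hence "g \<in> ring_iso (R\<lparr>carrier := F\<rparr>) (R\<lparr>carrier := E\<rparr>)" using g unfolding ring_iso_def by simp
  thus ?thesis unfolding is_ring_iso_def by blast
qed

text \<open>Finite partial embeddings stated for tuples instead of sets: tuples have numeric codes,
  so the quantifiers become number quantifiers.\<close>

definition diagram_embeds :: "('a, 'b) ring_scheme \<Rightarrow> 'a set \<Rightarrow> 'a set \<Rightarrow> bool" where
  "diagram_embeds R E F \<longleftrightarrow> (\<forall>as. set as \<subseteq> E \<longrightarrow> (\<exists>bs. length bs = length as \<and> set bs \<subseteq> F \<and>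
     (\<forall>i<length as. as ! i = \<one>\<^bsub>R\<^esub> \<longrightarrow> bs ! i = \<one>\<^bsub>R\<^esub>) \<and>
     (\<forall>i<length as. \<forall>j<length as. \<forall>k<length as.
        (as ! i \<oplus>\<^bsub>R\<^esub> as ! j = as ! k \<longrightarrow> bs ! i \<oplus>\<^bsub>R\<^esub> bs ! j = bs ! k) \<and>
        (as ! i \<otimes>\<^bsub>R\<^esub> as ! j = as ! k \<longrightarrow> bs ! i \<otimes>\<^bsub>R\<^esub> bs ! j = bs ! k))))"

lemma hom_imp_diagram_embeds:
  assumes "h \<in> ring_hom (R\<lparr>carrier := E\<rparr>) (R\<lparr>carrier := F\<rparr>)"
  shows "diagram_embeds R E F"
  unfolding diagram_embeds_def
proof (intro allI impI)
  fix as assume as: "set as \<subseteq> E"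
  have nth: "as ! i \<in> E" if "i < length as" for i using as that by auto
  have h: "\<And>x y. x \<in> E \<Longrightarrow> y \<in> E \<Longrightarrow> h (x \<oplus>\<^bsub>R\<^esub> y) = h x \<oplus>\<^bsub>R\<^esub> h y"
    "\<And>x y. x \<in> E \<Longrightarrow> y \<in> E \<Longrightarrow> h (x \<otimes>\<^bsub>R\<^esub> y) = h x \<otimes>\<^bsub>R\<^esub> h y" "h \<one>\<^bsub>R\<^esub> = \<one>\<^bsub>R\<^esub>"
    using ring_hom_memE(2-4)[OF assms] by simp_all
  show "\<exists>bs. length bs = length as \<and> set bs \<subseteq> F \<and>
     (\<forall>i<length as. as ! i = \<one>\<^bsub>R\<^esub> \<longrightarrow> bs ! i = \<one>\<^bsub>R\<^esub>) \<and>
     (\<forall>i<length as. \<forall>j<length as. \<forall>k<length as.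
        (as ! i \<oplus>\<^bsub>R\<^esub> as ! j = as ! k \<longrightarrow> bs ! i \<oplus>\<^bsub>R\<^esub> bs ! j = bs ! k) \<and>
        (as ! i \<otimes>\<^bsub>R\<^esub> as ! j = as ! k \<longrightarrow> bs ! i \<otimes>\<^bsub>R\<^esub> bs ! j = bs ! k))"
  proof (rule exI[of _ "map h as"], intro conjI allI impI)
    show "set (map h as) \<subseteq> F" using as ring_hom_memE(1)[OF assms] by auto
  qed (use h nth in \<open>auto\<close>, metis h(1) nth, metis h(2) nth)
qed

lemma (in field) diagram_embeds_imp_partial_hom:
  assumes "diagram_embeds R E F" "F \<subseteq> carrier R" "finite D" "D \<subseteq> E"
  shows "\<exists>h. partial_hom D h \<and> h ` D \<subseteq> F"
proof -
  obtain as where as: "set as = D" "distinct as" using finite_distinct_list[OF assms(3)] by blast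
  from assms(1)[unfolded diagram_embeds_def, rule_format, of as] as assms(4)
  obtain bs where bs: "length bs = length as" "set bs \<subseteq> F"
     "\<And>i. i<length as \<Longrightarrow> as ! i = \<one> \<Longrightarrow> bs ! i = \<one>"
     "\<And>i j k. i<length as \<Longrightarrow> j<length as \<Longrightarrow> k<length as \<Longrightarrow> as ! i \<oplus> as ! j = as ! k \<Longrightarrow> bs ! i \<oplus> bs ! j = bs ! k"
     "\<And>i j k. i<length as \<Longrightarrow> j<length as \<Longrightarrow> k<length as \<Longrightarrow> as ! i \<otimes> as ! j = as ! k \<Longrightarrow> bs ! i \<otimes> bs ! j = bs ! k"
    by auto
  define idx where "idx x = (SOME i. i < length as \<and> as ! i = x)" for x
  have idx: "idx x < length as" "as ! idx x = x" if "x \<in> D" for x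
    using someI_ex[of "\<lambda>i. i < length as \<and> as ! i = x"] that as(1) unfolding idx_def
    by (auto simp: in_set_conv_nth)
  define h where "h x = bs ! idx x" for x
  have "h ` D \<subseteq> F" using bs(1,2) idx(1) unfolding h_def by (auto simp: subset_iff)
  moreover have "partial_hom D h"
    unfolding partial_hom_def
  proof (intro conjI ballI impI)
    show "h ` D \<subseteq> carrier R" using \<open>h ` D \<subseteq> F\<close> assms(2) by blast
    show "h \<one> = \<one>" if "\<one> \<in> D" using bs(3) idx[OF that] unfolding h_def by blast
    show "h (x \<oplus> y) = h x \<oplus> h y" if "x \<in> D" "y \<in> D" "x \<oplus> y \<in> D" for x y
      using bs(4)[OF idx(1)[OF that(1)] idx(1)[OF that(2)] idx(1)[OF that(3)]] idx(2) that unfolding h_def by simp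
    show "h (x \<otimes> y) = h x \<otimes> h y" if "x \<in> D" "y \<in> D" "x \<otimes> y \<in> D" for x y
      using bs(5)[OF idx(1)[OF that(1)] idx(1)[OF that(2)] idx(1)[OF that(3)]] idx(2) that unfolding h_def by simp
  qed
  ultimately show ?thesis by blast
qed

text \<open>Replaces a quantifier over functions, the isomorphism, by quantifiers over tuples; the
  upper bound on complexity rests on this.\<close>

theorem subfield_iso_iff_diagrams:
  fixes R :: "nat ring"
  assumes "field R" and alg: "\<forall>x\<in>carrier R. ring.algebraic R (prime_subfield R) x"
    and E: "subfield E R" and F: "subfield F R"
  shows "(R\<lparr>carrier := E\<rparr>) \<simeq> (R\<lparr>carrier := F\<rparr>) \<longleftrightarrow> diagram_embeds R E F \<and> diagram_embeds R F E"
proof -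
  interpret field R by fact
  show ?thesis
  proof
    assume iso: "(R\<lparr>carrier := E\<rparr>) \<simeq> (R\<lparr>carrier := F\<rparr>)"
    from this ring_iso_sym[OF subring_is_ring[OF subfieldE(1)[OF E]] iso]
    obtain f g where "f \<in> ring_hom (R\<lparr>carrier := E\<rparr>) (R\<lparr>carrier := F\<rparr>)" "g \<in> ring_hom (R\<lparr>carrier := F\<rparr>) (R\<lparr>carrier := E\<rparr>)"
      unfolding is_ring_iso_def ring_iso_def by blast
    thus "diagram_embeds R E F \<and> diagram_embeds R F E" using hom_imp_diagram_embeds by blast
  next
    assume emb: "diagram_embeds R E F \<and> diagram_embeds R F E"
    note ph = diagram_embeds_imp_partial_hom
    from subfield_hom_exists[OF assms(1) refl alg E F] subfield_hom_exists[OF assms(1) refl alg F E]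
      ph[of E F] ph[of F E] emb subfieldE(3)[OF E] subfieldE(3)[OF F]
    obtain f g where "f \<in> ring_hom (R\<lparr>carrier := F\<rparr>) (R\<lparr>carrier := E\<rparr>)" "g \<in> ring_hom (R\<lparr>carrier := E\<rparr>) (R\<lparr>carrier := F\<rparr>)"
      by blast
    from subfield_iso_if_homs[OF alg F E this] show "(R\<lparr>carrier := E\<rparr>) \<simeq> (R\<lparr>carrier := F\<rparr>)" .
  qed
qed

section \<open>Fields generated by square roots of primes\<close>

context field
begin

abbreviation int_emb :: "int \<Rightarrow> 'a" where "int_emb k \<equiv> add_pow R k \<one>"

lemma int_emb_closed: "int_emb k \<in> carrier R"
  by simp

lemma int_emb_add: "int_emb (i + j) = int_emb i \<oplus> int_emb j"
  by (rule add.int_pow_mult) simp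

lemma int_emb_mult: "int_emb (i * j) = int_emb i \<otimes> int_emb j"
proof -
  have "int_emb i \<otimes> int_emb j = add_pow R i (int_emb j)"
    using add_pow_ldistr_int[of \<one> "int_emb j" i] by simp
  also have "\<dots> = int_emb (j * i)" using add.int_pow_pow[of \<one> i j] by simp
  finally show ?thesis by (simp add: mult.commute)
qed

lemma int_emb_minus: "int_emb (- i) = \<ominus> int_emb i"
  by (rule add.int_pow_neg) simp

lemma int_emb_01: "int_emb 0 = \<zero>" "int_emb 1 = \<one>"
  by (simp_all add: add_pow_int_ge)

lemma int_emb_nat: "int_emb (int n) = add_pow R n \<one>"
  by (simp add: add_pow_int_ge)

lemma int_emb_eq_0: "char0 R \<Longrightarrow> int_emb k = \<zero> \<longleftrightarrow> k = 0"
proof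
  assume c: "char0 R" and k: "int_emb k = \<zero>"
  have "int_emb (- k) = \<zero>" using k by (simp add: int_emb_minus)
  with k have "int_emb \<bar>k\<bar> = \<zero>" by (simp add: abs_if)
  hence "add_pow R (nat \<bar>k\<bar>) \<one> = \<zero>" using int_emb_nat[of "nat \<bar>k\<bar>"] by simp
  thus "k = 0" using c unfolding char0_def by (metis nat_0_iff abs_le_zero_iff bot_nat_0.not_eq_extremum)
qed (simp add: int_emb_01)

lemma int_emb_inj: "char0 R \<Longrightarrow> int_emb i = int_emb j \<longleftrightarrow> i = j"
proof -
  assume c: "char0 R"
  have "int_emb (i - j) = int_emb i \<ominus> int_emb j"
    unfolding a_minus_def by (metis diff_conv_add_uminus int_emb_add int_emb_minus)
  thus ?thesis using int_emb_eq_0[OF c, of "i - j"]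
    by (metis int_emb_closed r_right_minus_eq right_minus_eq)
qed

text \<open>The field of fractions of \<open>D\<close> inside \<open>R\<close>. Writing a quotient
  as a solution of \<open>z \<otimes> w = u\<close> keeps inverses out of most closure
  arguments.\<close>

definition fractions :: "'a set \<Rightarrow> 'a set" where
  "fractions D = {z \<in> carrier R. \<exists>u\<in>D. \<exists>w\<in>D. w \<noteq> \<zero> \<and> z \<otimes> w = u}"

lemma subfield_fractions:
  assumes "subring D R" shows "subfield (fractions D) R" "D \<subseteq> fractions D"
proof -
  note D = subringE[OF assms]
  have c: "\<And>x. x \<in> D \<Longrightarrow> x \<in> carrier R" using D(1) by blast
  show "D \<subseteq> fractions D"
  proof
    fix x assume x: "x \<in> D"
    hence "x \<otimes> \<one> = x" using c by simp
    hence "\<exists>u\<in>D. \<exists>w\<in>D. w \<noteq> \<zero> \<and> x \<otimes> w = u" using x D(3) one_not_zero by blast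
    thus "x \<in> fractions D" unfolding fractions_def using c[OF x] by blast
  qed
  show "subfield (fractions D) R"
  proof (rule subfieldI'[OF subringI])
    show "fractions D \<subseteq> carrier R" unfolding fractions_def by auto
    show "\<one> \<in> fractions D" using D(3) \<open>D \<subseteq> fractions D\<close> by blast
  next
    fix z assume "z \<in> fractions D"
    then obtain u w where z: "z \<in> carrier R" "u \<in> D" "w \<in> D" "w \<noteq> \<zero>" "z \<otimes> w = u" unfolding fractions_def by blast
    hence "\<ominus> z \<otimes> w = \<ominus> u" using c by (simp add: l_minus)
    thus "\<ominus> z \<in> fractions D" unfolding fractions_def using z D(5) by blast
  next
    fix z z' assume "z \<in> fractions D" "z' \<in> fractions D"
    then obtain u w u' w' where z: "z \<in> carrier R" "u \<in> D" "w \<in> D" "w \<noteq> \<zero>" "z \<otimes> w = u"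
      and z': "z' \<in> carrier R" "u' \<in> D" "w' \<in> D" "w' \<noteq> \<zero>" "z' \<otimes> w' = u'" unfolding fractions_def by blast
    have ww: "w \<otimes> w' \<in> D" "w \<otimes> w' \<noteq> \<zero>" using z z' D(6) c by (auto simp: integral_iff)
    have "(z \<oplus> z') \<otimes> (w \<otimes> w') = (z \<otimes> w) \<otimes> w' \<oplus> (z' \<otimes> w') \<otimes> w" using z(1,3) z'(1,3) c by (simp add: l_distr r_distr m_ac)
    hence "(z \<oplus> z') \<otimes> (w \<otimes> w') \<in> D" using z z' D(6,7) by simp
    thus "z \<oplus> z' \<in> fractions D" unfolding fractions_def using ww z(1) z'(1) by blast
    have "(z \<otimes> z') \<otimes> (w \<otimes> w') = (z \<otimes> w) \<otimes> (z' \<otimes> w')" using z(1,3) z'(1,3) c by (simp add: m_ac)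
    hence "(z \<otimes> z') \<otimes> (w \<otimes> w') \<in> D" using z z' D(6) by simp
    thus "z \<otimes> z' \<in> fractions D" unfolding fractions_def using ww z(1) z'(1) by blast
  next
    fix z assume "z \<in> fractions D - {\<zero>}"
    then obtain u w where z: "z \<in> carrier R" "u \<in> D" "w \<in> D" "w \<noteq> \<zero>" "z \<otimes> w = u" "z \<noteq> \<zero>" unfolding fractions_def by blast
    have u: "u \<noteq> \<zero>" using z c integral_iff by auto
    have zU: "z \<in> Units R" using z field_Units by blast
    have "inv z \<otimes> u = (inv z \<otimes> z) \<otimes> w" unfolding z(5)[symmetric] by (rule m_assoc[symmetric]) (use zU z(1,3) c in auto)
    hence "inv z \<otimes> u = w" unfolding Units_l_inv[OF zU] using c[OF z(3)] by simp
    thus "inv z \<in> fractions D" unfolding fractions_def using z u zU by blast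
  qed
qed

lemma prime_subfield_fraction:
  assumes "c \<in> prime_subfield R"
  obtains a b where "int_emb b \<noteq> \<zero>" "c \<otimes> int_emb b = int_emb a"
proof -
  have "subring (range int_emb) R"
  proof (rule subringI)
    show "\<one> \<in> range int_emb" by (rule range_eqI[of _ _ 1]) (simp add: int_emb_01)
  qed (auto simp flip: int_emb_minus int_emb_add int_emb_mult)
  from subfield_fractions[OF this] have "generate_field R {} \<subseteq> fractions (range int_emb)"
    by (intro generate_field_min_subfield1) auto
  thus ?thesis using assms that unfolding prime_subfield_def fractions_def by blast
qed

lemma int_emb_in_subfield: assumes "subfield E R" shows "int_emb k \<in> E"
proof -
  note E = subringE[OF subfieldE(1)[OF assms]]
  have "add_pow R n \<one> \<in> E" for n :: nat using E by (induction n) auto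
  from this[of "nat k"] this[of "nat (- k)"] show ?thesis
    using E(5) by (cases "k \<ge> 0") (simp_all add: add_pow_int_ge add_pow_int_lt)
qed

lemma generate_field_subfield: "subfield E R \<Longrightarrow> generate_field R E = E"
  by (intro equalityI generate_field_min_subfield1 subfieldE(3) subset_refl) (auto intro: generate_field.incl)

lemma quadratic_extension:
  assumes F: "subfield F R" and w: "w \<in> carrier R" "w \<otimes> w \<in> F" and z: "z \<in> generate_field R (insert w F)"
  shows "\<exists>x\<in>F. \<exists>y\<in>F. z = x \<oplus> y \<otimes> w"
proof -
  note F' = subringE[OF subfieldE(1)[OF F]]
  have c: "\<And>x. x \<in> F \<Longrightarrow> x \<in> carrier R" using F'(1) by blast
  have "[\<one>, \<zero>, \<ominus> (w \<otimes> w)] \<in> carrier (F[X])"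
    unfolding univ_poly_def polynomial_def using F'(2,3,5) w(2) by auto
  moreover have "eval [\<one>, \<zero>, \<ominus> (w \<otimes> w)] w = \<zero>"
    using w(1) by (simp add: numeral_2_eq_2 r_neg)
  ultimately have "(algebraic over F) w" unfolding over_def
    by (intro algebraicI[unfolded over_def]) auto
  hence "subfield (simple_extension F w) R" using simple_extension_is_subfield[OF F w(1)] by blast
  moreover have "insert w F \<subseteq> simple_extension F w"
    using simple_extension_mem[OF subfieldE(1)[OF F] w(1)] simple_extension_incl[OF F'(1) w(1)] by blast
  moreover have "insert w F \<subseteq> carrier R" using w F'(1) by blast
  ultimately have "z \<in> simple_extension F w" using generate_field_min_subfield1 z by blast
  thus ?thesis
  proof (induction rule: simple_extension.induct)
    case zero show ?case using F'(2) w(1) by (intro bexI[of _ \<zero>]) auto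
  next
    case (lin k1 k2)
    then obtain x y where xy: "x \<in> F" "y \<in> F" "k1 = x \<oplus> y \<otimes> w" by blast
    \<comment> \<open>Multiplication by \<open>w\<close> exchanges the two coordinates, and
      \<open>w \<otimes> w\<close> is absorbed into \<open>F\<close>.\<close>
    have "k1 \<otimes> w \<oplus> k2 = (y \<otimes> (w \<otimes> w) \<oplus> k2) \<oplus> x \<otimes> w"
      using xy c[OF xy(1)] c[OF xy(2)] c[OF lin(2)] w(1) by (simp add: l_distr m_assoc a_ac)
    moreover have "y \<otimes> (w \<otimes> w) \<oplus> k2 \<in> F" using xy(2) w(2) lin(2) F'(6,7) by blast
    ultimately show ?case using xy(1) by blast
  qed
qed

lemma insert_generate_field:
  assumes "A \<subseteq> carrier R" "w \<in> carrier R"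
  shows "generate_field R (insert w A) = generate_field R (insert w (generate_field R A))"
proof
  have 1: "insert w (generate_field R A) \<subseteq> carrier R" using generate_field_incl[OF assms(1)] assms(2) by blast
  show "generate_field R (insert w A) \<subseteq> generate_field R (insert w (generate_field R A))"
    by (rule mono_generate_field[OF _ 1]) (auto intro: generate_field.incl)
  have 2: "insert w A \<subseteq> carrier R" using assms by blast
  have "insert w (generate_field R A) \<subseteq> generate_field R (insert w A)"
    using mono_generate_field[OF _ 2, of A] generate_field.incl[of w "insert w A" R] by blast
  thus "generate_field R (insert w (generate_field R A)) \<subseteq> generate_field R (insert w A)"
    by (rule generate_field_min_subfield1[OF 1 generate_field_is_subfield[OF 2]])
qed

text \<open>Induction on the radicands; this is the quadratic case of Kummer theory. With
  \<open>z = x \<oplus> y \<otimes> s q\<close> over the field of the earlier roots,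
  \<open>z \<otimes> z\<close> is rational, so the mixed term lies in that smaller field. Hence
  \<open>s q\<close> was there already, or one of \<open>x\<close> and \<open>y\<close> is
  zero.\<close>

lemma square_in_sqrt_extension:
  assumes char: "char0 R" and "finite Q" and "\<And>q. q \<in> Q \<Longrightarrow> prime q"
    and s: "\<And>q. q \<in> Q \<Longrightarrow> s q \<in> carrier R \<and> s q \<otimes> s q = int_emb q"
    and "z \<in> generate_field R (s ` Q)" "r \<in> prime_subfield R" "r \<noteq> \<zero>" "z \<otimes> z = r"
  shows "\<exists>T\<subseteq>Q. \<exists>u\<in>prime_subfield R. r = u \<otimes> u \<otimes> int_emb (\<Prod>T)"
proof -
  have P: "subfield (prime_subfield R) R" unfolding prime_subfield_def by (rule generate_field_is_subfield) auto
  note P' = subringE[OF subfieldE(1)[OF P]]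
  have Pc: "\<And>x. x \<in> prime_subfield R \<Longrightarrow> x \<in> carrier R" using P'(1) by blast
  show ?thesis
    using assms(2-)
  proof (induction Q arbitrary: z r rule: finite_induct)
    case empty
    have "z \<in> prime_subfield R" using empty.prems(3) unfolding prime_subfield_def by simp
    thus ?case using empty.prems Pc by (intro exI[of _ "{}"] conjI bexI[of _ z]) (auto simp: int_emb_01)
  next
    case (insert q Q)
    let ?F = "generate_field R (s ` Q)"
    have q: "prime q" "s q \<in> carrier R" "s q \<otimes> s q = int_emb q" using insert.prems(1,2) by auto
    have sS: "s ` Q \<subseteq> carrier R" using insert.prems(2) by auto
    have F: "subfield ?F R" by (rule generate_field_is_subfield[OF sS])
    note F' = subringE[OF subfieldE(1)[OF F]]
    have Fc: "\<And>x. x \<in> ?F \<Longrightarrow> x \<in> carrier R" using F'(1) by blast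
    have PF: "prime_subfield R \<subseteq> ?F" unfolding prime_subfield_def by (rule mono_generate_field[OF _ sS]) simp
    have IH: "\<exists>T\<subseteq>Q. \<exists>u\<in>prime_subfield R. r = u \<otimes> u \<otimes> int_emb (\<Prod>T)"
      if "z \<in> ?F" "r \<in> prime_subfield R" "r \<noteq> \<zero>" "z \<otimes> z = r" for z r
      using insert.IH[OF _ _ that] insert.prems(1,2) by blast
    have zq: "z \<in> generate_field R (insert (s q) ?F)"
      using insert.prems(3) insert_generate_field[OF sS q(2)] by simp
    have qF: "s q \<otimes> s q \<in> ?F" unfolding q(3) by (rule int_emb_in_subfield[OF F])
    from quadratic_extension[OF F q(2) qF zq]
    obtain x y where xy: "x \<in> ?F" "y \<in> ?F" "z = x \<oplus> y \<otimes> s q" by blast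
    have xyc: "x \<in> carrier R" "y \<in> carrier R" using xy Fc by auto
    consider "s q \<in> ?F" | "x = \<zero>" | "y = \<zero>" | "s q \<notin> ?F" "x \<noteq> \<zero>" "y \<noteq> \<zero>" by blast
    thus ?case
    proof cases
      case 1
      hence "z \<in> ?F" using xy F'(6,7) by blast
      from IH[OF this insert.prems(4-6)] show ?thesis by blast
    next
      case 3
      hence "z \<in> ?F" using xy xyc q(2) by simp
      from IH[OF this insert.prems(4-6)] show ?thesis by blast
    next
      case 2
      \<comment> \<open>Here \<open>r\<close> is \<open>y \<otimes> y\<close> times
        \<open>q\<close>, so \<open>r\<close> times \<open>q\<close> is the square of
        \<open>y\<close> times \<open>q\<close> in the smaller field. Applying the induction
        hypothesis to that product and dividing by \<open>q\<close> twice puts \<open>q\<close> into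
        \<open>T\<close> and into the denominator of \<open>u\<close>.\<close>
      have z: "z = y \<otimes> s q" using xy xyc q(2) 2 by simp
      have iq: "int_emb q \<in> prime_subfield R" "int_emb q \<noteq> \<zero>"
        using int_emb_in_subfield[OF P] int_emb_eq_0[OF char, of q] q(1) by auto
      have iqc: "int_emb q \<in> carrier R" by simp
      have iqU: "int_emb q \<in> Units R" using iq iqc field_Units by blast
      have rc: "r \<in> carrier R" using insert.prems(4) Pc by blast
      have "(y \<otimes> int_emb q) \<otimes> (y \<otimes> int_emb q) = (y \<otimes> s q) \<otimes> (y \<otimes> s q) \<otimes> int_emb q"
        unfolding q(3)[symmetric] using xyc q(2) by (simp add: m_ac)
      hence "(y \<otimes> int_emb q) \<otimes> (y \<otimes> int_emb q) = r \<otimes> int_emb q" using insert.prems(6) z by simp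
      moreover have "y \<otimes> int_emb q \<in> ?F" using xy(2) int_emb_in_subfield[OF F] F'(6) by blast
      moreover have "r \<otimes> int_emb q \<in> prime_subfield R" using insert.prems(4) iq P'(6) by blast
      moreover have "r \<otimes> int_emb q \<noteq> \<zero>" using insert.prems(5) iq(2) rc iqc integral_iff by auto
      ultimately obtain T u where Tu: "T \<subseteq> Q" "u \<in> prime_subfield R" "r \<otimes> int_emb q = u \<otimes> u \<otimes> int_emb (\<Prod>T)"
        using IH by blast
      let ?i = "inv (int_emb q)"
      have inv: "?i \<in> carrier R" "int_emb q \<otimes> ?i = \<one>" using iqU by auto
      have uc: "u \<in> carrier R" using Tu(2) Pc by blast
      have iP: "?i \<in> prime_subfield R" using iq subfield_m_inv(1)[OF P] by blast
      have "q \<notin> T" "finite T" using Tu(1) insert.hyps finite_subset by auto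
      hence prod: "int_emb (\<Prod>(insert q T)) = int_emb q \<otimes> int_emb (\<Prod>T)" by (simp add: int_emb_mult)
      have "r = (r \<otimes> int_emb q) \<otimes> ?i" using rc inv iqc by (simp add: m_assoc)
      also have "\<dots> = u \<otimes> u \<otimes> int_emb (\<Prod>T) \<otimes> ?i \<otimes> (int_emb q \<otimes> ?i)" using Tu(3) inv uc by simp
      also have "\<dots> = (u \<otimes> ?i) \<otimes> (u \<otimes> ?i) \<otimes> int_emb (\<Prod>(insert q T))"
        unfolding prod using uc inv(1) iqc int_emb_closed[of "\<Prod>T"] by (simp add: m_ac)
      finally have "r = (u \<otimes> ?i) \<otimes> (u \<otimes> ?i) \<otimes> int_emb (\<Prod>(insert q T))" .
      moreover have "u \<otimes> ?i \<in> prime_subfield R" using Tu(2) iP P'(6) by blast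
      ultimately show ?thesis using Tu(1)
        by (intro exI[of _ "insert q T"] conjI bexI[of _ "u \<otimes> ?i"]) auto
    next
      case 4
      \<comment> \<open>The coefficient of \<open>s q\<close> in \<open>z \<otimes> z\<close>. It is
        nonzero because 2 is nonzero in characteristic 0, so \<open>s q\<close> can be solved for in
        the smaller field, against the case assumption.\<close>
      let ?t = "int_emb 2 \<otimes> (x \<otimes> y)"
      have tF: "?t \<in> ?F" using xy int_emb_in_subfield[OF F] F'(6) by blast
      have t0: "?t \<noteq> \<zero>" using 4 xyc int_emb_eq_0[OF char, of 2] by (simp add: integral_iff)
      have tc: "?t \<in> carrier R" using tF Fc by blast
      have two: "int_emb 2 = \<one> \<oplus> \<one>" using int_emb_add[of 1 1] by simp
      define A where "A = x \<otimes> x \<oplus> y \<otimes> y \<otimes> int_emb q"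
      have A: "A \<in> ?F" unfolding A_def
        by (intro F'(7)[OF F'(6) F'(6)] F'(6) xy int_emb_in_subfield[OF F])
      have Ac: "A \<in> carrier R" using A Fc by blast
      have "z \<otimes> z = A \<oplus> ?t \<otimes> s q"
        unfolding xy(3) A_def two q(3)[symmetric] using xyc q(2)
        by (simp add: l_distr r_distr m_ac a_ac)
      hence "r \<ominus> A = (A \<oplus> ?t \<otimes> s q) \<ominus> A" using insert.prems(6) by simp
      also have "\<dots> = ?t \<otimes> s q"
      proof -
        have tq: "?t \<otimes> s q \<in> carrier R" using tc q(2) by (rule m_closed)
        have "(A \<oplus> b) \<ominus> A = b" if "b \<in> carrier R" for b using that Ac by algebra
        from this[OF tq] show ?thesis .
      qed
      finally have "?t \<otimes> s q = r \<ominus> A" by (rule sym)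
      moreover have "r \<ominus> A \<in> ?F" unfolding a_minus_def using A PF insert.prems(4) F'(5,7) by blast
      moreover have "s q = inv ?t \<otimes> (?t \<otimes> s q)"
        using t0 tc q(2) field_Units by (simp add: m_assoc[symmetric])
      moreover have "inv ?t \<in> ?F" using t0 tF subfield_m_inv(1)[OF F] by blast
      ultimately have "s q \<in> ?F" using F'(6) by metis
      thus ?thesis using 4 by blast
    qed
  qed
qed

text \<open>The exponent of \<open>q\<close> is odd on the left and even on the right, because
  \<open>q\<close> does not divide the product of the other primes.\<close>

lemma prime_not_square_times_prod:
  fixes q :: int
  assumes q: "prime q" and T: "finite T" "\<And>p. p \<in> T \<Longrightarrow> prime p" "q \<notin> T" and "b \<noteq> 0"
    and eq: "q * b * b = a * a * \<Prod>T"
  shows False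
proof -
  have "0 \<notin> T" using T(2)[of 0] by auto
  hence T0: "\<Prod>T \<noteq> 0" using T(1) by (simp add: prod_zero_iff)
  have "\<not> q dvd \<Prod>T"
  proof
    assume "q dvd \<Prod>T"
    then obtain p where "p \<in> T" "q dvd p" using prime_dvd_prod_iff[OF T(1) q, of "\<lambda>x. x"] by auto
    thus False using T(2,3) q primes_dvd_imp_eq by blast
  qed
  hence m: "multiplicity q (\<Prod>T) = 0" by (rule not_dvd_imp_multiplicity_0)
  have q0: "q \<noteq> 0" and qe: "prime_elem q" "multiplicity q q = 1" using q by (auto simp: multiplicity_self prime_imp_prime_elem)
  have "a \<noteq> 0" using eq q0 assms(5) by auto
  hence "multiplicity q (a * a * \<Prod>T) = 2 * multiplicity q a"
    using T0 m by (simp add: prime_elem_multiplicity_mult_distrib[OF qe(1)])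
  moreover have "multiplicity q (q * b * b) = multiplicity q (q * b) + multiplicity q b"
    by (rule prime_elem_multiplicity_mult_distrib[OF qe(1)]) (use q0 assms(5) in simp_all)
  moreover have "multiplicity q (q * b) = multiplicity q q + multiplicity q b"
    by (rule prime_elem_multiplicity_mult_distrib[OF qe(1)]) (use q0 assms(5) in simp_all)
  ultimately have "1 + 2 * multiplicity q b = 2 * multiplicity q a" using qe(2) unfolding eq by linarith
  thus False by presburger
qed

text \<open>Brings an infinite set of radicands down to the finite sets that
  \<open>square_in_sqrt_extension\<close> handles.\<close>

lemma generate_field_finitary:
  assumes "A \<subseteq> carrier R" "x \<in> generate_field R A"
  shows "\<exists>A'\<subseteq>A. finite A' \<and> x \<in> generate_field R A'"
  using assms(2)
proof (induction rule: generate_field.induct)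
  case one show ?case by (intro exI[of _ "{}"]) (auto intro: generate_field.one)
next
  case (incl h) thus ?case by (intro exI[of _ "{h}"]) (auto intro: generate_field.incl)
next
  case (a_inv h) thus ?case by (meson generate_field.a_inv)
next
  case (m_inv h) thus ?case by (meson generate_field.m_inv)
next
  case (eng_add h1 h2)
  then obtain A1 A2 where A: "A1 \<subseteq> A" "finite A1" "h1 \<in> generate_field R A1" "A2 \<subseteq> A" "finite A2" "h2 \<in> generate_field R A2" by blast
  hence "A1 \<union> A2 \<subseteq> carrier R" using assms(1) by blast
  from mono_generate_field[OF _ this, of A1] mono_generate_field[OF _ this, of A2] A
  have "h1 \<oplus> h2 \<in> generate_field R (A1 \<union> A2)" by (intro generate_field.eng_add) auto
  thus ?case using A by (intro exI[of _ "A1 \<union> A2"]) auto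
next
  case (eng_mult h1 h2)
  then obtain A1 A2 where A: "A1 \<subseteq> A" "finite A1" "h1 \<in> generate_field R A1" "A2 \<subseteq> A" "finite A2" "h2 \<in> generate_field R A2" by blast
  hence "A1 \<union> A2 \<subseteq> carrier R" using assms(1) by blast
  from mono_generate_field[OF _ this, of A1] mono_generate_field[OF _ this, of A2] A
  have "h1 \<otimes> h2 \<in> generate_field R (A1 \<union> A2)" by (intro generate_field.eng_mult) auto
  thus ?case using A by (intro exI[of _ "A1 \<union> A2"]) auto
qed

text \<open>Both roots of every radicand are included, so the set can be enumerated from
  \<open>Q\<close> without choosing signs.\<close>

definition square_roots :: "int set \<Rightarrow> 'a set" where
  "square_roots Q = {x \<in> carrier R. \<exists>q\<in>Q. x \<otimes> x = int_emb q}"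

text \<open>\<open>Q\<close> can be read off from the field as the set of primes that have a square
  root there. Having a square root survives homomorphisms, so \<open>Q\<close> is an isomorphism
  invariant.\<close>

lemma prime_square_root_mem_iff:
  assumes char: "char0 R" and Q: "\<And>q. q \<in> Q \<Longrightarrow> prime q" and q: "prime q"
    and roots: "\<And>q. prime q \<Longrightarrow> \<exists>x\<in>carrier R. x \<otimes> x = int_emb q"
  shows "(\<exists>x\<in>generate_field R (square_roots Q). x \<otimes> x = int_emb q) \<longleftrightarrow> q \<in> Q"
proof
  assume "q \<in> Q"
  thus "\<exists>x\<in>generate_field R (square_roots Q). x \<otimes> x = int_emb q"
    using roots[OF q] unfolding square_roots_def by (auto intro!: generate_field.incl)
next
  assume "\<exists>x\<in>generate_field R (square_roots Q). x \<otimes> x = int_emb q"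
  then obtain x where x: "x \<in> generate_field R (square_roots Q)" "x \<otimes> x = int_emb q" by blast
  show "q \<in> Q"
  proof (rule ccontr)
    assume nq: "q \<notin> Q"
    obtain s where s: "\<And>q. prime q \<Longrightarrow> s q \<in> carrier R \<and> s q \<otimes> s q = int_emb q" using roots by metis
    have sS: "s ` Q \<subseteq> carrier R" using s Q by auto
    \<comment> \<open>Roots are unique up to sign, so one chosen root for each prime generates the
      same field.\<close>
    have "square_roots Q \<subseteq> generate_field R (s ` Q)"
    proof
      fix y assume "y \<in> square_roots Q"
      then obtain p where p: "y \<in> carrier R" "p \<in> Q" "y \<otimes> y = int_emb p" unfolding square_roots_def by blast
      have sp: "s p \<in> carrier R" "s p \<otimes> s p = int_emb p" using s Q p(2) by auto
      have "(y \<ominus> s p) \<otimes> (y \<oplus> s p) = y \<otimes> y \<ominus> s p \<otimes> s p" using p(1) sp(1) by algebra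
      also have "\<dots> = \<zero>" using p(3) sp by (simp add: r_right_minus_eq)
      finally have "(y \<ominus> s p) \<otimes> (y \<oplus> s p) = \<zero>" .
      hence "y \<ominus> s p = \<zero> \<or> y \<oplus> s p = \<zero>" using p(1) sp(1) by (intro integral) auto
      hence "y = s p \<or> y = \<ominus> s p" using p(1) sp(1) by (metis minus_equality r_right_minus_eq)
      thus "y \<in> generate_field R (s ` Q)" using p(2) by (auto intro: generate_field.intros)
    qed
    hence "generate_field R (square_roots Q) \<subseteq> generate_field R (s ` Q)"
      by (intro generate_field_min_subfield1 generate_field_is_subfield sS) (auto simp: square_roots_def)
    then obtain A where A: "A \<subseteq> s ` Q" "finite A" "x \<in> generate_field R A"
      using generate_field_finitary[OF sS] x(1) by blast
    then obtain Q' where Q': "Q' \<subseteq> Q" "finite Q'" "A = s ` Q'" by (meson finite_subset_image)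
    have iq: "int_emb q \<in> prime_subfield R"
      unfolding prime_subfield_def by (rule int_emb_in_subfield[OF generate_field_is_subfield]) auto
    have iq0: "int_emb q \<noteq> \<zero>" using q int_emb_eq_0[OF char, of q] by auto
    have "\<exists>T\<subseteq>Q'. \<exists>u\<in>prime_subfield R. int_emb q = u \<otimes> u \<otimes> int_emb (\<Prod>T)"
      by (rule square_in_sqrt_extension[OF char Q'(2) _ _ A(3)[unfolded Q'(3)] iq iq0 x(2)])
         (use s Q Q'(1) in auto)
    then obtain T u where T: "T \<subseteq> Q'" "u \<in> prime_subfield R" "int_emb q = u \<otimes> u \<otimes> int_emb (\<Prod>T)" by blast
    obtain a b where ab: "int_emb b \<noteq> \<zero>" "u \<otimes> int_emb b = int_emb a"
      using prime_subfield_fraction[OF T(2)] by blast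
    have uc: "u \<in> carrier R" using T(2) generate_field_incl[of "{}"] unfolding prime_subfield_def by auto
    \<comment> \<open>Writing the rational \<open>u\<close> as \<open>a / b\<close> and clearing
      denominators turns the identity into one between integers.\<close>
    have "int_emb (q * b * b) = (u \<otimes> int_emb b) \<otimes> (u \<otimes> int_emb b) \<otimes> int_emb (\<Prod>T)"
      unfolding int_emb_mult T(3) using uc int_emb_closed[of b] int_emb_closed[of "\<Prod>T"] by (simp add: m_ac)
    also have "\<dots> = int_emb (a * a * \<Prod>T)" unfolding ab(2) int_emb_mult ..
    finally have "q * b * b = a * a * \<Prod>T" using int_emb_inj[OF char] by blast
    moreover have "b \<noteq> 0" using ab(1) by (auto simp: int_emb_01)
    moreover have "finite T" "q \<notin> T" "\<And>p. p \<in> T \<Longrightarrow> prime p" using T(1) Q' Q nq finite_subset by blast+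
    ultimately show False using prime_not_square_times_prod[OF q] by blast
  qed
qed

end

lemma (in algebraically_closed) square_root_exists:
  assumes "a \<in> carrier L" shows "\<exists>x\<in>carrier L. x \<otimes> x = a"
proof -
  let ?p = "[\<one>, \<zero>, \<ominus> a]"
  have p: "?p \<in> carrier (poly_ring L)" unfolding univ_poly_def polynomial_def using assms by auto
  hence "size (roots ?p) = 2" using roots_over_carrier[OF p] unfolding splitted_def by simp
  then obtain x where "x \<in># roots ?p" by (metis multiset_nonemptyE size_empty zero_neq_numeral)
  hence "is_root ?p x" using roots_mem_iff_is_root[OF p] by blast
  hence x: "x \<in> carrier L" "eval ?p x = \<zero>" unfolding is_root_def by auto
  have "x \<otimes> x \<oplus> \<ominus> a = \<zero>" using x assms by (simp add: numeral_2_eq_2)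
  hence "x \<otimes> x = a" using x(1) assms by (metis a_minus_def m_closed r_right_minus_eq)
  thus ?thesis using x(1) by blast
qed

lemma subfield_hom_preserves_square_root:
  assumes "field R" "subfield E R" "subfield F R"
    and h: "h \<in> ring_hom (R\<lparr>carrier := E\<rparr>) (R\<lparr>carrier := F\<rparr>)" and x: "x \<in> E" "x \<otimes>\<^bsub>R\<^esub> x = add_pow R (k::int) \<one>\<^bsub>R\<^esub>"
  shows "h x \<in> F" "h x \<otimes>\<^bsub>R\<^esub> h x = add_pow R k \<one>\<^bsub>R\<^esub>"
proof -
  interpret field R by fact
  note E' = subringE[OF subfieldE(1)[OF assms(2)]]
  note F' = subringE[OF subfieldE(1)[OF assms(3)]]
  have hc: "\<And>x. x \<in> E \<Longrightarrow> h x \<in> F" using ring_hom_memE(1)[OF h] by simp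
  have hadd: "\<And>x y. x \<in> E \<Longrightarrow> y \<in> E \<Longrightarrow> h (x \<oplus>\<^bsub>R\<^esub> y) = h x \<oplus>\<^bsub>R\<^esub> h y"
   and hmult: "\<And>x y. x \<in> E \<Longrightarrow> y \<in> E \<Longrightarrow> h (x \<otimes>\<^bsub>R\<^esub> y) = h x \<otimes>\<^bsub>R\<^esub> h y" and hone: "h \<one>\<^bsub>R\<^esub> = \<one>\<^bsub>R\<^esub>"
    using ring_hom_memE(2-4)[OF h] by simp_all
  show "h x \<in> F" by (rule hc[OF x(1)])
  have Fc: "\<And>x. x \<in> E \<Longrightarrow> h x \<in> carrier R" using hc F'(1) by blast
  have "h \<zero>\<^bsub>R\<^esub> \<oplus>\<^bsub>R\<^esub> h \<zero>\<^bsub>R\<^esub> = h \<zero>\<^bsub>R\<^esub>" using hadd[OF E'(2) E'(2)] by simp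
  hence h0: "h \<zero>\<^bsub>R\<^esub> = \<zero>\<^bsub>R\<^esub>" using Fc[OF E'(2)] by (metis add.l_cancel_one')
  have nat: "add_pow R n \<one>\<^bsub>R\<^esub> \<in> E \<and> h (add_pow R n \<one>\<^bsub>R\<^esub>) = add_pow R n \<one>\<^bsub>R\<^esub>" for n :: nat
    using E' h0 hone hadd by (induction n) auto
  have "h (add_pow R k \<one>\<^bsub>R\<^esub>) = add_pow R k \<one>\<^bsub>R\<^esub>"
  proof (cases "k \<ge> 0")
    case True thus ?thesis using nat by (simp add: add_pow_int_ge)
  next
    case False
    let ?y = "add_pow R (nat (- k)) \<one>\<^bsub>R\<^esub>"
    have yc: "?y \<in> carrier R" by simp
    have "h (\<ominus>\<^bsub>R\<^esub> ?y) \<oplus>\<^bsub>R\<^esub> ?y = \<zero>\<^bsub>R\<^esub>"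
      using hadd[of "\<ominus>\<^bsub>R\<^esub> ?y" ?y] nat[of "nat (- k)"] E'(5) h0 yc by (simp add: l_neg)
    hence "h (\<ominus>\<^bsub>R\<^esub> ?y) = \<ominus>\<^bsub>R\<^esub> ?y"
      using minus_equality[of "h (\<ominus>\<^bsub>R\<^esub> ?y)" ?y] yc Fc[of "\<ominus>\<^bsub>R\<^esub> ?y"] nat[of "nat (- k)"] E'(5) by auto
    thus ?thesis using False by (simp add: add_pow_int_lt)
  qed
  thus "h x \<otimes>\<^bsub>R\<^esub> h x = add_pow R k \<one>\<^bsub>R\<^esub>" using hmult[OF x(1) x(1)] x(2) by simp
qed

theorem sqrt_fields_iso_iff:
  assumes "algebraically_closed R" "char0 R" and Q: "\<And>q. q \<in> Q \<Longrightarrow> prime q" and Q': "\<And>q. q \<in> Q' \<Longrightarrow> prime q"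
  shows "R\<lparr>carrier := generate_field R (field.square_roots R Q)\<rparr> \<simeq> R\<lparr>carrier := generate_field R (field.square_roots R Q')\<rparr>
    \<longleftrightarrow> Q = Q'"
proof -
  interpret algebraically_closed R by fact
  have sub: "square_roots Q \<subseteq> carrier R" for Q unfolding square_roots_def by auto
  note sf = generate_field_is_subfield[OF sub]
  have roots: "\<exists>x\<in>carrier R. x \<otimes>\<^bsub>R\<^esub> x = int_emb q" for q by (rule square_root_exists) simp
  note mem = prime_square_root_mem_iff[OF assms(2) _ _ roots]
  have incl: "S1 \<subseteq> S2" if iso: "R\<lparr>carrier := generate_field R (square_roots S1)\<rparr> \<simeq> R\<lparr>carrier := generate_field R (square_roots S2)\<rparr>"
    and S1: "\<And>q. q \<in> S1 \<Longrightarrow> prime q" and S2: "\<And>q. q \<in> S2 \<Longrightarrow> prime q" for S1 S2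
  proof
    fix q assume q: "q \<in> S1"
    from iso obtain h where h: "h \<in> ring_hom (R\<lparr>carrier := generate_field R (square_roots S1)\<rparr>) (R\<lparr>carrier := generate_field R (square_roots S2)\<rparr>)"
      unfolding is_ring_iso_def ring_iso_def by blast
    obtain x where "x \<in> generate_field R (square_roots S1)" "x \<otimes>\<^bsub>R\<^esub> x = int_emb q"
      using mem[of S1 q] S1 q by blast
    from subfield_hom_preserves_square_root[OF field_axioms sf sf h this]
    show "q \<in> S2" using mem[of S2 q] S1 S2 q by blast
  qed
  show ?thesis
  proof
    assume iso: "R\<lparr>carrier := generate_field R (square_roots Q)\<rparr> \<simeq> R\<lparr>carrier := generate_field R (square_roots Q')\<rparr>"
    from incl[OF iso Q Q'] incl[OF ring_iso_sym[OF subring_is_ring[OF subfieldE(1)[OF sf]] iso] Q' Q]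
    show "Q = Q'" by blast
  next
    assume "Q = Q'"
    thus "R\<lparr>carrier := generate_field R (square_roots Q)\<rparr> \<simeq> R\<lparr>carrier := generate_field R (square_roots Q')\<rparr>"
      using ring_iso_refl by simp
  qed
qed

section \<open>Transcendence degree\<close>

context field
begin

text \<open>Relative algebraic closure, seen as the closure operator of a matroid: it is monotone,
  idempotent and satisfies exchange, and independence and bases are expressed through it
  below.\<close>

definition alg_cl :: "'a set \<Rightarrow> 'a set" where
  "alg_cl A = {x \<in> carrier R. (algebraic over generate_field R A) x}"

lemma alg_cl_carrier: "alg_cl A \<subseteq> carrier R"
  unfolding alg_cl_def by blast

lemma generate_field_subset_alg_cl: assumes "A \<subseteq> carrier R" shows "generate_field R A \<subseteq> alg_cl A"
  unfolding alg_cl_def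
  using algebraic_self[OF subfieldE(1)[OF generate_field_is_subfield[OF assms]]] generate_field_incl[OF assms] by blast

lemma subset_alg_cl: "A \<subseteq> carrier R \<Longrightarrow> A \<subseteq> alg_cl A"
  by (rule subset_trans[OF _ generate_field_subset_alg_cl]) (auto intro: generate_field.incl)

lemma subfield_alg_cl: assumes "A \<subseteq> carrier R" shows "subfield (alg_cl A) R"
  unfolding alg_cl_def by (rule subfield_of_algebraics[OF generate_field_is_subfield[OF assms]])

lemma alg_cl_mono: assumes "A \<subseteq> B" "B \<subseteq> carrier R" shows "alg_cl A \<subseteq> alg_cl B"
  unfolding alg_cl_def using algebraic_mono[OF mono_generate_field[OF assms]] by blast

text \<open>The coefficients of one annihilating polynomial generate a finite extension of
  \<open>K\<close>; adjoining \<open>x\<close> to it is again a finite step, and finiteness is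
  transitive by the tower law.\<close>

lemma algebraic_trans:
  assumes K: "subfield K R" and x: "x \<in> carrier R"
    and alg: "(algebraic over {y \<in> carrier R. (algebraic over K) y}) x"
  shows "(algebraic over K) x"
proof -
  let ?M = "{y \<in> carrier R. (algebraic over K) y}"
  have M: "subfield ?M R" by (rule subfield_of_algebraics[OF K])
  obtain p where p: "p \<in> carrier (?M[X])" "p \<noteq> []" "eval p x = \<zero>"
    by (rule algebraicE[OF subfieldE(1)[OF M] x alg])
  have pM: "set p \<subseteq> ?M" "lead_coeff p \<noteq> \<zero>" using p(1,2) unfolding univ_poly_def polynomial_def by auto
  have pc: "set p \<subseteq> carrier R" using pM(1) by blast
  have palg: "\<And>y. y \<in> set p \<Longrightarrow> (algebraic over K) y" using pM(1) by blast
  let ?N = "finite_extension K p"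
  have N: "subfield ?N R" by (rule finite_extension_is_subfield[OF K pc palg])
  have fdN: "finite_dimension K ?N" by (rule finite_extension_finite_dimension(1)[OF K pc palg])
  have "set p \<subseteq> ?N" by (rule finite_extension_mem[OF subfieldE(1)[OF K] pc])
  hence "p \<in> carrier (?N[X])" using pM(2) unfolding univ_poly_def polynomial_def by auto
  hence xN: "(algebraic over ?N) x" unfolding over_def using algebraicI p(2,3) unfolding over_def by blast
  hence "finite_dimension ?N (simple_extension ?N x)" using finite_dimension_simple_extension[OF N x] by blast
  hence "finite_dimension K (simple_extension ?N x)" using telescopic_base_dim(1)[OF K N fdN] by blast
  from finite_dimension_imp_algebraic[OF K simple_extension_is_subring[OF subfieldE(1)[OF N] x] this]
  show ?thesis using simple_extension_mem[OF subfieldE(1)[OF N] x] by blast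
qed

lemma alg_cl_idem: assumes "A \<subseteq> carrier R" shows "alg_cl (alg_cl A) = alg_cl A"
proof
  show "alg_cl A \<subseteq> alg_cl (alg_cl A)" by (rule subset_alg_cl[OF alg_cl_carrier])
  have gen: "generate_field R (alg_cl A) = alg_cl A" by (rule generate_field_subfield[OF subfield_alg_cl[OF assms]])
  show "alg_cl (alg_cl A) \<subseteq> alg_cl A"
  proof
    fix x assume "x \<in> alg_cl (alg_cl A)"
    hence x: "x \<in> carrier R" "(algebraic over alg_cl A) x" unfolding alg_cl_def[of "alg_cl A"] gen by auto
    from algebraic_trans[OF generate_field_is_subfield[OF assms] x(1) x(2)[unfolded alg_cl_def]] x(1)
    show "x \<in> alg_cl A" unfolding alg_cl_def by blast
  qed
qed

text \<open>Indexed sums replace coefficient lists because the exchange argument interchanges two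
  summations; the free bound \<open>n\<close> allows padding with zero coefficients.\<close>

lemma eval_finsum:
  assumes "set p \<subseteq> carrier R" "x \<in> carrier R" "length p \<le> n"
  shows "eval p x = (\<Oplus>i\<in>{..<n}. coeff p i \<otimes> x [^] i)"
proof -
  have "eval p x = (\<Oplus>i\<in>{..<length p}. coeff p i \<otimes> x [^] i)"
    using assms(1)
  proof (induction p)
    case (Cons a p)
    have "(\<Oplus>i\<in>{..<length (a # p)}. coeff (a # p) i \<otimes> x [^] i) =
        coeff (a # p) (length p) \<otimes> x [^] length p \<oplus> (\<Oplus>i\<in>{..<length p}. coeff (a # p) i \<otimes> x [^] i)"
      unfolding length_Cons lessThan_Suc
      by (rule finsum_insert) (use coeff_in_carrier[of p] Cons.prems assms(2) in auto)
    also have "(\<Oplus>i\<in>{..<length p}. coeff (a # p) i \<otimes> x [^] i) = (\<Oplus>i\<in>{..<length p}. coeff p i \<otimes> x [^] i)"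
      by (rule finsum_cong') (use Cons.prems assms(2) in auto)
    finally show ?case using Cons by simp
  qed simp
  also have "\<dots> = (\<Oplus>i\<in>{..<n}. coeff p i \<otimes> x [^] i)"
    by (rule add.finprod_mono_neutral_cong_left) (use assms coeff_length in auto)
  finally show ?thesis .
qed

lemma normalize_eq_Nil: "normalize p = [] \<Longrightarrow> set p \<subseteq> {\<zero>}"
  by (induction p) (auto split: if_splits)

lemma algebraic_iff_finsum:
  assumes K: "subfield K R" and x: "x \<in> carrier R"
  shows "(algebraic over K) x \<longleftrightarrow>
    (\<exists>n c. (\<forall>i. c i \<in> K) \<and> (\<exists>i<n. c i \<noteq> \<zero>) \<and> (\<Oplus>i\<in>{..<n::nat}. c i \<otimes> x [^] i) = \<zero>)"
proof
  note K' = subringE[OF subfieldE(1)[OF K]]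
  {
    assume "(algebraic over K) x"
    then obtain p where p: "p \<in> carrier (K[X])" "p \<noteq> []" "eval p x = \<zero>"
      by (rule algebraicE[OF subfieldE(1)[OF K] x])
    have pK: "set p \<subseteq> K" "lead_coeff p \<noteq> \<zero>" using p(1,2) unfolding univ_poly_def polynomial_def by auto
    have pc: "set p \<subseteq> carrier R" using pK(1) K'(1) by blast
    have "coeff p i \<in> K" for i using pK(1) K'(2) by (induction p) auto
    moreover have "coeff p (length p - 1) \<noteq> \<zero>" using lead_coeff_simp[OF p(2)] pK(2) by simp
    moreover have "(\<Oplus>i\<in>{..<length p}. coeff p i \<otimes> x [^] i) = \<zero>" using eval_finsum[OF pc x order_refl] p(3) by simp
    ultimately show "\<exists>n c. (\<forall>i. c i \<in> K) \<and> (\<exists>i<n. c i \<noteq> \<zero>) \<and> (\<Oplus>i\<in>{..<n::nat}. c i \<otimes> x [^] i) = \<zero>"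
      using p(2) by (intro exI[of _ "length p"] exI[of _ "coeff p"]) (auto intro!: exI[of _ "length p - 1"])
  next
    assume "\<exists>n c. (\<forall>i. c i \<in> K) \<and> (\<exists>i<n. c i \<noteq> \<zero>) \<and> (\<Oplus>i\<in>{..<n::nat}. c i \<otimes> x [^] i) = \<zero>"
    then obtain n i and c :: "nat \<Rightarrow> 'a" where c: "\<And>i. c i \<in> K" "i < n" "c i \<noteq> \<zero>" "(\<Oplus>i\<in>{..<n}. c i \<otimes> x [^] i) = \<zero>" by blast
    have cc: "c i \<in> carrier R" for i using c(1) K'(1) by blast
    let ?p = "map c (rev [0..<n])"
    have eval: "eval (map c (rev [0..<m])) x = (\<Oplus>i\<in>{..<m}. c i \<otimes> x [^] i)" for m
    proof (induction m)
      case (Suc m)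
      have "(\<Oplus>i\<in>{..<Suc m}. c i \<otimes> x [^] i) = c m \<otimes> x [^] m \<oplus> (\<Oplus>i\<in>{..<m}. c i \<otimes> x [^] i)"
        unfolding lessThan_Suc by (rule finsum_insert) (use cc x in auto)
      with Suc show ?case by simp
    qed simp
    have pK: "set ?p \<subseteq> K" and pc: "set ?p \<subseteq> carrier R" using c(1) cc by auto
    have "c i \<in> set ?p" using c(2) by simp
    hence "normalize ?p \<noteq> []" using normalize_eq_Nil[of ?p] c(3) by blast
    moreover have "normalize ?p \<in> carrier (K[X])" using normalize_gives_polynomial[OF pK] unfolding univ_poly_def by simp
    moreover have "eval (normalize ?p) x = \<zero>" using eval_normalize[OF pc x] eval c(4) by simp
    ultimately show "(algebraic over K) x" by (metis algebraicI)
  }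
qed

lemma finsum_lessThan_Suc:
  assumes "\<And>i. f i \<in> carrier R" shows "(\<Oplus>i\<in>{..<Suc n}. f i) = f n \<oplus> (\<Oplus>i\<in>{..<n}. f i)"
  unfolding lessThan_Suc by (rule finsum_insert) (use assms in auto)

lemma finsum_swap_lessThan:
  assumes "\<And>i j. f i j \<in> carrier R"
  shows "(\<Oplus>i\<in>{..<n::nat}. \<Oplus>j\<in>{..<m::nat}. f i j) = (\<Oplus>j\<in>{..<m}. \<Oplus>i\<in>{..<n}. f i j)"
proof (induction n)
  case 0
  show ?case by (simp add: add.finprod_one_eqI)
next
  case (Suc n)
  have "(\<Oplus>i\<in>{..<Suc n}. \<Oplus>j\<in>{..<m}. f i j) = (\<Oplus>j\<in>{..<m}. f n j) \<oplus> (\<Oplus>i\<in>{..<n}. \<Oplus>j\<in>{..<m}. f i j)"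
    by (rule finsum_lessThan_Suc) (use assms in auto)
  also have "\<dots> = (\<Oplus>j\<in>{..<m}. f n j \<oplus> (\<Oplus>i\<in>{..<n}. f i j))"
    unfolding Suc by (rule finsum_addf[symmetric]) (use assms in auto)
  also have "\<dots> = (\<Oplus>j\<in>{..<m}. \<Oplus>i\<in>{..<Suc n}. f i j)"
    by (rule finsum_cong') (use assms finsum_lessThan_Suc in auto)
  finally show ?case .
qed

text \<open>The expansion is valid for every sufficiently large length, so that several elements can
  be expanded with the same number of terms.\<close>

lemma simple_extension_finsum:
  assumes K: "subfield K R" and y: "y \<in> carrier R" and z: "z \<in> simple_extension K y"
  shows "\<exists>m e. (\<forall>j. e j \<in> K) \<and> (\<forall>M\<ge>m. z = (\<Oplus>j\<in>{..<M::nat}. e j \<otimes> y [^] j))"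
proof -
  note K' = subringE[OF subfieldE(1)[OF K]]
  from z obtain p where p: "p \<in> carrier (K[X])" "z = eval p y"
    unfolding simple_extension_as_eval_img[OF K'(1) y] by blast
  have pK: "set p \<subseteq> K" using p(1) unfolding univ_poly_def polynomial_def by auto
  have pc: "set p \<subseteq> carrier R" using pK(1) K'(1) by blast
  have "coeff p i \<in> K" for i using pK(1) K'(2) by (induction p) auto
  moreover have "z = (\<Oplus>j\<in>{..<M}. coeff p j \<otimes> y [^] j)" if "M \<ge> length p" for M
    using eval_finsum[OF pc y that] p(2) by simp
  ultimately show ?thesis by blast
qed

lemma generate_field_insert_subset_fractions:
  assumes "A \<subseteq> carrier R" "y \<in> carrier R"
  shows "generate_field R (insert y A) \<subseteq> fractions (simple_extension (generate_field R A) y)"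
proof -
  let ?F = "generate_field R A"
  have F: "subfield ?F R" by (rule generate_field_is_subfield[OF assms(1)])
  note sub = simple_extension_is_subring[OF subfieldE(1)[OF F] assms(2)]
  have "insert y A \<subseteq> simple_extension ?F y"
    using simple_extension_mem[OF subfieldE(1)[OF F] assms(2)]
      simple_extension_incl[OF subfieldE(3)[OF F] assms(2)] generate_field.incl[of _ A R] by blast
  hence "insert y A \<subseteq> fractions (simple_extension ?F y)" using subfield_fractions(2)[OF sub] by blast
  thus ?thesis using assms by (intro generate_field_min_subfield1 subfield_fractions(1)[OF sub]) auto
qed

lemma common_denominator:
  assumes D: "subring D R" and c: "\<And>i. c i \<in> fractions D"
  shows "\<exists>w\<in>D. w \<noteq> \<zero> \<and> (\<forall>i<n::nat. c i \<otimes> w \<in> D)"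
proof (induction n)
  case 0
  show ?case using subringE(3)[OF D] by (intro bexI[of _ \<one>]) auto
next
  case (Suc n)
  note D' = subringE[OF D]
  have Dc: "\<And>x. x \<in> D \<Longrightarrow> x \<in> carrier R" using D'(1) by blast
  obtain w where w: "w \<in> D" "w \<noteq> \<zero>" "\<And>i. i < n \<Longrightarrow> c i \<otimes> w \<in> D" using Suc by blast
  obtain v where v: "v \<in> D" "v \<noteq> \<zero>" "c n \<otimes> v \<in> D" using c[of n] unfolding fractions_def by auto
  have cc: "c i \<in> carrier R" for i using c[of i] unfolding fractions_def by blast
  have "c i \<otimes> (w \<otimes> v) \<in> D" if "i < Suc n" for i
  proof (cases "i = n")
    case True
    have "c n \<otimes> (w \<otimes> v) = w \<otimes> (c n \<otimes> v)" using cc Dc[OF w(1)] Dc[OF v(1)] by (simp add: m_ac)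
    with True D'(6)[OF w(1) v(3)] show ?thesis by simp
  next
    case False
    with that have "i < n" by simp
    have "c i \<otimes> (w \<otimes> v) = (c i \<otimes> w) \<otimes> v" using cc Dc[OF w(1)] Dc[OF v(1)] by (simp add: m_assoc)
    with D'(6)[OF w(3)[OF \<open>i < n\<close>] v(1)] show ?thesis by simp
  qed
  moreover have "w \<otimes> v \<noteq> \<zero>" using w v Dc integral_iff by simp
  ultimately show ?case using D'(6)[OF w(1) v(1)] by blast
qed

text \<open>After clearing denominators, an algebraic relation for \<open>x\<close> over the field
  generated by \<open>A\<close> and \<open>y\<close> becomes a polynomial relation between
  \<open>x\<close> and \<open>y\<close> over the field of \<open>A\<close>. It is then read as a
  polynomial in \<open>y\<close>; this polynomial is nontrivial, since otherwise \<open>x\<close>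
  would be algebraic over the field of \<open>A\<close>.\<close>

lemma alg_cl_exchange:
  assumes A: "A \<subseteq> carrier R" and x: "x \<in> carrier R" and y: "y \<in> carrier R"
    and xy: "x \<in> alg_cl (insert y A)" and xA: "x \<notin> alg_cl A"
  shows "y \<in> alg_cl (insert x A)"
proof -
  let ?F = "generate_field R A"
  have F: "subfield ?F R" by (rule generate_field_is_subfield[OF A])
  have Fc: "\<And>z. z \<in> ?F \<Longrightarrow> z \<in> carrier R" using subfieldE(3)[OF F] by blast
  let ?D = "simple_extension ?F y"
  have D: "subring ?D R" by (rule simple_extension_is_subring[OF subfieldE(1)[OF F] y])
  have Dc: "\<And>z. z \<in> ?D \<Longrightarrow> z \<in> carrier R" using subringE(1)[OF D] by blast
  have yA: "insert y A \<subseteq> carrier R" and xA': "insert x A \<subseteq> carrier R" using x y A by auto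
  have Fx: "subfield (generate_field R (insert x A)) R" and Fy: "subfield (generate_field R (insert y A)) R"
    by (rule generate_field_is_subfield[OF xA'], rule generate_field_is_subfield[OF yA])
  have "(algebraic over generate_field R (insert y A)) x" using xy unfolding alg_cl_def by blast
  then obtain n i0 and c :: "nat \<Rightarrow> 'a" where c: "\<And>i. c i \<in> generate_field R (insert y A)" "i0 < n" "c i0 \<noteq> \<zero>"
    "(\<Oplus>i\<in>{..<n}. c i \<otimes> x [^] i) = \<zero>"
    unfolding algebraic_iff_finsum[OF Fy x] by blast
  have cD: "c i \<in> fractions ?D" for i using c(1) generate_field_insert_subset_fractions[OF A y] by blast
  have cc: "c i \<in> carrier R" for i using cD unfolding fractions_def by blast
  have "\<exists>w\<in>?D. w \<noteq> \<zero> \<and> (\<forall>i<n. c i \<otimes> w \<in> ?D)" by (rule common_denominator[OF D cD])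
  then obtain w where w: "w \<in> ?D" "w \<noteq> \<zero>" "\<And>i. i < n \<Longrightarrow> c i \<otimes> w \<in> ?D" by blast
  have wc: "w \<in> carrier R" by (rule Dc[OF w(1)])
  have "\<forall>i. \<exists>m e. i < n \<longrightarrow> (\<forall>j. e j \<in> ?F) \<and> (\<forall>M\<ge>m. c i \<otimes> w = (\<Oplus>j\<in>{..<M::nat}. e j \<otimes> y [^] j))"
    using simple_extension_finsum[OF F y w(3)] by blast
  then obtain m e0 where me: "\<And>i j. i < n \<Longrightarrow> e0 i j \<in> ?F"
    "\<And>i M. i < n \<Longrightarrow> m i \<le> M \<Longrightarrow> c i \<otimes> w = (\<Oplus>j\<in>{..<M::nat}. e0 i j \<otimes> y [^] j)" by metis
  \<comment> \<open>Coefficients are zero outside \<open>i < n\<close>, which makes \<open>e\<close>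
    total, and the sum \<open>M\<close> of all lengths is a common bound for them.\<close>
  define e where "e i j = (if i < n then e0 i j else \<zero>)" for i j :: nat
  define M where "M = (\<Sum>i<n. m i)"
  have eF: "e i j \<in> ?F" for i j using me(1) zero_in_generate unfolding e_def by simp
  have ec: "e i j \<in> carrier R" for i j by (rule Fc[OF eF])
  have cw: "c i \<otimes> w = (\<Oplus>j\<in>{..<M}. e i j \<otimes> y [^] j)" if "i < n" for i
  proof -
    have "m i \<le> M" unfolding M_def using that by (intro member_le_sum) auto
    from me(2)[OF that this] that show ?thesis unfolding e_def by simp
  qed
  have "(\<Oplus>i\<in>{..<n}. c i \<otimes> x [^] i) \<otimes> w = (\<Oplus>i\<in>{..<n}. (c i \<otimes> x [^] i) \<otimes> w)"
    by (rule finsum_ldistr) (use cc x wc in auto)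
  also have "\<dots> = (\<Oplus>i\<in>{..<n}. \<Oplus>j\<in>{..<M}. e i j \<otimes> x [^] i \<otimes> y [^] j)"
  proof (rule finsum_cong')
    fix i assume i: "i \<in> {..<n}"
    have "c i \<otimes> x [^] i \<otimes> w = (c i \<otimes> w) \<otimes> x [^] i" using cc wc x by (simp add: m_ac)
    also have "\<dots> = (\<Oplus>j\<in>{..<M}. (e i j \<otimes> y [^] j) \<otimes> x [^] i)"
      unfolding cw[OF i[unfolded lessThan_iff]] by (rule finsum_ldistr) (use ec x y in auto)
    also have "\<dots> = (\<Oplus>j\<in>{..<M}. e i j \<otimes> x [^] i \<otimes> y [^] j)"
      by (rule finsum_cong') (use ec x y in \<open>auto simp: m_ac\<close>)
    finally show "c i \<otimes> x [^] i \<otimes> w = (\<Oplus>j\<in>{..<M}. e i j \<otimes> x [^] i \<otimes> y [^] j)" .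
  qed (use ec x y in auto)
  also have "\<dots> = (\<Oplus>j\<in>{..<M}. \<Oplus>i\<in>{..<n}. e i j \<otimes> x [^] i \<otimes> y [^] j)"
    by (rule finsum_swap_lessThan) (use ec x y in auto)
  also have "\<dots> = (\<Oplus>j\<in>{..<M}. (\<Oplus>i\<in>{..<n}. e i j \<otimes> x [^] i) \<otimes> y [^] j)"
    by (rule finsum_cong') (use ec x y in \<open>auto intro!: finsum_ldistr[symmetric]\<close>)
  finally have sum: "(\<Oplus>j\<in>{..<M}. (\<Oplus>i\<in>{..<n}. e i j \<otimes> x [^] i) \<otimes> y [^] j) = \<zero>"
    using c(4) wc by simp
  \<comment> \<open>A nonzero coefficient of the relation for \<open>x\<close> leaves a nonzero
    entry in row \<open>i0\<close>. Column \<open>j0\<close> of the coefficients is then a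
    nontrivial polynomial in \<open>x\<close> over \<open>?F\<close>, so its value is not
    zero.\<close>
  have "\<exists>j0<M. e i0 j0 \<noteq> \<zero>"
  proof (rule ccontr)
    assume "\<not> ?thesis"
    hence "(\<Oplus>j\<in>{..<M}. e i0 j \<otimes> y [^] j) = \<zero>" using y by (intro add.finprod_one_eqI) auto
    hence "c i0 \<otimes> w = \<zero>" using cw[OF c(2)] by simp
    thus False using c(3) w(2) cc wc integral_iff by simp
  qed
  then obtain j0 where j0: "j0 < M" "e i0 j0 \<noteq> \<zero>" by blast
  have d0: "(\<Oplus>i\<in>{..<n}. e i j0 \<otimes> x [^] i) \<noteq> \<zero>"
  proof
    assume "(\<Oplus>i\<in>{..<n}. e i j0 \<otimes> x [^] i) = \<zero>"
    hence "(algebraic over ?F) x" unfolding algebraic_iff_finsum[OF F x]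
      using eF j0(2) c(2) by (intro exI[of _ n] exI[of _ "\<lambda>i. e i j0"]) auto
    thus False using xA x unfolding alg_cl_def by blast
  qed
  have dF: "(\<Oplus>i\<in>{..<k}. e i j \<otimes> x [^] i) \<in> generate_field R (insert x A)" for j k
  proof (induction k)
    case 0 show ?case using zero_in_generate by simp
  next
    case (Suc k)
    note Fx' = subringE[OF subfieldE(1)[OF Fx]]
    have "e k j \<in> generate_field R (insert x A)" using eF mono_generate_field[OF _ xA', of A] by blast
    moreover have "x [^] l \<in> generate_field R (insert x A)" for l :: nat
      using Fx'(3,6) generate_field.incl[of x "insert x A" R] by (induction l) auto
    ultimately have "e k j \<otimes> x [^] k \<oplus> (\<Oplus>i\<in>{..<k}. e i j \<otimes> x [^] i) \<in> generate_field R (insert x A)"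
      using Suc Fx'(6,7) by blast
    thus ?case using finsum_lessThan_Suc[of "\<lambda>i. e i j \<otimes> x [^] i" k] ec x by simp
  qed
  have "(algebraic over generate_field R (insert x A)) y" unfolding algebraic_iff_finsum[OF Fx y]
    using dF d0 j0(1) sum by (intro exI[of _ M] exI[of _ "\<lambda>j. \<Oplus>i\<in>{..<n}. e i j \<otimes> x [^] i"]) auto
  thus ?thesis using y unfolding alg_cl_def by blast
qed

lemma alg_independent_iff:
  "alg_independent R B \<longleftrightarrow> B \<subseteq> carrier R \<and> (\<forall>b\<in>B. b \<notin> alg_cl (B - {b}))"
  unfolding alg_independent_def alg_cl_def over_def by blast

lemma transcendence_basis_iff:
  "transcendence_basis R B \<longleftrightarrow> alg_independent R B \<and> alg_cl B = carrier R"
  unfolding transcendence_basis_def alg_cl_def over_def by blast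

text \<open>Steinitz exchange. Some \<open>t\<close> in \<open>T\<close> lies outside the closure of
  \<open>I - {b}\<close>, for otherwise \<open>b\<close> would depend on the other elements of
  \<open>I\<close>. Replacing \<open>b\<close> by \<open>t\<close> keeps independence and size, and
  fewer elements remain outside \<open>T\<close>.\<close>

lemma alg_independent_card_le:
  assumes "alg_independent R I" "finite I" "finite T" "T \<subseteq> carrier R" "I \<subseteq> alg_cl T"
  shows "card I \<le> card T"
  using assms(1,2,5)
proof (induction "card (I - T)" arbitrary: I rule: less_induct)
  case less
  have Ic: "I \<subseteq> carrier R" and ind: "\<And>b. b \<in> I \<Longrightarrow> b \<notin> alg_cl (I - {b})"
    using less.prems(1) unfolding alg_independent_iff by auto
  show ?case
  proof (cases "I \<subseteq> T")
    case True thus ?thesis using card_mono[OF assms(3)] by blast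
  next
    case False
    then obtain b where b: "b \<in> I" "b \<notin> T" by blast
    have Ib: "I - {b} \<subseteq> carrier R" using Ic by blast
    have "\<not> T \<subseteq> alg_cl (I - {b})"
    proof
      assume "T \<subseteq> alg_cl (I - {b})"
      hence "alg_cl T \<subseteq> alg_cl (alg_cl (I - {b}))" by (rule alg_cl_mono[OF _ alg_cl_carrier])
      hence "alg_cl T \<subseteq> alg_cl (I - {b})" unfolding alg_cl_idem[OF Ib] .
      thus False using ind[OF b(1)] less.prems(3) b(1) by blast
    qed
    then obtain t where t: "t \<in> T" "t \<notin> alg_cl (I - {b})" by blast
    have tc: "t \<in> carrier R" using t assms(4) by blast
    have tI: "t \<notin> I - {b}" using t(2) subset_alg_cl[OF Ib] by blast
    let ?J = "insert t (I - {b})"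
    have "alg_independent R ?J"
      unfolding alg_independent_iff
    proof (intro conjI ballI)
      show "?J \<subseteq> carrier R" using tc Ib by blast
      fix c assume c: "c \<in> ?J"
      show "c \<notin> alg_cl (?J - {c})"
      proof (cases "c = t")
        case True
        have "?J - {t} = I - {b}" using tI by blast
        thus ?thesis using t(2) True by simp
      next
        case False
        hence cI: "c \<in> I - {b}" using c by blast
        have eq: "?J - {c} = insert t (I - {b} - {c})" using False by blast
        have "c \<notin> alg_cl (I - {b} - {c})" using ind[of c] cI alg_cl_mono[of "I - {b} - {c}" "I - {c}"] Ic by blast
        moreover have "insert c (I - {b} - {c}) = I - {b}" using cI by blast
        moreover have "I - {b} - {c} \<subseteq> carrier R" "c \<in> carrier R" using Ic cI by auto
        ultimately show ?thesis using alg_cl_exchange[of "I - {b} - {c}" c t] tc t(2) unfolding eq by auto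
      qed
    qed
    moreover have "finite ?J" using less.prems(2) by simp
    moreover have "?J \<subseteq> alg_cl T" using less.prems(3) t(1) subset_alg_cl[OF assms(4)] by blast
    moreover have "card (?J - T) < card (I - T)"
      by (rule psubset_card_mono) (use less.prems(2) b t(1) in auto)
    ultimately have "card ?J \<le> card T" using less.hyps by blast
    moreover have "card ?J = Suc (card (I - {b}))"
      by (rule card_insert_disjoint) (use less.prems(2) tI in auto)
    moreover have "card I = Suc (card (I - {b}))" by (rule card.remove[OF less.prems(2) b(1)])
    ultimately show ?thesis by linarith
  qed
qed

lemma alg_independent_subset: "alg_independent R B \<Longrightarrow> A \<subseteq> B \<Longrightarrow> alg_independent R A"
  unfolding alg_independent_iff
proof (intro conjI ballI)
  assume B: "B \<subseteq> carrier R \<and> (\<forall>b\<in>B. b \<notin> alg_cl (B - {b}))" "A \<subseteq> B"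
  show "A \<subseteq> carrier R" using B by blast
  fix b assume "b \<in> A"
  thus "b \<notin> alg_cl (A - {b})" using B alg_cl_mono[of "A - {b}" "B - {b}"] by blast
qed

lemma transcendence_basis_finite:
  assumes "transcendence_basis R B" "transcendence_basis R B'" "finite B"
  shows "finite B'" "card B' \<le> card B"
proof -
  have B: "B \<subseteq> carrier R" "alg_cl B = carrier R"
    using assms(1) unfolding transcendence_basis_iff alg_independent_iff by auto
  have ind: "alg_independent R B'" and B': "B' \<subseteq> carrier R"
    using assms(2) unfolding transcendence_basis_iff alg_independent_iff by auto
  have le: "card A \<le> card B" if "A \<subseteq> B'" "finite A" for A
  proof (rule alg_independent_card_le[OF alg_independent_subset[OF ind that(1)] that(2) assms(3) B(1)])
    show "A \<subseteq> alg_cl B" using that(1) B' unfolding B(2) by (rule subset_trans)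
  qed
  show "finite B'"
  proof (rule ccontr)
    assume "infinite B'"
    from infinite_arbitrarily_large[OF this, of "Suc (card B)"]
    obtain A where A: "A \<subseteq> B'" "finite A" "card A = Suc (card B)" by blast
    show False using le[OF A(1,2)] A(3) by simp
  qed
  from le[OF subset_refl this] show "card B' \<le> card B" .
qed

end

lemma infinite_nat_sets_eqpoll:
  fixes A B :: "nat set" assumes "infinite A" "infinite B" shows "A \<approx> B"
  using bij_betw_trans[OF bij_betw_inv_into[OF bij_enumerate[OF assms(1)]] bij_enumerate[OF assms(2)]]
  unfolding eqpoll_def by blast

text \<open>The exchange argument is called on for finite bases; \<open>T\<close> and
  \<open>T'\<close> are sets of naturals, so if both are infinite they are equinumerous
  anyway.\<close>

lemma trdeg_unique:
  assumes "field R" "has_trdeg R T" "has_trdeg R T'"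
  shows "(T :: nat set) \<approx> (T' :: nat set)"
proof -
  interpret field R by fact
  obtain B B' where B: "transcendence_basis R B" "B \<approx> T" and B': "transcendence_basis R B'" "B' \<approx> T'"
    using assms(2,3) unfolding has_trdeg_def by blast
  show ?thesis
  proof (cases "finite B")
    case True
    note 1 = transcendence_basis_finite[OF B(1) B'(1) True]
    note 2 = transcendence_basis_finite[OF B'(1) B(1) 1(1)]
    have "B \<approx> B'" using True 1 2 by (simp add: eqpoll_iff_card)
    thus ?thesis using B(2) B'(2) by (meson eqpoll_sym eqpoll_trans)
  next
    case False
    hence "infinite B'" using transcendence_basis_finite(1)[OF B'(1) B(1)] by blast
    with False B(2) B'(2) have "infinite T" "infinite T'" by (simp_all add: eqpoll_finite_iff)
    thus ?thesis by (rule infinite_nat_sets_eqpoll)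
  qed
qed

lemma generate_field_image_iso:
  assumes "field R" "field R'" "h \<in> ring_iso R R'" "A \<subseteq> carrier R"
  shows "h ` generate_field R A = generate_field R' (h ` A)"
proof -
  interpret R: field R by fact
  interpret R': field R' by fact
  interpret h: ring_hom_ring R R' h
    by (rule ring_hom_ringI2[OF R.ring_axioms R'.ring_axioms]) (use assms(3) in \<open>auto simp: ring_iso_def\<close>)
  have hA: "h ` A \<subseteq> carrier R'" using assms(4) by auto
  have one: "\<one>\<^bsub>R'\<^esub> \<noteq> \<zero>\<^bsub>R'\<^esub>" by simp
  have sub: "subfield (h ` generate_field R A) R'"
    by (rule h.img_is_subfield(2)[OF R.generate_field_is_subfield[OF assms(4)] one])
  show ?thesis
  proof
    show "generate_field R' (h ` A) \<subseteq> h ` generate_field R A"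
      by (rule R'.generate_field_min_subfield1[OF hA sub]) (auto intro: generate_field.incl)
    let ?E = "{x \<in> carrier R. h x \<in> generate_field R' (h ` A)}"
    have h0: "h x = \<zero>\<^bsub>R'\<^esub> \<Longrightarrow> x = \<zero>\<^bsub>R\<^esub>" if "x \<in> carrier R" for x
      using that assms(3) h.hom_zero R.zero_closed unfolding ring_iso_def bij_betw_def inj_on_def
      by (metis (mono_tags, lifting) mem_Collect_eq)
    have "subfield ?E R"
    proof (rule R.subfieldI'[OF R.subringI])
      fix x assume x: "x \<in> ?E - {\<zero>\<^bsub>R\<^esub>}"
      hence xU: "x \<in> Units R" using R.field_Units by blast
      have "h (x \<otimes>\<^bsub>R\<^esub> inv\<^bsub>R\<^esub> x) = h x \<otimes>\<^bsub>R'\<^esub> h (inv\<^bsub>R\<^esub> x)" by (rule h.hom_mult) (use xU in auto)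
      hence "h x \<otimes>\<^bsub>R'\<^esub> h (inv\<^bsub>R\<^esub> x) = \<one>\<^bsub>R'\<^esub>" unfolding R.Units_r_inv[OF xU] by simp
      hence "h (inv\<^bsub>R\<^esub> x) = inv\<^bsub>R'\<^esub> (h x)" using R'.comm_inv_char[of "h x" "h (inv\<^bsub>R\<^esub> x)"] x xU by simp
      thus "inv\<^bsub>R\<^esub> x \<in> ?E" using x xU h0 by (auto intro: generate_field.m_inv)
    qed (auto intro: generate_field.intros)
    hence "generate_field R A \<subseteq> ?E"
      by (rule R.generate_field_min_subfield1[OF assms(4)]) (use assms(4) in \<open>auto intro: generate_field.incl\<close>)
    thus "h ` generate_field R A \<subseteq> generate_field R' (h ` A)" by blast
  qed
qed

lemma alg_cl_image_iso:
  assumes "field R" "field R'" "h \<in> ring_iso R R'" "A \<subseteq> carrier R" "x \<in> field.alg_cl R A"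
  shows "h x \<in> field.alg_cl R' (h ` A)"
proof -
  interpret R: field R by fact
  interpret R': field R' by fact
  have h: "h \<in> ring_hom R R'" using assms(3) by (simp add: ring_iso_def)
  have x: "x \<in> carrier R" "(R.algebraic over (generate_field R A)) x" using assms(5) unfolding R.alg_cl_def by auto
  from algebraic_hom[OF h assms(1,2) R.generate_field_is_subfield[OF assms(4)] x]
  show ?thesis unfolding R'.alg_cl_def generate_field_image_iso[OF assms(1-4)]
    using ring_hom_memE(1)[OF h x(1)] by blast
qed

lemma has_trdeg_iso:
  assumes "field R" "field R'" "R \<simeq> R'" "has_trdeg R T" shows "has_trdeg R' T"
proof -
  interpret R: field R by fact
  interpret R': field R' by fact
  obtain h where h: "h \<in> ring_iso R R'" using assms(3) unfolding is_ring_iso_def by blast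
  have bij: "bij_betw h (carrier R) (carrier R')" using h by (simp add: ring_iso_def)
  let ?g = "inv_into (carrier R) h"
  have g: "?g \<in> ring_iso R' R" by (rule ring_iso_set_sym[OF R.ring_axioms h])
  have gh: "?g (h x) = x" if "x \<in> carrier R" for x using bij that by (simp add: bij_betw_def)
  have hg: "h (?g y) = y" if "y \<in> carrier R'" for y using bij that by (auto simp: bij_betw_def f_inv_into_f)
  obtain B where B: "transcendence_basis R B" "B \<approx> T" using assms(4) unfolding has_trdeg_def by blast
  have Bc: "B \<subseteq> carrier R" and ind: "\<And>b. b \<in> B \<Longrightarrow> b \<notin> R.alg_cl (B - {b})" and cl: "R.alg_cl B = carrier R"
    using B(1) unfolding R.transcendence_basis_iff R.alg_independent_iff by auto
  have inj: "inj_on h B" using bij Bc by (auto simp: bij_betw_def intro: inj_on_subset)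
  have hB: "h ` B \<subseteq> carrier R'" using bij Bc by (auto simp: bij_betw_def)
  have gimg: "?g ` (h ` A) = A" if "A \<subseteq> carrier R" for A
    unfolding image_image using gh that by (auto simp: subset_iff image_iff)
  have "transcendence_basis R' (h ` B)"
    unfolding R'.transcendence_basis_iff R'.alg_independent_iff
  proof (intro conjI ballI notI)
    show "h ` B \<subseteq> carrier R'" by (rule hB)
    fix c assume c: "c \<in> h ` B" "c \<in> R'.alg_cl (h ` B - {c})"
    then obtain b where b: "b \<in> B" "c = h b" by blast
    have eq: "h ` B - {c} = h ` (B - {b})" using inj b by (auto simp: inj_on_def)
    have Bb: "B - {b} \<subseteq> carrier R" using Bc by blast
    have "?g c \<in> R.alg_cl (?g ` (h ` (B - {b})))"
      by (rule alg_cl_image_iso[OF assms(2,1) g _ c(2)[unfolded eq]]) (use hB in blast)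
    thus False using ind[OF b(1)] gh b Bc unfolding gimg[OF Bb] by auto
  next
    show "R'.alg_cl (h ` B) = carrier R'"
    proof (intro equalityI subsetI)
      fix y assume y: "y \<in> carrier R'"
      have "?g y \<in> R.alg_cl B" unfolding cl using y bij by (auto simp: bij_betw_def inv_into_into)
      from alg_cl_image_iso[OF assms(1,2) h Bc this] show "y \<in> R'.alg_cl (h ` B)" using hg[OF y] by simp
    qed (use R'.alg_cl_carrier in blast)
  qed
  moreover have "h ` B \<approx> T" using B(2) inj by (meson eqpoll_trans inj_on_image_eqpoll_self)
  ultimately show ?thesis unfolding has_trdeg_def by blast
qed

section \<open>Isomorphism of algebraically closed fields\<close>

text \<open>An isomorphism between subfields of \<open>R\<close> and \<open>R'\<close>, represented by its graph: a subring of the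
  product ring all of whose nonzero elements are units.\<close>
definition corr :: "('a, 'c) ring_scheme \<Rightarrow> ('b, 'd) ring_scheme \<Rightarrow> ('a \<times> 'b) set \<Rightarrow> bool" where
  "corr R R' G \<longleftrightarrow> G \<subseteq> carrier R \<times> carrier R' \<and> (\<one>\<^bsub>R\<^esub>, \<one>\<^bsub>R'\<^esub>) \<in> G \<and>
     (\<forall>x y x' y'. (x, y) \<in> G \<longrightarrow> (x', y') \<in> G \<longrightarrow> (x \<oplus>\<^bsub>R\<^esub> x', y \<oplus>\<^bsub>R'\<^esub> y') \<in> G) \<and>
     (\<forall>x y x' y'. (x, y) \<in> G \<longrightarrow> (x', y') \<in> G \<longrightarrow> (x \<otimes>\<^bsub>R\<^esub> x', y \<otimes>\<^bsub>R'\<^esub> y') \<in> G) \<and>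
     (\<forall>x y. (x, y) \<in> G \<longrightarrow> (\<ominus>\<^bsub>R\<^esub> x, \<ominus>\<^bsub>R'\<^esub> y) \<in> G) \<and>
     (\<forall>x y. (x, y) \<in> G \<longrightarrow> (x = \<zero>\<^bsub>R\<^esub> \<longleftrightarrow> y = \<zero>\<^bsub>R'\<^esub>)) \<and>
     (\<forall>x y. (x, y) \<in> G \<longrightarrow> x \<noteq> \<zero>\<^bsub>R\<^esub> \<longrightarrow> (inv\<^bsub>R\<^esub> x, inv\<^bsub>R'\<^esub> y) \<in> G)"

lemma corrD:
  assumes "corr R R' G"
  shows "(x, y) \<in> G \<Longrightarrow> x \<in> carrier R" "(x, y) \<in> G \<Longrightarrow> y \<in> carrier R'" "(\<one>\<^bsub>R\<^esub>, \<one>\<^bsub>R'\<^esub>) \<in> G"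
    "(x, y) \<in> G \<Longrightarrow> (x', y') \<in> G \<Longrightarrow> (x \<oplus>\<^bsub>R\<^esub> x', y \<oplus>\<^bsub>R'\<^esub> y') \<in> G"
    "(x, y) \<in> G \<Longrightarrow> (x', y') \<in> G \<Longrightarrow> (x \<otimes>\<^bsub>R\<^esub> x', y \<otimes>\<^bsub>R'\<^esub> y') \<in> G"
    "(x, y) \<in> G \<Longrightarrow> (\<ominus>\<^bsub>R\<^esub> x, \<ominus>\<^bsub>R'\<^esub> y) \<in> G"
    "(x, y) \<in> G \<Longrightarrow> x = \<zero>\<^bsub>R\<^esub> \<longleftrightarrow> y = \<zero>\<^bsub>R'\<^esub>"
    "(x, y) \<in> G \<Longrightarrow> x \<noteq> \<zero>\<^bsub>R\<^esub> \<Longrightarrow> (inv\<^bsub>R\<^esub> x, inv\<^bsub>R'\<^esub> y) \<in> G"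
  using assms unfolding corr_def by simp_all auto

lemma corr_converse: assumes "corr R R' G" shows "corr R' R (G\<inverse>)"
  unfolding corr_def converse_iff
proof (intro conjI allI impI)
  show "G\<inverse> \<subseteq> carrier R' \<times> carrier R" using corrD(1,2)[OF assms] by auto
  show "(\<one>\<^bsub>R\<^esub>, \<one>\<^bsub>R'\<^esub>) \<in> G" by (rule corrD(3)[OF assms])
next
  fix x y x' y' assume *: "(y, x) \<in> G" "(y', x') \<in> G"
  show "(y \<oplus>\<^bsub>R\<^esub> y', x \<oplus>\<^bsub>R'\<^esub> x') \<in> G" by (rule corrD(4)[OF assms *])
  show "(y \<otimes>\<^bsub>R\<^esub> y', x \<otimes>\<^bsub>R'\<^esub> x') \<in> G" by (rule corrD(5)[OF assms *])
next
  fix x y assume *: "(y, x) \<in> G"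
  show "(\<ominus>\<^bsub>R\<^esub> y, \<ominus>\<^bsub>R'\<^esub> x) \<in> G" by (rule corrD(6)[OF assms *])
  show iff: "x = \<zero>\<^bsub>R'\<^esub> \<longleftrightarrow> y = \<zero>\<^bsub>R\<^esub>" using corrD(7)[OF assms *] by (rule sym)
  assume "x \<noteq> \<zero>\<^bsub>R'\<^esub>"
  thus "(inv\<^bsub>R\<^esub> y, inv\<^bsub>R'\<^esub> x) \<in> G" using iff by (intro corrD(8)[OF assms *]) simp
qed

text \<open>The subring of the product generated by \<open>G\<close> and the new pair: values of the
  same polynomial at \<open>a\<close> and at \<open>a'\<close>, computed in parallel by Horner's
  rule, with coefficients matched by \<open>G\<close>.\<close>

inductive_set horner for R :: "('a, 'c) ring_scheme" and R' :: "('b, 'd) ring_scheme" and G :: "('a \<times> 'b) set" and a a' where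
  zero: "(\<zero>\<^bsub>R\<^esub>, \<zero>\<^bsub>R'\<^esub>) \<in> horner R R' G a a'"
| step: "(u, v) \<in> horner R R' G a a' \<Longrightarrow> (c, d) \<in> G \<Longrightarrow> (u \<otimes>\<^bsub>R\<^esub> a \<oplus>\<^bsub>R\<^esub> c, v \<otimes>\<^bsub>R'\<^esub> a' \<oplus>\<^bsub>R'\<^esub> d) \<in> horner R R' G a a'"

definition horner_quotients where
  "horner_quotients R R' G a a' = {(u \<otimes>\<^bsub>R\<^esub> inv\<^bsub>R\<^esub> w, v \<otimes>\<^bsub>R'\<^esub> inv\<^bsub>R'\<^esub> z) | u v w z.
     (u, v) \<in> horner R R' G a a' \<and> (w, z) \<in> horner R R' G a a' \<and> w \<noteq> \<zero>\<^bsub>R\<^esub>}"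

lemma horner_converse: "(u, v) \<in> horner R R' G a a' \<Longrightarrow> (v, u) \<in> horner R' R (G\<inverse>) a' a"
proof (induction rule: horner.induct)
  case zero show ?case by (rule horner.zero)
next
  case (step u v c d) thus ?case by (intro horner.step) auto
qed

context field
begin

lemma inv_mult_units:
  assumes "w \<in> Units R" "w' \<in> Units R" shows "inv (w \<otimes> w') = inv w' \<otimes> inv w"
proof (rule comm_inv_char)
  have c: "w \<in> carrier R" "w' \<in> carrier R" "inv w \<in> carrier R" "inv w' \<in> carrier R" using assms by auto
  have "(w \<otimes> w') \<otimes> (inv w' \<otimes> inv w) = (w \<otimes> inv w) \<otimes> (w' \<otimes> inv w')" using c by algebra
  thus "(w \<otimes> w') \<otimes> (inv w' \<otimes> inv w) = \<one>" using assms by simp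
qed (use assms in auto)

lemma frac_add:
  assumes "u \<in> carrier R" "w \<in> carrier R" "u' \<in> carrier R" "w' \<in> carrier R" "w \<noteq> \<zero>" "w' \<noteq> \<zero>"
  shows "u \<otimes> inv w \<oplus> u' \<otimes> inv w' = (u \<otimes> w' \<oplus> u' \<otimes> w) \<otimes> inv (w \<otimes> w')"
proof -
  have U: "w \<in> Units R" "w' \<in> Units R" using assms field_Units by auto
  have i: "inv w \<in> carrier R" "inv w' \<in> carrier R" using U by auto
  have "(u \<otimes> w' \<oplus> u' \<otimes> w) \<otimes> (inv w' \<otimes> inv w) = u \<otimes> inv w \<otimes> (w' \<otimes> inv w') \<oplus> u' \<otimes> inv w' \<otimes> (w \<otimes> inv w)"
    using assms(1-4) i by algebra
  thus ?thesis using U assms(1-4) i by (simp add: inv_mult_units Units_r_inv)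
qed

lemma frac_mult:
  assumes "u \<in> carrier R" "w \<in> carrier R" "u' \<in> carrier R" "w' \<in> carrier R" "w \<noteq> \<zero>" "w' \<noteq> \<zero>"
  shows "(u \<otimes> inv w) \<otimes> (u' \<otimes> inv w') = (u \<otimes> u') \<otimes> inv (w \<otimes> w')"
proof -
  have U: "w \<in> Units R" "w' \<in> Units R" using assms field_Units by auto
  have i: "inv w \<in> carrier R" "inv w' \<in> carrier R" using U by auto
  show ?thesis unfolding inv_mult_units[OF U] using assms(1-4) i by algebra
qed

lemma frac_inv:
  assumes "u \<in> carrier R" "w \<in> carrier R" "u \<noteq> \<zero>" "w \<noteq> \<zero>"
  shows "inv (u \<otimes> inv w) = w \<otimes> inv u"
proof -
  have U: "u \<in> Units R" "w \<in> Units R" using assms field_Units by auto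
  have i: "inv u \<in> carrier R" "inv w \<in> carrier R" using U by auto
  have "(u \<otimes> inv w) \<otimes> (w \<otimes> inv u) = (u \<otimes> inv u) \<otimes> (w \<otimes> inv w)" using assms(1,2) i by algebra
  also have "\<dots> = \<one>" using U by simp
  finally show ?thesis using assms(1,2) i by (intro comm_inv_char) auto
qed

lemma frac_eq_zero:
  assumes "u \<in> carrier R" "w \<in> carrier R" "w \<noteq> \<zero>" shows "u \<otimes> inv w = \<zero> \<longleftrightarrow> u = \<zero>"
proof -
  have U: "w \<in> Units R" using assms field_Units by auto
  have "inv w \<noteq> \<zero>" using U by (metis Units_r_inv Units_closed r_null one_not_zero)
  thus ?thesis using integral_iff[of u "inv w"] assms(1) U by simp
qed

lemma eval_minus_smult:
  assumes "length xs = length ys" "set xs \<subseteq> carrier R" "set ys \<subseteq> carrier R" "l \<in> carrier R" "a \<in> carrier R"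
  shows "eval (map2 (\<lambda>x y. x \<ominus> l \<otimes> y) xs ys) a = eval xs a \<ominus> l \<otimes> eval ys a"
  using assms(1-3)
proof (induction xs ys rule: list_induct2)
  case Nil show ?case using assms(4) by (simp add: a_minus_def)
next
  case (Cons x xs y ys)
  have c: "x \<in> carrier R" "y \<in> carrier R" "eval xs a \<in> carrier R" "eval ys a \<in> carrier R" "a [^] length ys \<in> carrier R"
    using Cons assms(5) eval_in_carrier by auto
  have "(x \<ominus> l \<otimes> y) \<otimes> p \<oplus> (e \<ominus> l \<otimes> f) = (x \<otimes> p \<oplus> e) \<ominus> l \<otimes> (y \<otimes> p \<oplus> f)"
    if "p \<in> carrier R" "e \<in> carrier R" "f \<in> carrier R" for p e f
    using that c(1,2) assms(4) by algebra
  from this[OF c(5) c(3) c(4)] show ?case using Cons by simp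
qed

text \<open>One Horner step modulo a monic relation.\<close>
lemma eval_reduce:
  assumes "length ms = Suc (length qs)" "set ms \<subseteq> carrier R" "set qs \<subseteq> carrier R" "l \<in> carrier R" "c \<in> carrier R" "a \<in> carrier R"
    and rel: "a [^] length ms \<oplus> eval ms a = \<zero>"
  shows "eval (l # qs) a \<otimes> a \<oplus> c = eval (map2 (\<lambda>x y. x \<ominus> l \<otimes> y) (qs @ [c]) ms) a"
proof -
  have e: "eval (qs @ [c]) a \<in> carrier R" "eval ms a \<in> carrier R" "a [^] length ms \<in> carrier R"
    using assms by (auto intro!: eval_in_carrier)
  have "eval (l # qs) a \<otimes> a \<oplus> c = eval ((l # qs) @ [c]) a"
    using assms by (intro eval_append_aux[symmetric]) auto
  also have "\<dots> = l \<otimes> a [^] length ms \<oplus> eval (qs @ [c]) a" using assms(1) by simp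
  also have "a [^] length ms = \<ominus> eval ms a" using rel e by (metis minus_equality)
  also have "l \<otimes> (\<ominus> eval ms a) \<oplus> eval (qs @ [c]) a = eval (qs @ [c]) a \<ominus> l \<otimes> eval ms a"
    using e(1,2) assms(4) by (simp add: r_minus a_minus_def a_comm)
  also have "\<dots> = eval (map2 (\<lambda>x y. x \<ominus> l \<otimes> y) (qs @ [c]) ms) a"
    using assms by (intro eval_minus_smult[symmetric]) auto
  finally show ?thesis .
qed

lemma eval_zeros: "set p \<subseteq> {\<zero>} \<Longrightarrow> x \<in> carrier R \<Longrightarrow> eval p x = \<zero>"
  by (induction p) auto

lemma algebraically_closed_root:
  assumes "algebraically_closed R" "set p \<subseteq> carrier R" "p \<noteq> []"
  shows "\<exists>x\<in>carrier R. eval (\<one> # p) x = \<zero>"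
proof -
  interpret C: algebraically_closed R by fact
  have p: "\<one> # p \<in> carrier (poly_ring R)" using assms(2) unfolding univ_poly_def polynomial_def by auto
  hence "size (roots (\<one> # p)) = length p" using C.roots_over_carrier[OF p] unfolding splitted_def by simp
  then obtain x where "x \<in># roots (\<one> # p)" using assms(3) by (metis length_0_conv multiset_nonemptyE size_empty)
  hence "is_root (\<one> # p) x" using roots_mem_iff_is_root[OF p] by blast
  thus ?thesis unfolding is_root_def by blast
qed

end

text \<open>The two fields are treated alike: the backward half of an argument is its forward half
  for the swapped pair and the converse correspondence.\<close>

locale field_pair = R: field R + R': field R' for R :: "('a, 'c) ring_scheme" and R' :: "('b, 'd) ring_scheme"
begin

lemma field_pair_swap: "field_pair R' R"
  by unfold_locales

lemma corr_zero: assumes "corr R R' G" shows "(\<zero>\<^bsub>R\<^esub>, \<zero>\<^bsub>R'\<^esub>) \<in> G"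
proof -
  have "(\<one>\<^bsub>R\<^esub> \<oplus>\<^bsub>R\<^esub> \<ominus>\<^bsub>R\<^esub> \<one>\<^bsub>R\<^esub>, \<one>\<^bsub>R'\<^esub> \<oplus>\<^bsub>R'\<^esub> \<ominus>\<^bsub>R'\<^esub> \<one>\<^bsub>R'\<^esub>) \<in> G"
    by (intro corrD[OF assms])
  thus ?thesis by (simp add: R.r_neg R'.r_neg)
qed

lemma corr_subfield: assumes G: "corr R R' G" shows "subfield (fst ` G) R"
proof (rule R.subfieldI'[OF R.subringI])
  show "fst ` G \<subseteq> carrier R" using corrD(1)[OF G] by auto
  show "\<one>\<^bsub>R\<^esub> \<in> fst ` G" using corrD(3)[OF G] by force
  show "\<ominus>\<^bsub>R\<^esub> x \<in> fst ` G" if "x \<in> fst ` G" for x using that corrD(6)[OF G] by force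
  show "x \<oplus>\<^bsub>R\<^esub> y \<in> fst ` G" if "x \<in> fst ` G" "y \<in> fst ` G" for x y using that corrD(4)[OF G] by force
  show "x \<otimes>\<^bsub>R\<^esub> y \<in> fst ` G" if "x \<in> fst ` G" "y \<in> fst ` G" for x y using that corrD(5)[OF G] by force
  show "inv\<^bsub>R\<^esub> x \<in> fst ` G" if "x \<in> fst ` G - {\<zero>\<^bsub>R\<^esub>}" for x using that corrD(8)[OF G] by force
qed

context
  fixes G a a'
  assumes G: "corr R R' G" and a: "a \<in> carrier R" and a': "a' \<in> carrier R'"
begin

abbreviation "H \<equiv> horner R R' G a a'"

lemma horner_carrier: "(u, v) \<in> H \<Longrightarrow> u \<in> carrier R \<and> v \<in> carrier R'"
  by (induction rule: horner.induct) (use a a' corrD(1,2)[OF G] in auto)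

lemma horner_base: assumes "(c, d) \<in> G" shows "(c, d) \<in> H"
  using horner.step[OF horner.zero assms, where R=R and R'=R' and a=a and a'=a'] a a' corrD(1,2)[OF G assms] by simp

lemma horner_add: "(u, v) \<in> H \<Longrightarrow> (u', v') \<in> H \<Longrightarrow> (u \<oplus>\<^bsub>R\<^esub> u', v \<oplus>\<^bsub>R'\<^esub> v') \<in> H"
proof (induction arbitrary: u' v' rule: horner.induct)
  case zero thus ?case using horner_carrier[OF zero] by simp
next
  case (step u v c d)
  note uv = horner_carrier[OF step.hyps(1)] corrD(1,2)[OF G step.hyps(2)]
  from step.prems show ?case
  proof (cases rule: horner.cases)
    case zero thus ?thesis using horner.step[OF step.hyps] uv a a' by simp
  next
    case s: (step u0 v0 c0 d0)
    note uv0 = horner_carrier[OF s(3)] corrD(1,2)[OF G s(4)]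
    have "((u \<oplus>\<^bsub>R\<^esub> u0) \<otimes>\<^bsub>R\<^esub> a \<oplus>\<^bsub>R\<^esub> (c \<oplus>\<^bsub>R\<^esub> c0), (v \<oplus>\<^bsub>R'\<^esub> v0) \<otimes>\<^bsub>R'\<^esub> a' \<oplus>\<^bsub>R'\<^esub> (d \<oplus>\<^bsub>R'\<^esub> d0)) \<in> H"
      by (rule horner.step[OF step.IH[OF s(3)] corrD(4)[OF G step.hyps(2) s(4)]])
    thus ?thesis unfolding s(1,2) using uv uv0 a a' by (simp add: R.l_distr R'.l_distr R.a_ac R'.a_ac)
  qed
qed

lemma horner_smult: "(u, v) \<in> H \<Longrightarrow> (c, d) \<in> G \<Longrightarrow> (c \<otimes>\<^bsub>R\<^esub> u, d \<otimes>\<^bsub>R'\<^esub> v) \<in> H"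
proof (induction rule: horner.induct)
  case zero thus ?case using horner.zero corrD(1,2)[OF G zero] by simp
next
  case (step u v c0 d0)
  note uv = horner_carrier[OF step.hyps(1)] corrD(1,2)[OF G step.hyps(2)] corrD(1,2)[OF G step.prems]
  have "((c \<otimes>\<^bsub>R\<^esub> u) \<otimes>\<^bsub>R\<^esub> a \<oplus>\<^bsub>R\<^esub> c \<otimes>\<^bsub>R\<^esub> c0, (d \<otimes>\<^bsub>R'\<^esub> v) \<otimes>\<^bsub>R'\<^esub> a' \<oplus>\<^bsub>R'\<^esub> d \<otimes>\<^bsub>R'\<^esub> d0) \<in> H"
    by (rule horner.step[OF step.IH[OF step.prems] corrD(5)[OF G step.prems step.hyps(2)]])
  thus ?case using uv a a' by (simp add: R.r_distr R'.r_distr R.m_assoc R'.m_assoc)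
qed

lemma horner_mult: "(u, v) \<in> H \<Longrightarrow> (u', v') \<in> H \<Longrightarrow> (u \<otimes>\<^bsub>R\<^esub> u', v \<otimes>\<^bsub>R'\<^esub> v') \<in> H"
proof (induction rule: horner.induct)
  case zero thus ?case using horner.zero horner_carrier[OF zero] by simp
next
  case (step u v c d)
  note uv = horner_carrier[OF step.hyps(1)] corrD(1,2)[OF G step.hyps(2)] horner_carrier[OF step.prems]
  have "((u \<otimes>\<^bsub>R\<^esub> u') \<otimes>\<^bsub>R\<^esub> a \<oplus>\<^bsub>R\<^esub> \<zero>\<^bsub>R\<^esub>, (v \<otimes>\<^bsub>R'\<^esub> v') \<otimes>\<^bsub>R'\<^esub> a' \<oplus>\<^bsub>R'\<^esub> \<zero>\<^bsub>R'\<^esub>) \<in> H"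
    by (rule horner.step[OF step.IH[OF step.prems] corr_zero[OF G]])
  from horner_add[OF this horner_smult[OF step.prems step.hyps(2)]]
  show ?case using uv a a' by (simp add: R.l_distr R'.l_distr R.r_distr R'.r_distr R.m_ac R'.m_ac)
qed

lemma horner_a_inv: assumes "(u, v) \<in> H" shows "(\<ominus>\<^bsub>R\<^esub> u, \<ominus>\<^bsub>R'\<^esub> v) \<in> H"
proof -
  have "(\<ominus>\<^bsub>R\<^esub> \<one>\<^bsub>R\<^esub>, \<ominus>\<^bsub>R'\<^esub> \<one>\<^bsub>R'\<^esub>) \<in> G" by (intro corrD(6)[OF G] corrD(3)[OF G])
  from horner_smult[OF assms this] show ?thesis using horner_carrier[OF assms] by (simp add: R.l_minus R'.l_minus)
qed

lemma horner_one: "(\<one>\<^bsub>R\<^esub>, \<one>\<^bsub>R'\<^esub>) \<in> H"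
  by (rule horner_base[OF corrD(3)[OF G]])

lemma horner_gen: "(a, a') \<in> H"
  using horner.step[OF horner_one corr_zero[OF G]] a a' by simp

lemma horner_simple_extension:
  assumes "u \<in> ring.simple_extension R (fst ` G) a" shows "\<exists>v. (u, v) \<in> H"
  using assms
proof (induction rule: R.simple_extension.induct)
  case zero show ?case by (rule exI, rule horner.zero)
next
  case (lin k1 k2)
  then obtain v d where "(k1, v) \<in> H" "(k2, d) \<in> G" by force
  from horner.step[OF this] show ?case by blast
qed

lemma simple_extension_horner: "(u, v) \<in> H \<Longrightarrow> u \<in> ring.simple_extension R (fst ` G) a"
proof (induction rule: horner.induct)
  case (step u v c d)
  from R.simple_extension.lin[OF step.IH, of c] step.hyps(2) show ?case by force
qed simp

lemma horner_eval:
  "(u, v) \<in> H \<Longrightarrow> \<exists>ps. set ps \<subseteq> G \<and> u = ring.eval R (map fst ps) a \<and> v = ring.eval R' (map snd ps) a'"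
proof (induction rule: horner.induct)
  case zero show ?case by (intro exI[of _ "[]"]) simp
next
  case (step u v c d)
  then obtain ps where ps: "set ps \<subseteq> G" "u = R.eval (map fst ps) a" "v = R'.eval (map snd ps) a'" by blast
  have "set (map fst ps) \<subseteq> carrier R" "set (map snd ps) \<subseteq> carrier R'" using ps(1) corrD(1,2)[OF G] by auto
  hence "R.eval (map fst (ps @ [(c, d)])) a = u \<otimes>\<^bsub>R\<^esub> a \<oplus>\<^bsub>R\<^esub> c"
    "R'.eval (map snd (ps @ [(c, d)])) a' = v \<otimes>\<^bsub>R'\<^esub> a' \<oplus>\<^bsub>R'\<^esub> d"
    using R.eval_append_aux[of "map fst ps" c a] R'.eval_append_aux[of "map snd ps" d a'] a a'
      corrD(1,2)[OF G step.hyps(2)] ps by simp_all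
  thus ?case using ps(1) step.hyps(2) by (intro exI[of _ "ps @ [(c, d)]"]) simp
qed

lemma eval_snd_zero:
  assumes "set ps \<subseteq> G" "R.normalize (map fst ps) = []" shows "R'.eval (map snd ps) a' = \<zero>\<^bsub>R'\<^esub>"
proof (rule R'.eval_zeros[OF _ a'])
  have "set (map fst ps) \<subseteq> {\<zero>\<^bsub>R\<^esub>}" by (rule R.normalize_eq_Nil[OF assms(2)])
  thus "set (map snd ps) \<subseteq> {\<zero>\<^bsub>R'\<^esub>}" using assms(1) corrD(7)[OF G] by fastforce
qed

text \<open>A polynomial vanishing at a transcendental element has only zero coefficients, and
  \<open>G\<close> matches zero with zero, so the other polynomial is zero too.\<close>

lemma horner_transcendental:
  assumes "(ring.transcendental R over fst ` G) a" "(u, v) \<in> H" "u = \<zero>\<^bsub>R\<^esub>" shows "v = \<zero>\<^bsub>R'\<^esub>"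
proof -
  obtain ps where ps: "set ps \<subseteq> G" "u = R.eval (map fst ps) a" "v = R'.eval (map snd ps) a'"
    using horner_eval[OF assms(2)] by blast
  have K: "set (map fst ps) \<subseteq> fst ` G" and c: "set (map fst ps) \<subseteq> carrier R" using ps(1) corrD(1)[OF G] by auto
  have "R.normalize (map fst ps) \<in> carrier ((fst ` G)[X]\<^bsub>R\<^esub>)"
    using R.normalize_gives_polynomial[OF K] unfolding univ_poly_def by simp
  moreover have "R.eval (R.normalize (map fst ps)) a = \<zero>\<^bsub>R\<^esub>"
    using R.eval_normalize[OF c a] ps(2) assms(3) by simp
  ultimately have "R.normalize (map fst ps) = []" by (rule R.eval_transcendental[OF assms(1)])
  from eval_snd_zero[OF ps(1) this] show ?thesis using ps(3) by simp
qed

text \<open>Adjoining a pair comes down to one condition: a polynomial vanishes at \<open>a\<close>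
  exactly when its counterpart vanishes at \<open>a'\<close>. Quotients then carry the
  correspondence to the generated fields.\<close>

lemma corr_horner_quotients:
  assumes Z': "\<And>u v. (u, v) \<in> H \<Longrightarrow> u = \<zero>\<^bsub>R\<^esub> \<longleftrightarrow> v = \<zero>\<^bsub>R'\<^esub>"
  defines "Q \<equiv> horner_quotients R R' G a a'"
  shows "corr R R' Q" "G \<subseteq> Q" "(a, a') \<in> Q"
proof -
  have QI: "(u \<otimes>\<^bsub>R\<^esub> inv\<^bsub>R\<^esub> w, v \<otimes>\<^bsub>R'\<^esub> inv\<^bsub>R'\<^esub> z) \<in> Q" if "(u, v) \<in> H" "(w, z) \<in> H" "w \<noteq> \<zero>\<^bsub>R\<^esub>" for u v w z
    unfolding Q_def horner_quotients_def using that by blast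
  have base: "(u, v) \<in> Q" if "(u, v) \<in> H" for u v
    using QI[OF that horner_one] horner_carrier[OF that] by simp
  show "G \<subseteq> Q" using base horner_base by auto
  show "(a, a') \<in> Q" by (rule base[OF horner_gen])
  have QE: "\<exists>u v w z. (u, v) \<in> H \<and> (w, z) \<in> H \<and> w \<noteq> \<zero>\<^bsub>R\<^esub> \<and> z \<noteq> \<zero>\<^bsub>R'\<^esub> \<and> u \<in> carrier R \<and> v \<in> carrier R' \<and> w \<in> carrier R \<and> z \<in> carrier R'
      \<and> w \<in> Units R \<and> z \<in> Units R' \<and> x = u \<otimes>\<^bsub>R\<^esub> inv\<^bsub>R\<^esub> w \<and> y = v \<otimes>\<^bsub>R'\<^esub> inv\<^bsub>R'\<^esub> z" if "(x, y) \<in> Q" for x y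
  proof -
    from that obtain u v w z where uv: "(u, v) \<in> H" "(w, z) \<in> H" "w \<noteq> \<zero>\<^bsub>R\<^esub>" "x = u \<otimes>\<^bsub>R\<^esub> inv\<^bsub>R\<^esub> w" "y = v \<otimes>\<^bsub>R'\<^esub> inv\<^bsub>R'\<^esub> z"
      unfolding Q_def horner_quotients_def by blast
    note c = horner_carrier[OF uv(1)] horner_carrier[OF uv(2)]
    have z: "z \<noteq> \<zero>\<^bsub>R'\<^esub>" using Z'[OF uv(2)] uv(3) by blast
    have "w \<in> Units R" "z \<in> Units R'" using c uv(3) z R.field_Units R'.field_Units by auto
    thus ?thesis using uv c z by blast
  qed
  show "corr R R' Q"
    unfolding corr_def
  proof (intro conjI allI impI)
    show "Q \<subseteq> carrier R \<times> carrier R'"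
    proof
      fix q assume "q \<in> Q"
      moreover obtain x y where "q = (x, y)" by (cases q)
      ultimately show "q \<in> carrier R \<times> carrier R'" using QE[of x y] by auto
    qed
    show "(\<one>\<^bsub>R\<^esub>, \<one>\<^bsub>R'\<^esub>) \<in> Q" by (rule base[OF horner_one])
  next
    fix x y x' y' assume "(x, y) \<in> Q" "(x', y') \<in> Q"
    from QE[OF this(1)] QE[OF this(2)]
    obtain u v w z u' v' w' z' where uv: "(u, v) \<in> H" "(w, z) \<in> H" "w \<noteq> \<zero>\<^bsub>R\<^esub>" "z \<noteq> \<zero>\<^bsub>R'\<^esub>" "u \<in> carrier R" "v \<in> carrier R'" "w \<in> carrier R" "z \<in> carrier R'"
      "x = u \<otimes>\<^bsub>R\<^esub> inv\<^bsub>R\<^esub> w" "y = v \<otimes>\<^bsub>R'\<^esub> inv\<^bsub>R'\<^esub> z"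
      and uv': "(u', v') \<in> H" "(w', z') \<in> H" "w' \<noteq> \<zero>\<^bsub>R\<^esub>" "z' \<noteq> \<zero>\<^bsub>R'\<^esub>" "u' \<in> carrier R" "v' \<in> carrier R'" "w' \<in> carrier R" "z' \<in> carrier R'"
      "x' = u' \<otimes>\<^bsub>R\<^esub> inv\<^bsub>R\<^esub> w'" "y' = v' \<otimes>\<^bsub>R'\<^esub> inv\<^bsub>R'\<^esub> z'" by (elim exE conjE) blast
    have ww: "(w \<otimes>\<^bsub>R\<^esub> w', z \<otimes>\<^bsub>R'\<^esub> z') \<in> H" "w \<otimes>\<^bsub>R\<^esub> w' \<noteq> \<zero>\<^bsub>R\<^esub>"
      using horner_mult[OF uv(2) uv'(2)] uv uv' R.integral_iff by auto
    have "(u \<otimes>\<^bsub>R\<^esub> w' \<oplus>\<^bsub>R\<^esub> u' \<otimes>\<^bsub>R\<^esub> w, v \<otimes>\<^bsub>R'\<^esub> z' \<oplus>\<^bsub>R'\<^esub> v' \<otimes>\<^bsub>R'\<^esub> z) \<in> H"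
      by (intro horner_add horner_mult uv uv')
    from QI[OF this ww] show "(x \<oplus>\<^bsub>R\<^esub> x', y \<oplus>\<^bsub>R'\<^esub> y') \<in> Q"
      unfolding uv(9,10) uv'(9,10)
        R.frac_add[OF uv(5,7) uv'(5,7) uv(3) uv'(3)] R'.frac_add[OF uv(6,8) uv'(6,8) uv(4) uv'(4)] .
    have "(u \<otimes>\<^bsub>R\<^esub> u', v \<otimes>\<^bsub>R'\<^esub> v') \<in> H" by (intro horner_mult uv uv')
    from QI[OF this ww] show "(x \<otimes>\<^bsub>R\<^esub> x', y \<otimes>\<^bsub>R'\<^esub> y') \<in> Q"
      unfolding uv(9,10) uv'(9,10)
        R.frac_mult[OF uv(5,7) uv'(5,7) uv(3) uv'(3)] R'.frac_mult[OF uv(6,8) uv'(6,8) uv(4) uv'(4)] .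
  next
    fix x y assume "(x, y) \<in> Q"
    from QE[OF this] obtain u v w z where uv: "(u, v) \<in> H" "(w, z) \<in> H" "w \<noteq> \<zero>\<^bsub>R\<^esub>" "z \<noteq> \<zero>\<^bsub>R'\<^esub>" "u \<in> carrier R" "v \<in> carrier R'" "w \<in> carrier R" "z \<in> carrier R'"
      "w \<in> Units R" "z \<in> Units R'" "x = u \<otimes>\<^bsub>R\<^esub> inv\<^bsub>R\<^esub> w" "y = v \<otimes>\<^bsub>R'\<^esub> inv\<^bsub>R'\<^esub> z" by (elim exE conjE) blast
    from QI[OF horner_a_inv[OF uv(1)] uv(2,3)] show "(\<ominus>\<^bsub>R\<^esub> x, \<ominus>\<^bsub>R'\<^esub> y) \<in> Q"
      unfolding uv(11,12) using uv(5,6,9,10) by (simp add: R.l_minus R'.l_minus)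
    show xy0: "x = \<zero>\<^bsub>R\<^esub> \<longleftrightarrow> y = \<zero>\<^bsub>R'\<^esub>"
      unfolding uv(11,12) R.frac_eq_zero[OF uv(5,7,3)] R'.frac_eq_zero[OF uv(6,8,4)] by (rule Z'[OF uv(1)])
    assume "x \<noteq> \<zero>\<^bsub>R\<^esub>"
    hence u0: "u \<noteq> \<zero>\<^bsub>R\<^esub>" and v0: "v \<noteq> \<zero>\<^bsub>R'\<^esub>"
      unfolding uv(11) R.frac_eq_zero[OF uv(5,7,3)] using Z'[OF uv(1)] by auto
    from QI[OF uv(2,1) u0] show "(inv\<^bsub>R\<^esub> x, inv\<^bsub>R'\<^esub> y) \<in> Q"
      unfolding uv(11,12) R.frac_inv[OF uv(5,7) u0 uv(3)] R'.frac_inv[OF uv(6,8) v0 uv(4)] .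
  qed
qed

text \<open>Minimality of the extension; it preserves the invariant of the Zorn argument in
  \<open>steinitz\<close>, that everything matched is algebraic over the matched basis
  elements.\<close>

lemma fst_horner_quotients_subset:
  assumes E: "subfield E R" "fst ` G \<subseteq> E" "a \<in> E" shows "fst ` horner_quotients R R' G a a' \<subseteq> E"
proof -
  note E' = subringE[OF subfieldE(1)[OF E(1)]]
  have uE: "(u, v) \<in> H \<Longrightarrow> u \<in> E" for u v
  proof (induction rule: horner.induct)
    case (step u v c d)
    have "c \<in> E" using step.hyps(2) E(2) by force
    thus ?case using step.IH E(3) E'(6,7) by blast
  qed (rule E'(2))
  show ?thesis
  proof
    fix x assume "x \<in> fst ` horner_quotients R R' G a a'"
    then obtain u v w z where uv: "(u, v) \<in> H" "(w, z) \<in> H" "w \<noteq> \<zero>\<^bsub>R\<^esub>" "x = u \<otimes>\<^bsub>R\<^esub> inv\<^bsub>R\<^esub> w"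
      unfolding horner_quotients_def by auto
    have "inv\<^bsub>R\<^esub> w \<in> E" using R.subfield_m_inv(1)[OF E(1)] uE[OF uv(2)] uv(3) by blast
    thus "x \<in> E" using uE[OF uv(1)] E'(6) uv(4) by blast
  qed
qed

lemma snd_horner_quotients_subset:
  assumes E: "subfield E R'" "snd ` G \<subseteq> E" "a' \<in> E" and Z': "\<And>u v. (u, v) \<in> H \<Longrightarrow> u = \<zero>\<^bsub>R\<^esub> \<longleftrightarrow> v = \<zero>\<^bsub>R'\<^esub>"
  shows "snd ` horner_quotients R R' G a a' \<subseteq> E"
proof -
  note E' = subringE[OF subfieldE(1)[OF E(1)]]
  have vE: "(u, v) \<in> H \<Longrightarrow> v \<in> E" for u v
  proof (induction rule: horner.induct)
    case (step u v c d)
    have "d \<in> E" using step.hyps(2) E(2) by force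
    thus ?case using step.IH E(3) E'(6,7) by blast
  qed (rule E'(2))
  show ?thesis
  proof
    fix y assume "y \<in> snd ` horner_quotients R R' G a a'"
    then obtain u v w z where uv: "(u, v) \<in> H" "(w, z) \<in> H" "w \<noteq> \<zero>\<^bsub>R\<^esub>" "y = v \<otimes>\<^bsub>R'\<^esub> inv\<^bsub>R'\<^esub> z"
      unfolding horner_quotients_def by auto
    have "z \<noteq> \<zero>\<^bsub>R'\<^esub>" using Z'[OF uv(2)] uv(3) by blast
    hence "inv\<^bsub>R'\<^esub> z \<in> E" using R'.subfield_m_inv(1)[OF E(1)] vE[OF uv(2)] by blast
    thus "y \<in> E" using vE[OF uv(1)] E'(6) uv(4) by blast
  qed
qed

end

lemma corr_extend_transcendental:
  assumes G: "corr R R' G" and a: "a \<in> carrier R" and a': "a' \<in> carrier R'"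
    and tr: "(ring.transcendental R over fst ` G) a" and tr': "(ring.transcendental R' over snd ` G) a'"
  shows "\<exists>Q. corr R R' Q \<and> G \<subseteq> Q \<and> (a, a') \<in> Q \<and>
    (\<forall>E. subfield E R \<longrightarrow> fst ` G \<subseteq> E \<longrightarrow> a \<in> E \<longrightarrow> fst ` Q \<subseteq> E) \<and>
    (\<forall>E. subfield E R' \<longrightarrow> snd ` G \<subseteq> E \<longrightarrow> a' \<in> E \<longrightarrow> snd ` Q \<subseteq> E)"
proof -
  have swap: "fst ` (G\<inverse>) = snd ` G" by force
  have Z': "u = \<zero>\<^bsub>R\<^esub> \<longleftrightarrow> v = \<zero>\<^bsub>R'\<^esub>" if "(u, v) \<in> horner R R' G a a'" for u v
  proof
    assume "u = \<zero>\<^bsub>R\<^esub>" with horner_transcendental[OF G a a' tr that] show "v = \<zero>\<^bsub>R'\<^esub>" .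
  next
    assume "v = \<zero>\<^bsub>R'\<^esub>"
    with field_pair.horner_transcendental[OF field_pair_swap corr_converse[OF G] a' a tr'[folded swap] horner_converse[OF that]]
    show "u = \<zero>\<^bsub>R\<^esub>" .
  qed
  show ?thesis
    using corr_horner_quotients[OF G a a' Z'] fst_horner_quotients_subset[OF G a a'] snd_horner_quotients_subset[OF G a a' _ _ _ Z']
    by (intro exI[of _ "horner_quotients R R' G a a'"] conjI allI impI)
qed

lemma map_fst_map2:
  "map fst (map2 (\<lambda>x y. (f (fst x) (fst y), g (snd x) (snd y))) xs ys) = map2 f (map fst xs) (map fst ys)"
  "map snd (map2 (\<lambda>x y. (f (fst x) (fst y), g (snd x) (snd y))) xs ys) = map2 g (map snd xs) (map snd ys)"
  by (auto intro!: nth_equalityI)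

text \<open>The minimal polynomial of \<open>a\<close> is carried over by \<open>G\<close>, and any
  root \<open>a'\<close> of the image serves as partner. Since reduction modulo the two monic
  polynomials runs in parallel, a vanishing first coordinate makes all remaining coefficients zero
  on both sides.\<close>

lemma corr_extend_algebraic:
  assumes G: "corr R R' G" and a: "a \<in> carrier R" and alg: "(ring.algebraic R over fst ` G) a"
    and closed: "algebraically_closed R'"
  shows "\<exists>Q. corr R R' Q \<and> G \<subseteq> Q \<and> a \<in> fst ` Q"
proof -
  let ?K = "fst ` G"
  have K: "subfield ?K R" by (rule corr_subfield[OF G])
  define p where "p = R.Irr ?K a"
  note p = R.IrrE[OF K a alg, folded p_def]
  have p_ne: "p \<noteq> []" by (rule R.pirreducibleE(1)[OF subfieldE(1)[OF K] p(1,2)])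
  obtain p0 where p0: "p = \<one>\<^bsub>R\<^esub> # p0" using p(3) p_ne by (cases p) auto
  have "set p0 \<subseteq> ?K" using p(1) unfolding p0 univ_poly_def polynomial_def by auto
  hence "\<exists>ms. set ms \<subseteq> G \<and> map fst ms = p0"
  proof (induction p0)
    case (Cons x p0)
    then obtain m ms where "m \<in> G" "fst m = x" "set ms \<subseteq> G" "map fst ms = p0" by auto
    thus ?case by (intro exI[of _ "m # ms"]) auto
  qed simp
  then obtain ms where ms: "set ms \<subseteq> G" "map fst ms = p0" by blast
  have msc: "set (map fst ms) \<subseteq> carrier R" "set (map snd ms) \<subseteq> carrier R'" using ms(1) corrD(1,2)[OF G] by auto
  define n where "n = length ms"
  have lp: "length p0 = n" using ms(2) n_def by auto
  have rel: "a [^]\<^bsub>R\<^esub> n \<oplus>\<^bsub>R\<^esub> R.eval (map fst ms) a = \<zero>\<^bsub>R\<^esub>"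
    using p(4) a lp unfolding p0 ms(2) by simp
  have n0: "n > 0"
  proof (rule ccontr)
    assume "\<not> n > 0"
    thus False using rel n_def by simp
  qed
  hence "map snd ms \<noteq> []" using n_def by simp
  from R'.algebraically_closed_root[OF closed msc(2) this]
  obtain a' where a': "a' \<in> carrier R'" "R'.eval (\<one>\<^bsub>R'\<^esub> # map snd ms) a' = \<zero>\<^bsub>R'\<^esub>" by blast
  have rel': "a' [^]\<^bsub>R'\<^esub> n \<oplus>\<^bsub>R'\<^esub> R'.eval (map snd ms) a' = \<zero>\<^bsub>R'\<^esub>" using a' n_def by simp
  have G0: "(\<zero>\<^bsub>R\<^esub>, \<zero>\<^bsub>R'\<^esub>) \<in> G" by (rule corr_zero[OF G])
  \<comment> \<open>Each element of the generated ring is represented by \<open>n\<close>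
    coefficient pairs, \<open>n\<close> being the degree; one Horner step followed by one reduction
    keeps that length.\<close>
  have red: "\<exists>qs. set qs \<subseteq> G \<and> length qs = n \<and> u = R.eval (map fst qs) a \<and> v = R'.eval (map snd qs) a'"
    if "(u, v) \<in> horner R R' G a a'" for u v
    using that
  proof (induction rule: horner.induct)
    case zero
    have "R.eval (replicate n \<zero>\<^bsub>R\<^esub>) a = \<zero>\<^bsub>R\<^esub>" "R'.eval (replicate n \<zero>\<^bsub>R'\<^esub>) a' = \<zero>\<^bsub>R'\<^esub>"
      by (rule R.eval_zeros[OF _ a], auto intro: R'.eval_zeros[OF _ a'(1)])
    thus ?case using G0 by (intro exI[of _ "replicate n (\<zero>\<^bsub>R\<^esub>, \<zero>\<^bsub>R'\<^esub>)"]) auto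
  next
    case (step u v c d)
    then obtain qs where qs: "set qs \<subseteq> G" "length qs = n" "u = R.eval (map fst qs) a" "v = R'.eval (map snd qs) a'" by blast
    obtain q qs0 where q: "qs = q # qs0" using qs(2) n0 by (cases qs) auto
    obtain l l' where l: "q = (l, l')" by (cases q)
    have lG: "(l, l') \<in> G" using qs(1) q l by auto
    have c: "set (map fst qs0) \<subseteq> carrier R" "set (map snd qs0) \<subseteq> carrier R'" "l \<in> carrier R" "l' \<in> carrier R'" "c \<in> carrier R" "d \<in> carrier R'"
      using qs(1) q corrD(1,2)[OF G] step.hyps(2) lG by auto
    define new where "new = map2 (\<lambda>x y. (fst x \<ominus>\<^bsub>R\<^esub> l \<otimes>\<^bsub>R\<^esub> fst y, snd x \<ominus>\<^bsub>R'\<^esub> l' \<otimes>\<^bsub>R'\<^esub> snd y)) (qs0 @ [(c, d)]) ms"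
    note map_new = map_fst_map2[where f="\<lambda>x y. x \<ominus>\<^bsub>R\<^esub> l \<otimes>\<^bsub>R\<^esub> y" and g="\<lambda>x y. x \<ominus>\<^bsub>R'\<^esub> l' \<otimes>\<^bsub>R'\<^esub> y"]
    have minG: "(x \<ominus>\<^bsub>R\<^esub> l \<otimes>\<^bsub>R\<^esub> y, x' \<ominus>\<^bsub>R'\<^esub> l' \<otimes>\<^bsub>R'\<^esub> y') \<in> G" if "(x, x') \<in> G" "(y, y') \<in> G" for x x' y y'
      unfolding a_minus_def by (intro corrD(4)[OF G that(1)] corrD(6)[OF G] corrD(5)[OF G lG that(2)])
    have "set new \<subseteq> G"
    proof
      fix t assume "t \<in> set new"
      then obtain w where w: "w \<in> set (zip (qs0 @ [(c, d)]) ms)"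
        "t = (\<lambda>(x, y). (fst x \<ominus>\<^bsub>R\<^esub> l \<otimes>\<^bsub>R\<^esub> fst y, snd x \<ominus>\<^bsub>R'\<^esub> l' \<otimes>\<^bsub>R'\<^esub> snd y)) w"
        unfolding new_def set_map by (rule imageE)
      obtain x y where "w = (x, y)" by (cases w)
      with w have xy: "x \<in> set (qs0 @ [(c, d)])" "y \<in> set ms"
        "t = (fst x \<ominus>\<^bsub>R\<^esub> l \<otimes>\<^bsub>R\<^esub> fst y, snd x \<ominus>\<^bsub>R'\<^esub> l' \<otimes>\<^bsub>R'\<^esub> snd y)"
        by (simp_all only: split) (erule set_zip_leftD, erule set_zip_rightD)
      have "x \<in> G" "y \<in> G" using xy(1,2) qs(1) q step.hyps(2) ms(1) by auto
      thus "t \<in> G" unfolding xy(3) by (intro minG) auto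
    qed
    moreover have "length new = n" unfolding new_def using qs(2) q n_def by simp
    moreover have "u \<otimes>\<^bsub>R\<^esub> a \<oplus>\<^bsub>R\<^esub> c = R.eval (map fst new) a"
    proof -
      have "map fst new = map2 (\<lambda>x y. x \<ominus>\<^bsub>R\<^esub> l \<otimes>\<^bsub>R\<^esub> y) (map fst qs0 @ [c]) (map fst ms)"
        unfolding new_def map_new by simp
      moreover have "R.eval (l # map fst qs0) a \<otimes>\<^bsub>R\<^esub> a \<oplus>\<^bsub>R\<^esub> c
          = R.eval (map2 (\<lambda>x y. x \<ominus>\<^bsub>R\<^esub> l \<otimes>\<^bsub>R\<^esub> y) (map fst qs0 @ [c]) (map fst ms)) a"
        by (rule R.eval_reduce) (use c msc qs(2) q n_def rel a in auto)
      ultimately show ?thesis using qs(3) q l by simp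
    qed
    moreover have "v \<otimes>\<^bsub>R'\<^esub> a' \<oplus>\<^bsub>R'\<^esub> d = R'.eval (map snd new) a'"
    proof -
      have "map snd new = map2 (\<lambda>x y. x \<ominus>\<^bsub>R'\<^esub> l' \<otimes>\<^bsub>R'\<^esub> y) (map snd qs0 @ [d]) (map snd ms)"
        unfolding new_def map_new by simp
      moreover have "R'.eval (l' # map snd qs0) a' \<otimes>\<^bsub>R'\<^esub> a' \<oplus>\<^bsub>R'\<^esub> d
          = R'.eval (map2 (\<lambda>x y. x \<ominus>\<^bsub>R'\<^esub> l' \<otimes>\<^bsub>R'\<^esub> y) (map snd qs0 @ [d]) (map snd ms)) a'"
        by (rule R'.eval_reduce) (use c msc qs(2) q n_def rel' a' in auto)
      ultimately show ?thesis using qs(4) q l by simp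
    qed
    ultimately show ?case by blast
  qed
  have Z1: "v = \<zero>\<^bsub>R'\<^esub>" if uv: "(u, v) \<in> horner R R' G a a'" "u = \<zero>\<^bsub>R\<^esub>" for u v
  proof -
    obtain qs where qs: "set qs \<subseteq> G" "length qs = n" "u = R.eval (map fst qs) a" "v = R'.eval (map snd qs) a'"
      using red[OF uv(1)] by blast
    have qK: "set (map fst qs) \<subseteq> ?K" and qc: "set (map fst qs) \<subseteq> carrier R" using qs(1) corrD(1)[OF G] by auto
    let ?q = "R.normalize (map fst qs)"
    have q: "?q \<in> carrier (?K[X]\<^bsub>R\<^esub>)"
      using R.normalize_gives_polynomial[OF qK] unfolding univ_poly_def by simp
    have "R.eval ?q a = \<zero>\<^bsub>R\<^esub>" using R.eval_normalize[OF qc a] qs(3) uv(2) by simp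
    from R.Irr_minimal[OF K a alg q this] have div: "p pdivides\<^bsub>R\<^esub> ?q" unfolding p_def .
    \<comment> \<open>A nonzero multiple of the minimal polynomial has degree at least
      \<open>n\<close>, but a list of length \<open>n\<close> only reaches degree
      \<open>n - 1\<close>.\<close>
    have "?q = []"
    proof (rule ccontr)
      assume ne: "?q \<noteq> []"
      from R.pdivides_imp_degree_le[OF subfieldE(1)[OF K] p(1) q ne div]
      have "n \<le> length ?q - 1" using lp p0 by simp
      moreover have "length ?q \<le> n" using R.normalize_length_le[of "map fst qs"] qs(2) by simp
      ultimately show False using n0 by linarith
    qed
    from eval_snd_zero[OF G a a'(1) qs(1) this] show ?thesis using qs(4) by simp
  qed
  have KA: "subfield (R.simple_extension ?K a) R" using R.simple_extension_is_subfield[OF K a] alg by blast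
  have Z': "u = \<zero>\<^bsub>R\<^esub> \<longleftrightarrow> v = \<zero>\<^bsub>R'\<^esub>" if uv: "(u, v) \<in> horner R R' G a a'" for u v
  proof
    assume v0: "v = \<zero>\<^bsub>R'\<^esub>"
    note uvc = horner_carrier[OF G a a'(1) uv]
    show "u = \<zero>\<^bsub>R\<^esub>"
    proof (rule ccontr)
      \<comment> \<open>The inverse of \<open>u\<close> lies in the simple extension and so has a
        partner \<open>z\<close>. With \<open>v\<close> zero, multiplying the pairs gives (1, 0);
        subtracting this from (1, 1) gives (0, 1), which \<open>Z1\<close> forbids.\<close>
      assume u0: "u \<noteq> \<zero>\<^bsub>R\<^esub>"
      have uU: "u \<in> Units R" using uvc u0 R.field_Units by blast
      have "inv\<^bsub>R\<^esub> u \<in> R.simple_extension ?K a"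
        using R.subfield_m_inv(1)[OF KA] simple_extension_horner[OF G a a'(1) uv] u0 by blast
      then obtain z where z: "(inv\<^bsub>R\<^esub> u, z) \<in> horner R R' G a a'" using horner_simple_extension[OF G a a'(1)] by blast
      have zc: "z \<in> carrier R'" using horner_carrier[OF G a a'(1) z] by blast
      have "(u \<otimes>\<^bsub>R\<^esub> inv\<^bsub>R\<^esub> u, v \<otimes>\<^bsub>R'\<^esub> z) \<in> horner R R' G a a'" by (rule horner_mult[OF G a a'(1) uv z])
      hence "(\<one>\<^bsub>R\<^esub>, \<zero>\<^bsub>R'\<^esub>) \<in> horner R R' G a a'" using uU zc v0 by simp
      from horner_add[OF G a a'(1) horner_one[OF G a a'(1)] horner_a_inv[OF G a a'(1) this]]
      have "(\<zero>\<^bsub>R\<^esub>, \<one>\<^bsub>R'\<^esub>) \<in> horner R R' G a a'" by (simp add: R.r_neg)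
      from Z1[OF this refl] show False by simp
    qed
  qed (rule Z1[OF uv])
  from corr_horner_quotients[OF G a a'(1) Z'] show ?thesis
    by (intro exI[of _ "horner_quotients R R' G a a'"]) force
qed

text \<open>The identification of the two copies of the rationals, matching \<open>i / j\<close>
  with \<open>i / j\<close>; it makes the family in the Zorn argument nonempty.\<close>

definition prime_corr :: "('a \<times> 'b) set" where
  "prime_corr = {(x, y). x \<in> carrier R \<and> y \<in> carrier R' \<and>
     (\<exists>i j. j \<noteq> 0 \<and> x \<otimes>\<^bsub>R\<^esub> R.int_emb j = R.int_emb i \<and> y \<otimes>\<^bsub>R'\<^esub> R'.int_emb j = R'.int_emb i)}"

end

context field
begin

text \<open>Arithmetic of fractions in the form \<open>x \<otimes> int_emb j = int_emb i\<close>: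
  the numerator and denominator are integers, so the same pair describes the matching elements of
  both fields.\<close>

lemma int_frac_add:
  assumes "x \<in> carrier R" "x' \<in> carrier R" "x \<otimes> int_emb j = int_emb i" "x' \<otimes> int_emb j' = int_emb i'"
  shows "(x \<oplus> x') \<otimes> int_emb (j * j') = int_emb (i * j' + i' * j)"
proof -
  have "(x \<oplus> x') \<otimes> (p \<otimes> q) = (x \<otimes> p) \<otimes> q \<oplus> (x' \<otimes> q) \<otimes> p" if "p \<in> carrier R" "q \<in> carrier R" for p q
    using assms(1,2) that by algebra
  from this[OF int_emb_closed int_emb_closed, of j j'] show ?thesis
    unfolding int_emb_mult int_emb_add assms(3,4) .
qed

lemma int_frac_mult:
  assumes "x \<in> carrier R" "x' \<in> carrier R" "x \<otimes> int_emb j = int_emb i" "x' \<otimes> int_emb j' = int_emb i'"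
  shows "(x \<otimes> x') \<otimes> int_emb (j * j') = int_emb (i * i')"
proof -
  have "(x \<otimes> x') \<otimes> (p \<otimes> q) = (x \<otimes> p) \<otimes> (x' \<otimes> q)" if "p \<in> carrier R" "q \<in> carrier R" for p q
    using assms(1,2) that by algebra
  from this[OF int_emb_closed int_emb_closed, of j j'] show ?thesis
    unfolding int_emb_mult assms(3,4) .
qed

lemma int_frac_minus:
  assumes "x \<in> carrier R" "x \<otimes> int_emb j = int_emb i"
  shows "(\<ominus> x) \<otimes> int_emb j = int_emb (- i)"
  using assms by (simp add: l_minus int_emb_minus)

lemma int_frac_inv:
  assumes "x \<in> carrier R" "x \<noteq> \<zero>" "x \<otimes> int_emb j = int_emb i"
  shows "inv x \<otimes> int_emb i = int_emb j"
proof -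
  have U: "x \<in> Units R" using assms field_Units by blast
  have "inv x \<otimes> (x \<otimes> int_emb j) = (inv x \<otimes> x) \<otimes> int_emb j" by (rule m_assoc[symmetric]) (use U assms(1) in auto)
  thus ?thesis unfolding assms(3) Units_l_inv[OF U] by simp
qed

lemma int_frac_eq_0:
  assumes "char0 R" "x \<in> carrier R" "j \<noteq> 0" "x \<otimes> int_emb j = int_emb i"
  shows "x = \<zero> \<longleftrightarrow> i = 0"
  using assms integral_iff[of x "int_emb j"] int_emb_eq_0[OF assms(1)] by (metis int_emb_closed)

lemma int_frac_mem:
  assumes "char0 R" "x \<in> carrier R" "j \<noteq> 0" "x \<otimes> int_emb j = int_emb i" "subfield E R"
  shows "x \<in> E"
proof -
  have U: "int_emb j \<in> Units R" using int_emb_eq_0[OF assms(1)] assms(3) field_Units by auto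
  have "x \<otimes> int_emb j \<otimes> inv (int_emb j) = x \<otimes> (int_emb j \<otimes> inv (int_emb j))"
    by (rule m_assoc) (use U assms(2) in auto)
  hence "x = int_emb i \<otimes> inv (int_emb j)" unfolding assms(4) Units_r_inv[OF U] using assms(2) by simp
  moreover have "inv (int_emb j) \<in> E" using subfield_m_inv(1)[OF assms(5)] int_emb_in_subfield[OF assms(5)]
    int_emb_eq_0[OF assms(1)] assms(3) by simp
  ultimately show ?thesis using int_emb_in_subfield[OF assms(5)] subringE(6)[OF subfieldE(1)[OF assms(5)]] by simp
qed

end

context field_pair
begin

lemma corr_prime_corr: assumes "char0 R" "char0 R'" shows "corr R R' prime_corr"
proof -
  have I: "(x, y) \<in> prime_corr" if "x \<in> carrier R" "y \<in> carrier R'" "j \<noteq> 0"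
      "x \<otimes>\<^bsub>R\<^esub> R.int_emb j = R.int_emb i" "y \<otimes>\<^bsub>R'\<^esub> R'.int_emb j = R'.int_emb i" for x y i j
    unfolding prime_corr_def using that by blast
  show ?thesis
    unfolding corr_def
  proof (intro conjI allI impI)
    show "prime_corr \<subseteq> carrier R \<times> carrier R'" unfolding prime_corr_def by auto
    show "(\<one>\<^bsub>R\<^esub>, \<one>\<^bsub>R'\<^esub>) \<in> prime_corr" by (rule I[of _ _ 1 1]) auto
  next
    fix x y x' y' assume "(x, y) \<in> prime_corr" "(x', y') \<in> prime_corr"
    then obtain i j i' j' where *: "x \<in> carrier R" "y \<in> carrier R'" "j \<noteq> 0" "x \<otimes>\<^bsub>R\<^esub> R.int_emb j = R.int_emb i" "y \<otimes>\<^bsub>R'\<^esub> R'.int_emb j = R'.int_emb i"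
      and **: "x' \<in> carrier R" "y' \<in> carrier R'" "j' \<noteq> 0" "x' \<otimes>\<^bsub>R\<^esub> R.int_emb j' = R.int_emb i'" "y' \<otimes>\<^bsub>R'\<^esub> R'.int_emb j' = R'.int_emb i'"
      unfolding prime_corr_def by blast
    show "(x \<oplus>\<^bsub>R\<^esub> x', y \<oplus>\<^bsub>R'\<^esub> y') \<in> prime_corr"
      by (rule I[OF _ _ _ R.int_frac_add[OF *(1) **(1) *(4) **(4)] R'.int_frac_add[OF *(2) **(2) *(5) **(5)]]) (use * ** in auto)
    show "(x \<otimes>\<^bsub>R\<^esub> x', y \<otimes>\<^bsub>R'\<^esub> y') \<in> prime_corr"
      by (rule I[OF _ _ _ R.int_frac_mult[OF *(1) **(1) *(4) **(4)] R'.int_frac_mult[OF *(2) **(2) *(5) **(5)]]) (use * ** in auto)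
  next
    fix x y assume "(x, y) \<in> prime_corr"
    then obtain i j where *: "x \<in> carrier R" "y \<in> carrier R'" "j \<noteq> 0" "x \<otimes>\<^bsub>R\<^esub> R.int_emb j = R.int_emb i" "y \<otimes>\<^bsub>R'\<^esub> R'.int_emb j = R'.int_emb i"
      unfolding prime_corr_def by blast
    show "(\<ominus>\<^bsub>R\<^esub> x, \<ominus>\<^bsub>R'\<^esub> y) \<in> prime_corr"
      by (rule I[OF _ _ *(3) R.int_frac_minus[OF *(1,4)] R'.int_frac_minus[OF *(2,5)]]) (use * in auto)
    note 0 = R.int_frac_eq_0[OF assms(1) *(1,3,4)] R'.int_frac_eq_0[OF assms(2) *(2,3,5)]
    show "x = \<zero>\<^bsub>R\<^esub> \<longleftrightarrow> y = \<zero>\<^bsub>R'\<^esub>" unfolding 0 ..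
    assume x: "x \<noteq> \<zero>\<^bsub>R\<^esub>"
    hence i: "i \<noteq> 0" and y: "y \<noteq> \<zero>\<^bsub>R'\<^esub>" unfolding 0 by auto
    have "x \<in> Units R" "y \<in> Units R'" using x y * R.field_Units R'.field_Units by auto
    thus "(inv\<^bsub>R\<^esub> x, inv\<^bsub>R'\<^esub> y) \<in> prime_corr"
      by (intro I[OF _ _ i R.int_frac_inv[OF *(1) x *(4)] R'.int_frac_inv[OF *(2) y *(5)]]) auto
  qed
qed

lemma corr_full_iso:
  assumes M: "corr R R' M" "fst ` M = carrier R" "snd ` M = carrier R'" shows "R \<simeq> R'"
proof -
  \<comment> \<open>Subtracting two pairs with equal first entry gives a pair whose first entry is
    0; its second entry must then be 0 as well.\<close>
  have funct: "y = y'" if "(x, y) \<in> M" "(x, y') \<in> M" for x y y'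
  proof -
    have "(x \<oplus>\<^bsub>R\<^esub> \<ominus>\<^bsub>R\<^esub> x, y \<oplus>\<^bsub>R'\<^esub> \<ominus>\<^bsub>R'\<^esub> y') \<in> M" by (intro corrD(4)[OF M(1) that(1)] corrD(6)[OF M(1) that(2)])
    from corrD(7)[OF M(1) this] show ?thesis
      using corrD(1,2)[OF M(1) that(1)] corrD(2)[OF M(1) that(2)]
      by (simp add: R.r_neg R'.r_right_minus_eq flip: a_minus_def)
  qed
  have inj: "x = x'" if "(x, y) \<in> M" "(x', y) \<in> M" for x x' y
  proof -
    have "(x \<oplus>\<^bsub>R\<^esub> \<ominus>\<^bsub>R\<^esub> x', y \<oplus>\<^bsub>R'\<^esub> \<ominus>\<^bsub>R'\<^esub> y) \<in> M" by (intro corrD(4)[OF M(1) that(1)] corrD(6)[OF M(1) that(2)])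
    from corrD(7)[OF M(1) this] show ?thesis
      using corrD(1,2)[OF M(1) that(1)] corrD(1)[OF M(1) that(2)]
      by (simp add: R'.r_neg R.r_right_minus_eq flip: a_minus_def)
  qed
  have ex: "\<exists>y. (x, y) \<in> M" if "x \<in> carrier R" for x using that M(2) by force
  define h where "h x = (SOME y. (x, y) \<in> M)" for x
  have h: "(x, h x) \<in> M" if "x \<in> carrier R" for x unfolding h_def by (rule someI_ex[OF ex[OF that]])
  have heq: "h x = y" if "(x, y) \<in> M" for x y using funct[OF h[OF corrD(1)[OF M(1) that]] that] .
  have "h \<in> ring_hom R R'"
  proof (rule ring_hom_memI)
    show "h x \<in> carrier R'" if "x \<in> carrier R" for x by (rule corrD(2)[OF M(1) h[OF that]])
    show "h \<one>\<^bsub>R\<^esub> = \<one>\<^bsub>R'\<^esub>" by (rule heq[OF corrD(3)[OF M(1)]])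
    fix x y assume xy: "x \<in> carrier R" "y \<in> carrier R"
    show "h (x \<otimes>\<^bsub>R\<^esub> y) = h x \<otimes>\<^bsub>R'\<^esub> h y" by (rule heq[OF corrD(5)[OF M(1) h[OF xy(1)] h[OF xy(2)]]])
    show "h (x \<oplus>\<^bsub>R\<^esub> y) = h x \<oplus>\<^bsub>R'\<^esub> h y" by (rule heq[OF corrD(4)[OF M(1) h[OF xy(1)] h[OF xy(2)]]])
  qed
  moreover have "bij_betw h (carrier R) (carrier R')"
  proof (rule bij_betwI')
    fix x y assume xy: "x \<in> carrier R" "y \<in> carrier R"
    show "(h x = h y) = (x = y)" using inj[OF h[OF xy(1)]] h[OF xy(2)] by auto
  next
    fix x assume "x \<in> carrier R" thus "h x \<in> carrier R'" by (rule corrD(2)[OF M(1) h])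
  next
    fix y assume "y \<in> carrier R'"
    then obtain x where "(x, y) \<in> M" using M(3) by force
    thus "\<exists>x\<in>carrier R. y = h x" using heq corrD(1)[OF M(1)] by metis
  qed
  ultimately show ?thesis unfolding is_ring_iso_def ring_iso_def by blast
qed

lemma corr_Union:
  assumes ne: "C \<noteq> {}" and chain: "\<And>G1 G2. G1 \<in> C \<Longrightarrow> G2 \<in> C \<Longrightarrow> G1 \<subseteq> G2 \<or> G2 \<subseteq> G1" and C: "\<And>G1. G1 \<in> C \<Longrightarrow> corr R R' G1"
  shows "corr R R' (\<Union>C)"
proof -
  have two: "\<exists>G1\<in>C. p \<in> G1 \<and> q \<in> G1" if "p \<in> \<Union>C" "q \<in> \<Union>C" for p q
  proof -
    from that obtain G1 G2 where "p \<in> G1" "G1 \<in> C" "q \<in> G2" "G2 \<in> C" by (elim UnionE)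
    note G = this
    from chain[OF G(2,4)] show ?thesis
    proof
      assume "G1 \<subseteq> G2" thus ?thesis using G by (intro bexI[of _ G2]) auto
    next
      assume "G2 \<subseteq> G1" thus ?thesis using G by (intro bexI[of _ G1]) auto
    qed
  qed
  show ?thesis
    unfolding corr_def
  proof (intro conjI allI impI)
    show "\<Union>C \<subseteq> carrier R \<times> carrier R'" by (intro Union_least) (use C in \<open>simp add: corr_def\<close>)
    obtain G1 where "G1 \<in> C" using ne by (meson ex_in_conv)
    with corrD(3)[OF C[OF this]] show "(\<one>\<^bsub>R\<^esub>, \<one>\<^bsub>R'\<^esub>) \<in> \<Union>C" by (intro UnionI)
  next
    fix x y x' y' assume "(x, y) \<in> \<Union>C" "(x', y') \<in> \<Union>C"
    from two[OF this] obtain G1 where G1: "G1 \<in> C" "(x, y) \<in> G1" "(x', y') \<in> G1" by (elim bexE conjE)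
    show "(x \<oplus>\<^bsub>R\<^esub> x', y \<oplus>\<^bsub>R'\<^esub> y') \<in> \<Union>C" using corrD(4)[OF C[OF G1(1)] G1(2,3)] G1(1) by blast
    show "(x \<otimes>\<^bsub>R\<^esub> x', y \<otimes>\<^bsub>R'\<^esub> y') \<in> \<Union>C" using corrD(5)[OF C[OF G1(1)] G1(2,3)] G1(1) by blast
  next
    fix x y assume "(x, y) \<in> \<Union>C"
    then obtain G1 where G1: "G1 \<in> C" "(x, y) \<in> G1" by blast
    show "(\<ominus>\<^bsub>R\<^esub> x, \<ominus>\<^bsub>R'\<^esub> y) \<in> \<Union>C" using corrD(6)[OF C[OF G1(1)] G1(2)] G1(1) by blast
    show "x = \<zero>\<^bsub>R\<^esub> \<longleftrightarrow> y = \<zero>\<^bsub>R'\<^esub>" by (rule corrD(7)[OF C[OF G1(1)] G1(2)])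
    assume "x \<noteq> \<zero>\<^bsub>R\<^esub>"
    show "(inv\<^bsub>R\<^esub> x, inv\<^bsub>R'\<^esub> y) \<in> \<Union>C" using corrD(8)[OF C[OF G1(1)] G1(2) \<open>x \<noteq> _\<close>] G1(1) by blast
  qed
qed

theorem steinitz:
  assumes closed: "algebraically_closed R" "algebraically_closed R'" and char: "char0 R" "char0 R'"
    and B: "transcendence_basis R B" and B': "transcendence_basis R' B'" and bij: "bij_betw \<phi> B B'"
  shows "R \<simeq> R'"
proof -
  have Bc: "B \<subseteq> carrier R" and ind: "\<And>b. b \<in> B \<Longrightarrow> b \<notin> R.alg_cl (B - {b})" and cl: "R.alg_cl B = carrier R"
    using B unfolding R.transcendence_basis_iff R.alg_independent_iff by auto
  have Bc': "B' \<subseteq> carrier R'" and ind': "\<And>b. b \<in> B' \<Longrightarrow> b \<notin> R'.alg_cl (B' - {b})" and cl': "R'.alg_cl B' = carrier R'"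
    using B' unfolding R'.transcendence_basis_iff R'.alg_independent_iff by auto
  have img: "\<phi> ` B = B'" and inj: "inj_on \<phi> B" using bij by (auto simp: bij_betw_def)
  define T where "T G = {b \<in> B. (b, \<phi> b) \<in> G}" for G
  have TB: "T G \<subseteq> B" for G unfolding T_def by blast
  have Tc: "T G \<subseteq> carrier R" and Tc': "\<phi> ` T G \<subseteq> carrier R'" for G using TB[of G] Bc Bc' img by auto
  \<comment> \<open>Invariant: whatever is matched is algebraic over the basis elements already
    matched with their prescribed images. It ensures that a basis element not yet matched is
    transcendental over the current domain, and its image over the current range, so that the pair
    can be adjoined.\<close>
  define \<A> where "\<A> = {G. corr R R' G \<and> fst ` G \<subseteq> R.alg_cl (T G) \<and> snd ` G \<subseteq> R'.alg_cl (\<phi> ` T G)}"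
  have "prime_corr \<in> \<A>"
  proof -
    have "x \<in> R.alg_cl (T prime_corr) \<and> y \<in> R'.alg_cl (\<phi> ` T prime_corr)" if "(x, y) \<in> prime_corr" for x y
    proof -
      from that obtain i j where *: "x \<in> carrier R" "y \<in> carrier R'" "j \<noteq> 0" "x \<otimes>\<^bsub>R\<^esub> R.int_emb j = R.int_emb i" "y \<otimes>\<^bsub>R'\<^esub> R'.int_emb j = R'.int_emb i"
        unfolding prime_corr_def by blast
      from R.int_frac_mem[OF char(1) *(1,3,4) R.subfield_alg_cl[OF Tc]] R'.int_frac_mem[OF char(2) *(2,3,5) R'.subfield_alg_cl[OF Tc']]
      show ?thesis by blast
    qed
    thus ?thesis unfolding \<A>_def using corr_prime_corr[OF char] by auto
  qed
  moreover have "\<Union>C \<in> \<A>" if C: "C \<noteq> {}" "subset.chain \<A> C" for C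
  proof -
    have CA: "\<And>G1. G1 \<in> C \<Longrightarrow> G1 \<in> \<A>" and ch: "\<And>G1 G2. G1 \<in> C \<Longrightarrow> G2 \<in> C \<Longrightarrow> G1 \<subseteq> G2 \<or> G2 \<subseteq> G1"
      using C(2) unfolding subset.chain_def by auto
    have mem: "x \<in> R.alg_cl (T (\<Union>C)) \<and> y \<in> R'.alg_cl (\<phi> ` T (\<Union>C))" if "(x, y) \<in> \<Union>C" for x y
    proof -
      from that obtain G1 where G1: "G1 \<in> C" "(x, y) \<in> G1" by blast
      have xy: "x \<in> R.alg_cl (T G1)" "y \<in> R'.alg_cl (\<phi> ` T G1)" using CA[OF G1(1)] G1(2) unfolding \<A>_def by force+
      have "T G1 \<subseteq> T (\<Union>C)" unfolding T_def using G1(1) by blast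
      with R.alg_cl_mono[OF this Tc] R'.alg_cl_mono[OF image_mono[OF this] Tc'] xy show ?thesis by blast
    qed
    have "corr R R' (\<Union>C)" by (rule corr_Union[OF C(1) ch]) (use CA in \<open>auto simp: \<A>_def\<close>)
    moreover have "fst p \<in> R.alg_cl (T (\<Union>C)) \<and> snd p \<in> R'.alg_cl (\<phi> ` T (\<Union>C))" if "p \<in> \<Union>C" for p
      using mem[of "fst p" "snd p"] that by simp
    ultimately show ?thesis unfolding \<A>_def by (simp add: image_subset_iff)
  qed
  ultimately have "\<exists>M\<in>\<A>. \<forall>G1\<in>\<A>. M \<subseteq> G1 \<longrightarrow> G1 = M" by (intro subset_Zorn_nonempty) auto
  then obtain M where M: "M \<in> \<A>" and max: "\<And>G1. G1 \<in> \<A> \<Longrightarrow> M \<subseteq> G1 \<Longrightarrow> G1 = M" by blast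
  have cM: "corr R R' M" and f: "fst ` M \<subseteq> R.alg_cl (T M)" and s: "snd ` M \<subseteq> R'.alg_cl (\<phi> ` T M)"
    using M unfolding \<A>_def by auto
  have swap: "fst ` (M\<inverse>) = snd ` M" by force
  have sub: "subfield (fst ` M) R" "subfield (snd ` M) R'"
    using corr_subfield[OF cM] field_pair.corr_subfield[OF field_pair_swap corr_converse[OF cM]] unfolding swap by auto
  have "b \<in> T M" if b: "b \<in> B" for b
  proof (rule ccontr)
    assume nb: "b \<notin> T M"
    have b': "\<phi> b \<in> B'" using b img by blast
    have TB1: "T M \<subseteq> B - {b}" using TB nb by blast
    have TB2: "\<phi> ` T M \<subseteq> B' - {\<phi> b}" using TB1 img inj b by (auto simp: inj_on_def)
    have tr: "(R.transcendental over fst ` M) b"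
    proof (rule ccontr)
      assume "\<not> (R.transcendental over fst ` M) b"
      hence "b \<in> R.alg_cl (fst ` M)" using b Bc unfolding R.alg_cl_def R.generate_field_subfield[OF sub(1)] over_def by blast
      hence "b \<in> R.alg_cl (R.alg_cl (T M))" using R.alg_cl_mono[OF f R.alg_cl_carrier] by blast
      hence "b \<in> R.alg_cl (B - {b})" unfolding R.alg_cl_idem[OF Tc] using R.alg_cl_mono[OF TB1] Bc by blast
      thus False using ind[OF b] by blast
    qed
    have tr': "(R'.transcendental over snd ` M) (\<phi> b)"
    proof (rule ccontr)
      assume "\<not> (R'.transcendental over snd ` M) (\<phi> b)"
      hence "\<phi> b \<in> R'.alg_cl (snd ` M)" using b' Bc' unfolding R'.alg_cl_def R'.generate_field_subfield[OF sub(2)] over_def by blast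
      hence "\<phi> b \<in> R'.alg_cl (R'.alg_cl (\<phi> ` T M))" using R'.alg_cl_mono[OF s R'.alg_cl_carrier] by blast
      hence "\<phi> b \<in> R'.alg_cl (B' - {\<phi> b})" unfolding R'.alg_cl_idem[OF Tc'] using R'.alg_cl_mono[OF TB2] Bc' by blast
      thus False using ind'[OF b'] by blast
    qed
    have "b \<in> carrier R" "\<phi> b \<in> carrier R'" using b b' Bc Bc' by auto
    from corr_extend_transcendental[OF cM this tr tr'] obtain Q where Q: "corr R R' Q" "M \<subseteq> Q" "(b, \<phi> b) \<in> Q"
      "\<And>E. subfield E R \<Longrightarrow> fst ` M \<subseteq> E \<Longrightarrow> b \<in> E \<Longrightarrow> fst ` Q \<subseteq> E"
      "\<And>E. subfield E R' \<Longrightarrow> snd ` M \<subseteq> E \<Longrightarrow> \<phi> b \<in> E \<Longrightarrow> snd ` Q \<subseteq> E" by blast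
    have TQ: "T M \<subseteq> T Q" "b \<in> T Q" using Q(2,3) b unfolding T_def by auto
    have "fst ` Q \<subseteq> R.alg_cl (T Q)"
      by (rule Q(4)[OF R.subfield_alg_cl[OF Tc]])
         (use f R.alg_cl_mono[OF TQ(1) Tc] TQ(2) R.subset_alg_cl[OF Tc] in blast)+
    moreover have "snd ` Q \<subseteq> R'.alg_cl (\<phi> ` T Q)"
      by (rule Q(5)[OF R'.subfield_alg_cl[OF Tc']])
         (use s R'.alg_cl_mono[OF image_mono[OF TQ(1)] Tc'] TQ(2) R'.subset_alg_cl[OF Tc'] in blast)+
    ultimately have "Q \<in> \<A>" using Q(1) unfolding \<A>_def by blast
    from max[OF this Q(2)] TQ(2) nb show False by blast
  qed
  hence TM: "T M = B" using TB by blast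
  \<comment> \<open>Once the whole basis is matched the invariant holds trivially, because the
    closure of a basis is everything. \<open>M\<close> is therefore maximal among all
    correspondences, and algebraic extensions can be used without controlling their size.\<close>
  have maxB: "Q = M" if Q: "corr R R' Q" "M \<subseteq> Q" for Q
  proof (rule max[OF _ Q(2)])
    have "T M \<subseteq> T Q" using Q(2) unfolding T_def by blast
    hence TQ: "T Q = B" using TM TB by blast
    have "fst ` Q \<subseteq> carrier R" "snd ` Q \<subseteq> carrier R'" using corrD(1,2)[OF Q(1)] by auto
    thus "Q \<in> \<A>" using Q(1) by (simp add: \<A>_def TQ img cl cl')
  qed
  have BM: "B \<subseteq> fst ` M" and BM': "B' \<subseteq> snd ` M" using TM img unfolding T_def by force+
  have "a \<in> fst ` M" if a: "a \<in> carrier R" for a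
  proof -
    have "a \<in> R.alg_cl (fst ` M)" using a cl R.alg_cl_mono[OF BM subfieldE(3)[OF sub(1)]] by blast
    hence "(R.algebraic over fst ` M) a" unfolding R.alg_cl_def R.generate_field_subfield[OF sub(1)] by blast
    from corr_extend_algebraic[OF cM a this closed(2)] obtain Q where "corr R R' Q" "M \<subseteq> Q" "a \<in> fst ` Q" by blast
    with maxB show ?thesis by blast
  qed
  hence 1: "fst ` M = carrier R" using subfieldE(3)[OF sub(1)] by blast
  have "a \<in> snd ` M" if a: "a \<in> carrier R'" for a
  proof -
    have "a \<in> R'.alg_cl (snd ` M)" using a cl' R'.alg_cl_mono[OF BM' subfieldE(3)[OF sub(2)]] by blast
    hence "(R'.algebraic over snd ` M) a" unfolding R'.alg_cl_def R'.generate_field_subfield[OF sub(2)] by blast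
    from field_pair.corr_extend_algebraic[OF field_pair_swap corr_converse[OF cM] a this[folded swap] closed(1)]
    obtain Q where Q: "corr R' R Q" "M\<inverse> \<subseteq> Q" "a \<in> fst ` Q" by blast
    have "Q\<inverse> = M" by (rule maxB[OF corr_converse[OF Q(1)]]) (use Q(2) in auto)
    with Q(3) show ?thesis by force
  qed
  hence 2: "snd ` M = carrier R'" using subfieldE(3)[OF sub(2)] by blast
  show ?thesis by (rule corr_full_iso[OF cM 1 2])
qed

end

theorem ACF0_iso_iff:
  fixes T T' :: "nat set"
  assumes R: "ACF0_with_trdeg R T" and R': "ACF0_with_trdeg R' T'"
  shows "R \<simeq> R' \<longleftrightarrow> T \<approx> T'"
proof -
  interpret R: algebraically_closed R using R unfolding ACF0_with_trdeg_def by blast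
  interpret R': algebraically_closed R' using R' unfolding ACF0_with_trdeg_def by blast
  interpret field_pair R R' by unfold_locales
  show ?thesis
  proof
    assume "R \<simeq> R'"
    from has_trdeg_iso[OF R.field_axioms R'.field_axioms this, of T] R R'
    show "T \<approx> T'" using trdeg_unique[OF R'.field_axioms] unfolding ACF0_with_trdeg_def by blast
  next
    assume T: "T \<approx> T'"
    obtain B B' where B: "transcendence_basis R B" "B \<approx> T" "transcendence_basis R' B'" "B' \<approx> T'"
      using R R' unfolding ACF0_with_trdeg_def has_trdeg_def by blast
    have "B \<approx> B'" using B(2,4) T by (meson eqpoll_sym eqpoll_trans)
    then obtain \<phi> where "bij_betw \<phi> B B'" unfolding eqpoll_def by blast
    from steinitz[OF _ _ _ _ B(1,3) this] R R' show "R \<simeq> R'" unfolding ACF0_with_trdeg_def by blast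
  qed
qed

section \<open>The equivalence relation of algebraic fields\<close>

lemma ce_imp [comp]: assumes "dec P" "ce Q" shows "ce (\<lambda>x. P x \<longrightarrow> Q x)"
  unfolding imp_conv_disj by (intro comp dec_imp_ce[OF dec_not] assms)

lemma mem_pair_code: "x \<in> pair_code R \<longleftrightarrow> (pfst x, psnd x) \<in> R"
proof
  assume "(pfst x, psnd x) \<in> R"
  hence "prod_encode (pfst x, psnd x) \<in> pair_code R" unfolding pair_code_def by (rule imageI)
  thus "x \<in> pair_code R" by simp
qed (auto simp: pair_code_def)

lemma all_pair: "(\<forall>w. P (pfst w) (psnd w)) \<longleftrightarrow> (\<forall>a b. P a b)"
  using ex_pair[of "\<lambda>a b. \<not> P a b"] by blast

lemma all_list_decode: "(\<forall>a. P (list_decode a)) \<longleftrightarrow> (\<forall>as. P as)"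
  by (metis list_encode_inverse)

lemma ex_list_decode: "(\<exists>a. P (list_decode a)) \<longleftrightarrow> (\<exists>as. P as)"
  by (metis list_encode_inverse)

lemma computable1_rec: "computable1 f \<Longrightarrow> computable2 g \<Longrightarrow> computable1 (\<lambda>x. rec_nat a (\<lambda>k r. g r k) (f x))"
  by (rule computable1_compose[OF computable1_rec_nat_const])

section \<open>A computable sequence of primes\<close>

definition nth_prime :: "nat \<Rightarrow> nat" where
  "nth_prime = rec_nat 2 (\<lambda>k r. LEAST q. prime q \<and> r < q)"

lemma nth_prime_Suc: "prime (nth_prime (Suc n)) \<and> nth_prime n < nth_prime (Suc n)"
proof -
  have "\<exists>q. prime q \<and> nth_prime n < q" by (rule bigger_prime)
  from LeastI_ex[OF this] show ?thesis by (simp add: nth_prime_def)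
qed

lemma prime_nth_prime: "prime (nth_prime n)"
proof (cases n)
  case 0 thus ?thesis by (simp add: nth_prime_def two_is_prime_nat)
qed (use nth_prime_Suc in simp)

lemma inj_nth_prime: "inj nth_prime"
  by (rule strict_mono_imp_inj_on) (simp add: strict_mono_Suc_iff nth_prime_Suc)

lemma dec_prime: assumes "computable1 f" shows "dec (\<lambda>x. prime (f x))"
proof (rule dec_compose[OF _ assms])
  have "prime p \<longleftrightarrow> 1 < p \<and> (\<forall>m<Suc p. (\<exists>k<Suc p. p = m * k) \<longrightarrow> m = 1 \<or> m = p)" for p :: nat
  proof -
    have "m dvd p \<longleftrightarrow> m < Suc p \<and> (\<exists>k<Suc p. p = m * k)" if "1 < p" for m
    proof
      assume "m dvd p"
      then obtain k where k: "p = m * k" by (rule dvdE)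
      have "k dvd p" unfolding k by simp
      have "0 < p" using that by simp
      have "m < Suc p" "k < Suc p"
        using dvd_imp_le[OF \<open>m dvd p\<close> \<open>0 < p\<close>] dvd_imp_le[OF \<open>k dvd p\<close> \<open>0 < p\<close>] by linarith+
      thus "m < Suc p \<and> (\<exists>k<Suc p. p = m * k)" using k by blast
    qed auto
    thus ?thesis unfolding prime_nat_iff by blast
  qed
  moreover have "dec (\<lambda>p. 1 < p \<and> (\<forall>m<Suc p. (\<exists>k<Suc p. p = m * k) \<longrightarrow> m = 1 \<or> m = p))" by (intro comp)
  ultimately show "dec prime" by presburger
qed

lemma computable1_nth_prime: assumes "computable1 f" shows "computable1 (\<lambda>x. nth_prime (f x))"
proof -
  have "computable1 (\<lambda>r. LEAST q. prime q \<and> r < q)"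
    by (rule computable1_Least) (intro comp dec_prime, rule bigger_prime)
  hence "computable2 (\<lambda>r k. LEAST q. prime q \<and> r < q)" by (rule computable2_compose1[OF _ computable2_proj1])
  thus ?thesis unfolding nth_prime_def using assms by (intro computable1_rec)
qed

section \<open>Complexity of isomorphism between generated subfields\<close>

locale presented_Qbar =
  fixes K :: "nat ring"
  assumes presentation: "computable_presentation_of_Qbar K"
begin

sublocale algebraically_closed K
  using presentation unfolding computable_presentation_of_Qbar_def is_Qbar_def by blast

lemma carrier_K [simp]: "carrier K = UNIV"
  using presentation unfolding computable_presentation_of_Qbar_def by blast

lemma char0_K: "char0 K"
  using presentation unfolding computable_presentation_of_Qbar_def is_Qbar_def by blast

lemma algebraic_K: "\<forall>x\<in>carrier K. ring.algebraic K (prime_subfield K) x"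
  using presentation unfolding computable_presentation_of_Qbar_def is_Qbar_def by blast

lemma comp_ops [comp]:
  assumes "computable1 f" "computable1 g"
  shows "computable1 (\<lambda>x. f x \<oplus>\<^bsub>K\<^esub> g x)" "computable1 (\<lambda>x. f x \<otimes>\<^bsub>K\<^esub> g x)"
  using presentation assms unfolding computable_presentation_of_Qbar_def by (auto intro: computable1_compose2)

lemma subfield_gen: "subfield (generate_field K A) K"
  by (rule generate_field_is_subfield) simp

text \<open>Field generation as inference on pairs of an element and an index. Negatives and
  inverses are recognised by the equations they satisfy, since the presentation supplies only
  addition and multiplication as computable operations.\<close>

definition gen_step :: "nat \<Rightarrow> nat \<Rightarrow> bool" where
  "gen_step l t \<longleftrightarrow> pfst t = \<one>\<^bsub>K\<^esub> \<or> pfst t \<in> W (psnd t) \<or>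
     (\<exists>h. cmem (pair h (psnd t)) l \<and> h \<oplus>\<^bsub>K\<^esub> pfst t = \<zero>\<^bsub>K\<^esub>) \<or>
     (\<exists>h. cmem (pair h (psnd t)) l \<and> h \<otimes>\<^bsub>K\<^esub> pfst t = \<one>\<^bsub>K\<^esub>) \<or>
     (\<exists>h1 h2. cmem (pair h1 (psnd t)) l \<and> cmem (pair h2 (psnd t)) l \<and>
       (pfst t = h1 \<oplus>\<^bsub>K\<^esub> h2 \<or> pfst t = h1 \<otimes>\<^bsub>K\<^esub> h2))"

lemma gen_step_sound: "derivable gen_step t \<Longrightarrow> pfst t \<in> generate_field K (W (psnd t))"
proof (induction rule: derivable.induct)
  case (step l t)
  let ?F = "generate_field K (W (psnd t))"
  have IH: "h \<in> ?F" if "cmem (pair h (psnd t)) l" for h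
    using step.IH that unfolding cmem_iff by fastforce
  from step.hyps[unfolded gen_step_def] show ?case
  proof (elim disjE exE conjE)
    assume "pfst t = \<one>\<^bsub>K\<^esub>" thus ?thesis by (simp add: generate_field.one)
  next
    assume "pfst t \<in> W (psnd t)" thus ?thesis by (rule generate_field.incl)
  next
    fix h assume h: "cmem (pair h (psnd t)) l" "h \<oplus>\<^bsub>K\<^esub> pfst t = \<zero>\<^bsub>K\<^esub>"
    have "\<ominus>\<^bsub>K\<^esub> h = pfst t" using h(2) minus_equality[of "pfst t" h] a_comm[of h "pfst t"] by simp
    thus ?thesis using generate_field.a_inv[OF IH[OF h(1)]] by simp
  next
    fix h assume h: "cmem (pair h (psnd t)) l" "h \<otimes>\<^bsub>K\<^esub> pfst t = \<one>\<^bsub>K\<^esub>"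
    have "inv\<^bsub>K\<^esub> h = pfst t" using comm_inv_char[OF _ _ h(2)] by simp
    moreover have "h \<noteq> \<zero>\<^bsub>K\<^esub>" using h(2) by auto
    ultimately show ?thesis using generate_field.m_inv[OF IH[OF h(1)]] by simp
  next
    fix h1 h2 assume "cmem (pair h1 (psnd t)) l" "cmem (pair h2 (psnd t)) l" "pfst t = h1 \<oplus>\<^bsub>K\<^esub> h2"
    thus ?thesis using generate_field.eng_add[OF IH IH] by simp
  next
    fix h1 h2 assume "cmem (pair h1 (psnd t)) l" "cmem (pair h2 (psnd t)) l" "pfst t = h1 \<otimes>\<^bsub>K\<^esub> h2"
    thus ?thesis using generate_field.eng_mult[OF IH IH] by simp
  qed
qed

lemma gen_step_complete: "x \<in> generate_field K (W e) \<Longrightarrow> derivable gen_step (pair x e)"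
proof (induction rule: generate_field.induct)
  case one show ?case by (rule derivable.step[of 0]) (simp_all add: gen_step_def)
next
  case (incl h) thus ?case by (intro derivable.step[of 0]) (simp_all add: gen_step_def)
next
  case (a_inv h)
  have "gen_step (list_encode [pair h e]) (pair (\<ominus>\<^bsub>K\<^esub> h) e)"
    unfolding gen_step_def cmem_iff by (auto simp: r_neg simp del: list_encode.simps)
  with a_inv.IH show ?case by (intro derivable.step[of "list_encode [pair h e]"]) (simp_all del: list_encode.simps)
next
  case (m_inv h)
  have "h \<in> Units K" using m_inv.hyps field_Units by simp
  hence "gen_step (list_encode [pair h e]) (pair (inv\<^bsub>K\<^esub> h) e)"
    unfolding gen_step_def cmem_iff by (auto simp: Units_r_inv simp del: list_encode.simps)
  with m_inv.IH show ?case by (intro derivable.step[of "list_encode [pair h e]"]) (simp_all del: list_encode.simps)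
next
  case (eng_add h1 h2)
  have "gen_step (list_encode [pair h1 e, pair h2 e]) (pair (h1 \<oplus>\<^bsub>K\<^esub> h2) e)"
    unfolding gen_step_def cmem_iff by (auto simp del: list_encode.simps)
  with eng_add.IH show ?case by (intro derivable.step[of "list_encode [pair h1 e, pair h2 e]"]) (simp_all del: list_encode.simps)
next
  case (eng_mult h1 h2)
  have "gen_step (list_encode [pair h1 e, pair h2 e]) (pair (h1 \<otimes>\<^bsub>K\<^esub> h2) e)"
    unfolding gen_step_def cmem_iff by (auto simp del: list_encode.simps)
  with eng_mult.IH show ?case by (intro derivable.step[of "list_encode [pair h1 e, pair h2 e]"]) (simp_all del: list_encode.simps)
qed

lemma ce_gen: assumes "computable1 f" "computable1 g" shows "ce (\<lambda>x. f x \<in> generate_field K (W (g x)))"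
proof -
  have 1: "ce (\<lambda>p. gen_step (pfst p) (psnd p))" unfolding gen_step_def by (intro comp)
  have "derivable gen_step (pair x e) \<longleftrightarrow> x \<in> generate_field K (W e)" for x e
    using gen_step_sound[of "pair x e"] gen_step_complete[of x e] by auto
  with ce_derivable[OF 1 computable1_pair[OF assms]] show ?thesis by simp
qed

lemma F_alg_iff:
  "(i, j) \<in> F_alg K \<longleftrightarrow> diagram_embeds K (generate_field K (W i)) (generate_field K (W j)) \<and>
     diagram_embeds K (generate_field K (W j)) (generate_field K (W i))"
  unfolding F_alg_def subfield_W_def
  using subfield_iso_iff_diagrams[OF field_axioms algebraic_K subfield_gen subfield_gen] by simp

text \<open>That a tuple lies in the first subfield is a c.e. premise. Its enumeration witnesses are
  moved to the outer universal quantifier, where the failure of a given witness is decidable; what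
  remains, including the search for an image tuple, is c.e.\<close>

lemma diagram_embeds_Pi2:
  "\<exists>P. ce (\<lambda>q. P (pfst q) (pfst (psnd q)) (psnd (psnd q))) \<and>
    (\<forall>i j. diagram_embeds K (generate_field K (W i)) (generate_field K (W j)) \<longleftrightarrow> (\<forall>a. P a i j))"
proof -
  obtain Q where Q: "dec (\<lambda>p. Q (pfst p) (psnd p))" "\<And>y. pfst y \<in> generate_field K (W (psnd y)) \<longleftrightarrow> (\<exists>w. Q w y)"
    by (rule ceE[OF ce_gen[OF computable1_pfst_id computable1_psnd_id]]) blast
  have Q2: "y \<in> generate_field K (W i) \<longleftrightarrow> (\<exists>w. Q w (pair y i))" for y i using Q(2)[of "pair y i"] by simp
  define hom where "hom a b \<longleftrightarrow> (\<forall>i<clen a. cnth a i = \<one>\<^bsub>K\<^esub> \<longrightarrow> cnth b i = \<one>\<^bsub>K\<^esub>) \<and>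
     (\<forall>i<clen a. \<forall>j<clen a. \<forall>k<clen a.
        (cnth a i \<oplus>\<^bsub>K\<^esub> cnth a j = cnth a k \<longrightarrow> cnth b i \<oplus>\<^bsub>K\<^esub> cnth b j = cnth b k) \<and>
        (cnth a i \<otimes>\<^bsub>K\<^esub> cnth a j = cnth a k \<longrightarrow> cnth b i \<otimes>\<^bsub>K\<^esub> cnth b j = cnth b k))" for a b
  define P where "P c i j \<longleftrightarrow> (\<exists>k<clen (pfst c). \<not> Q (cnth (psnd c) k) (pair (cnth (pfst c) k) i)) \<or>
     (\<exists>b. clen b = clen (pfst c) \<and> (\<forall>k<clen b. cnth b k \<in> generate_field K (W j)) \<and> hom (pfst c) b)" for c i j
  have "ce (\<lambda>q. P (pfst q) (pfst (psnd q)) (psnd (psnd q)))"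
    unfolding P_def hom_def by (intro comp ce_gen dec_imp_ce[OF dec_not[OF dec_compose2[OF Q(1)]]])
  moreover have "diagram_embeds K (generate_field K (W i)) (generate_field K (W j)) \<longleftrightarrow> (\<forall>c. P c i j)" for i j
  proof -
    let ?E = "generate_field K (W i)" and ?F = "generate_field K (W j)"
    have inF: "set (list_decode b) \<subseteq> generate_field K (W e) \<longleftrightarrow> (\<forall>k<clen b. cnth b k \<in> generate_field K (W e))" for b e
      unfolding clen_def cnth_def by (auto simp: subset_iff in_set_conv_nth)
    have wit: "(\<forall>k<clen a. cnth a k \<in> ?E) \<longleftrightarrow> (\<exists>w. \<forall>k<clen a. Q (cnth w k) (pair (cnth a k) i))" for a
    proof
      assume "\<forall>k<clen a. cnth a k \<in> ?E"
      hence "\<forall>k. \<exists>w. k < clen a \<longrightarrow> Q w (pair (cnth a k) i)" unfolding Q2 by blast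
      then obtain w where "\<forall>k. k < clen a \<longrightarrow> Q (w k) (pair (cnth a k) i)" by metis
      thus "\<exists>w. \<forall>k<clen a. Q (cnth w k) (pair (cnth a k) i)"
        by (intro exI[of _ "list_encode (map w [0..<clen a])"]) auto
    qed (use Q2 in blast)
    have "diagram_embeds K ?E ?F \<longleftrightarrow> (\<forall>a. set (list_decode a) \<subseteq> ?E \<longrightarrow>
       (\<exists>b. length (list_decode b) = length (list_decode a) \<and> set (list_decode b) \<subseteq> ?F \<and> hom a b))"
    proof -
      have hom: "hom a b \<longleftrightarrow> (\<forall>i<length (list_decode a). list_decode a ! i = \<one>\<^bsub>K\<^esub> \<longrightarrow> list_decode b ! i = \<one>\<^bsub>K\<^esub>) \<and>
         (\<forall>i<length (list_decode a). \<forall>j<length (list_decode a). \<forall>k<length (list_decode a).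
        (list_decode a ! i \<oplus>\<^bsub>K\<^esub> list_decode a ! j = list_decode a ! k \<longrightarrow> list_decode b ! i \<oplus>\<^bsub>K\<^esub> list_decode b ! j = list_decode b ! k) \<and>
        (list_decode a ! i \<otimes>\<^bsub>K\<^esub> list_decode a ! j = list_decode a ! k \<longrightarrow> list_decode b ! i \<otimes>\<^bsub>K\<^esub> list_decode b ! j = list_decode b ! k))"
        if "length (list_decode b) = length (list_decode a)" for a b
        unfolding hom_def cnth_def clen_def using that by (simp cong: imp_cong)
      show ?thesis
        unfolding diagram_embeds_def all_list_decode[symmetric] ex_list_decode[symmetric]
        using hom by (simp cong: conj_cong)
    qed
    also have "\<dots> \<longleftrightarrow> (\<forall>a w. (\<exists>k<clen a. \<not> Q (cnth w k) (pair (cnth a k) i)) \<or>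
       (\<exists>b. clen b = clen a \<and> (\<forall>k<clen b. cnth b k \<in> ?F) \<and> hom a b))"
      unfolding inF wit unfolding clen_def by blast
    also have "\<dots> \<longleftrightarrow> (\<forall>c. P c i j)"
      unfolding P_def all_pair[of "\<lambda>a w. (\<exists>k<clen a. \<not> Q (cnth w k) (pair (cnth a k) i)) \<or>
       (\<exists>b. clen b = clen a \<and> (\<forall>k<clen b. cnth b k \<in> ?F) \<and> hom a b)"] ..
    finally show ?thesis .
  qed
  ultimately show ?thesis by blast
qed

lemma Pi2_F_alg: "Pi2_set (pair_code (F_alg K))"
proof -
  obtain P where P: "ce (\<lambda>q. P (pfst q) (pfst (psnd q)) (psnd (psnd q)))"
    "\<And>i j. diagram_embeds K (generate_field K (W i)) (generate_field K (W j)) \<longleftrightarrow> (\<forall>a. P a i j)"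
    using diagram_embeds_Pi2 by (elim exE conjE) blast
  have ceP: "ce (\<lambda>x. P (f x) (g x) (h x))" if "computable1 f" "computable1 g" "computable1 h" for f g h
    using ce_compose[OF P(1) computable1_pair[OF that(1) computable1_pair[OF that(2,3)]]] by simp
  show ?thesis
  proof (rule Pi2_setI)
    show "ce (\<lambda>p. P (pfst p) (pfst (psnd p)) (psnd (psnd p)) \<and> P (pfst p) (psnd (psnd p)) (pfst (psnd p)))"
      by (intro comp ceP)
    show "x \<in> pair_code (F_alg K) \<longleftrightarrow> (\<forall>a. P a (pfst x) (psnd x) \<and> P a (psnd x) (pfst x))" for x
      unfolding mem_pair_code F_alg_iff P(2) by blast
  qed
qed

lemma equiv_F_alg: "equiv UNIV (F_alg K)"
proof (rule equivI)
  show "refl (F_alg K)" unfolding F_alg_def by (auto intro!: refl_onI ring_iso_refl)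
  show "sym (F_alg K)" unfolding F_alg_def subfield_W_def
    by (auto intro!: symI ring_iso_sym subring_is_ring subfieldE(1)[OF subfield_gen])
  show "trans (F_alg K)" unfolding F_alg_def by (auto intro!: transI intro: ring_iso_trans)
qed simp

text \<open>Both hardness proofs use the fields only through this: equality of uniformly c.e. sets
  is turned into isomorphism.\<close>

lemma F_alg_reduction:
  assumes "ce (\<lambda>p. V (pfst p) (psnd p))"
  obtains g where "computable1 g" "inj g" "\<And>a b. (g a, g b) \<in> F_alg K \<longleftrightarrow> (\<forall>k. V k a \<longleftrightarrow> V k b)"
proof -
  define roots where "roots a = square_roots ((\<lambda>k. int (nth_prime k)) ` {k. V k a})" for a
  \<comment> \<open>The radicands are computed in the presentation by adding 1 repeatedly.\<close>
  have emb: "int_emb (int n) = rec_nat \<zero>\<^bsub>K\<^esub> (\<lambda>k r. r \<oplus>\<^bsub>K\<^esub> \<one>\<^bsub>K\<^esub>) n" for n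
    unfolding int_emb_nat by (induction n) auto
  have emb_comp: "computable1 (\<lambda>x. int_emb (int (nth_prime (f x))))" if "computable1 f" for f
    unfolding emb by (intro comp computable1_nth_prime that)
  have "ce (\<lambda>p. \<exists>k. V k (psnd p) \<and> pfst p \<otimes>\<^bsub>K\<^esub> pfst p = int_emb (int (nth_prime k)))"
    by (intro comp ce_compose2[OF assms] emb_comp)
  then obtain g where g: "computable1 g" "inj g" "\<And>a. W (g a) = {x. \<exists>k. V k a \<and> x \<otimes>\<^bsub>K\<^esub> x = int_emb (int (nth_prime k))}"
    by (rule ce_index) blast
  have W: "W (g a) = roots a" for a unfolding g(3) roots_def square_roots_def by auto
  have pr: "\<And>q a. q \<in> (\<lambda>k. int (nth_prime k)) ` {k. V k a} \<Longrightarrow> prime q"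
    using prime_nth_prime by auto
  have inj: "inj (\<lambda>k. int (nth_prime k))" using inj_nth_prime by (auto simp: inj_def)
  have "(g a, g b) \<in> F_alg K \<longleftrightarrow> {k. V k a} = {k. V k b}" for a b
  proof -
    have "(g a, g b) \<in> F_alg K \<longleftrightarrow>
        (\<lambda>k. int (nth_prime k)) ` {k. V k a} = (\<lambda>k. int (nth_prime k)) ` {k. V k b}"
      unfolding F_alg_def subfield_W_def W mem_Collect_eq prod.case roots_def
      by (rule sqrt_fields_iso_iff[OF algebraically_closed_axioms char0_K]) (erule pr)+
    thus ?thesis unfolding inj_image_eq_iff[OF inj] .
  qed
  hence "(g a, g b) \<in> F_alg K \<longleftrightarrow> (\<forall>k. V k a \<longleftrightarrow> V k b)" for a b by auto
  with g(1,2) show thesis by (rule that)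
qed

lemma Pi2_hard_F_alg: assumes "Pi2_set B" shows "one_reducible B (pair_code (F_alg K))"
proof -
  obtain P where P: "ce (\<lambda>p. P (pfst p) (psnd p))" "\<And>x. x \<in> B \<longleftrightarrow> (\<forall>a. P a x)"
    by (rule Pi2_setE[OF assms]) blast
  \<comment> \<open>Parameter 0 yields the full set and \<open>Suc x\<close> the set of true
    instances for \<open>x\<close>; the two agree exactly when \<open>x\<close> is in
    \<open>B\<close>.\<close>
  have "ce (\<lambda>p. psnd p = 0 \<or> P (pfst p) (psnd p - 1))" by (intro comp ce_compose2[OF P(1)])
  then obtain g where g: "computable1 g" "inj g" "\<And>a b. (g a, g b) \<in> F_alg K \<longleftrightarrow> (\<forall>k. (a = 0 \<or> P k (a - 1)) \<longleftrightarrow> (b = 0 \<or> P k (b - 1)))"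
    by (rule F_alg_reduction) blast
  show ?thesis
    unfolding one_reducible_def
  proof (intro exI[of _ "\<lambda>x. pair (g 0) (g (Suc x))"] conjI allI)
    show "inj (\<lambda>x. pair (g 0) (g (Suc x)))" using g(2) by (auto simp: inj_def)
    show "computable1 (\<lambda>x. pair (g 0) (g (Suc x)))" by (intro comp computable1_compose[OF g(1)])
    show "x \<in> B \<longleftrightarrow> pair (g 0) (g (Suc x)) \<in> pair_code (F_alg K)" for x
      unfolding mem_pair_code using g(3)[of 0 "Suc x"] P(2) by simp
  qed
qed

text \<open>Extends a path by one edge at its end. The goal is coded as source, target, level,
  number of nodes and list of nodes; only the target changes from premise to conclusion.\<close>

definition reach_step :: "(nat \<Rightarrow> nat \<Rightarrow> bool) \<Rightarrow> nat \<Rightarrow> nat \<Rightarrow> bool" where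
  "reach_step P l t \<longleftrightarrow> pfst t = pfst (psnd t) \<or>
    (\<exists>u. cmem (pair (pfst t) (pair u (psnd (psnd t)))) l \<and> u < pfst (psnd (psnd (psnd t))) \<and> pfst (psnd t) < pfst (psnd (psnd (psnd t))) \<and>
      (\<forall>a<pfst (psnd (psnd t)). P a (pair (cnth (psnd (psnd (psnd (psnd t)))) u) (cnth (psnd (psnd (psnd (psnd t)))) (pfst (psnd t))))))"

definition edges :: "(nat \<Rightarrow> nat \<Rightarrow> bool) \<Rightarrow> nat \<Rightarrow> nat \<Rightarrow> nat \<Rightarrow> (nat \<times> nat) set" where
  "edges P m n xs = {(u, v). u < n \<and> v < n \<and> (\<forall>a<m. P a (pair (cnth xs u) (cnth xs v)))}"

lemma reach_step_iff:
  "derivable (reach_step P) (pair i (pair j (pair m (pair n xs)))) \<longleftrightarrow> (i, j) \<in> (edges P m n xs)\<^sup>*"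
proof
  have "derivable (reach_step P) t \<Longrightarrow> \<forall>i j. t = pair i (pair j (pair m (pair n xs))) \<longrightarrow> (i, j) \<in> (edges P m n xs)\<^sup>*" for t
  proof (induction rule: derivable.induct)
    case (step l t)
    show ?case
    proof (intro allI impI)
      fix i j assume t: "t = pair i (pair j (pair m (pair n xs)))"
      from step.hyps[unfolded reach_step_def t] consider "i = j"
        | u where "cmem (pair i (pair u (pair m (pair n xs)))) l" "u < n" "j < n" "\<forall>a<m. P a (pair (cnth xs u) (cnth xs j))"
        by auto
      thus "(i, j) \<in> (edges P m n xs)\<^sup>*"
      proof cases
        case 2
        have "(i, u) \<in> (edges P m n xs)\<^sup>*" using step.IH 2(1) unfolding cmem_iff by blast
        moreover have "(u, j) \<in> edges P m n xs" using 2 unfolding edges_def by simp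
        ultimately show ?thesis by (rule rtrancl_into_rtrancl)
      qed simp
    qed
  qed
  thus "derivable (reach_step P) (pair i (pair j (pair m (pair n xs)))) \<Longrightarrow> (i, j) \<in> (edges P m n xs)\<^sup>*" by blast
next
  assume "(i, j) \<in> (edges P m n xs)\<^sup>*"
  thus "derivable (reach_step P) (pair i (pair j (pair m (pair n xs))))"
  proof (induction rule: rtrancl_induct)
    case base show ?case by (rule derivable.step[of 0]) (simp_all add: reach_step_def)
  next
    case (step u v)
    have "reach_step P (list_encode [pair i (pair u (pair m (pair n xs)))]) (pair i (pair v (pair m (pair n xs))))"
      unfolding reach_step_def cmem_iff using step.hyps(2) unfolding edges_def by (simp del: list_encode.simps)
    with step.IH show ?case by (intro derivable.step[of "list_encode [pair i (pair u (pair m (pair n xs)))]"]) (simp_all del: list_encode.simps)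
  qed
qed

text \<open>The edge sets decrease to the given equivalence relation on the finitely many nodes, so reachability at a
  high enough level is equivalence.\<close>
lemma Pi2_finitary: assumes R: "Pi2_eqrel R" shows "finitary_reducible R (F_alg K)"
proof -
  have eq: "equiv UNIV R" and "Pi2_set (pair_code R)" using R unfolding Pi2_eqrel_def by auto
  then obtain P where P: "ce (\<lambda>p. P (pfst p) (psnd p))" "\<And>x. x \<in> pair_code R \<longleftrightarrow> (\<forall>a. P a x)"
    by (elim Pi2_setE) blast
  have RP: "(x, y) \<in> R \<longleftrightarrow> (\<forall>a. P a (pair x y))" for x y using P(2)[of "pair x y"] unfolding mem_pair_code by simp
  \<comment> \<open>\<open>k\<close> codes a level and a target, \<open>t\<close> a source together
    with the whole instance, so the set attached to a node records what it reaches at every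
    level.\<close>
  define V where "V k t = derivable (reach_step P) (pair (pfst t) (pair (psnd k) (pair (pfst k) (psnd t))))" for k t
  have reach_ce: "ce (\<lambda>p. reach_step P (pfst p) (psnd p))" unfolding reach_step_def by (intro comp ce_compose2[OF P(1)])
  have "ce (\<lambda>p. V (pfst p) (psnd p))" unfolding V_def by (intro ce_derivable reach_ce comp)
  then obtain g where g: "computable1 g" "\<And>a b. (g a, g b) \<in> F_alg K \<longleftrightarrow> (\<forall>k. V k a \<longleftrightarrow> V k b)"
    by (rule F_alg_reduction) blast
  have "computable1 (\<lambda>p. list_encode (map (\<lambda>i. g (pair i p)) [0..<pfst p]))"
    by (intro comp computable1_compose[OF g(1)])
  hence "computable2 (\<lambda>n l. list_encode (map (\<lambda>i. g (pair i (pair n l))) [0..<n]))"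
    unfolding computable2_iff by simp
  then obtain c where c: "\<And>n l. rc_eval c [n, l] (list_encode (map (\<lambda>i. g (pair i (pair n l))) [0..<n]))"
    unfolding computable2_def by blast
  have main: "(g (pair i (pair n (list_encode xs))), g (pair j (pair n (list_encode xs)))) \<in> F_alg K \<longleftrightarrow> (xs ! i, xs ! j) \<in> R"
    if n: "length xs = n" and ij: "i < n" "j < n" for n xs i j
  proof -
    let ?E = "\<lambda>m. edges P m n (list_encode xs)"
    have E: "(u, v) \<in> ?E m \<longleftrightarrow> u < n \<and> v < n \<and> (\<forall>a<m. P a (pair (xs ! u) (xs ! v)))" for u v m
      unfolding edges_def using n by auto
    have "(\<forall>k. V k (pair i (pair n (list_encode xs))) \<longleftrightarrow> V k (pair j (pair n (list_encode xs))))
        \<longleftrightarrow> (\<forall>m v. (i, v) \<in> (?E m)\<^sup>* \<longleftrightarrow> (j, v) \<in> (?E m)\<^sup>*)"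
      unfolding V_def prod_encode_inverse fst_conv snd_conv reach_step_iff
      by (rule all_pair[of "\<lambda>m v. (i, v) \<in> (?E m)\<^sup>* \<longleftrightarrow> (j, v) \<in> (?E m)\<^sup>*"])
    also have "\<dots> \<longleftrightarrow> (xs ! i, xs ! j) \<in> R"
    proof
      assume reach: "\<forall>m v. (i, v) \<in> (?E m)\<^sup>* \<longleftrightarrow> (j, v) \<in> (?E m)\<^sup>*"
      have "\<forall>u v. \<exists>a. (xs ! u, xs ! v) \<notin> R \<longrightarrow> \<not> P a (pair (xs ! u) (xs ! v))" using RP by blast
      then obtain A where A: "\<And>u v. (xs ! u, xs ! v) \<notin> R \<Longrightarrow> \<not> P (A u v) (pair (xs ! u) (xs ! v))" by metis
      \<comment> \<open>\<open>M\<close> exceeds a refuting level for each inequivalent pair of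
        nodes, so an edge at level \<open>M\<close> joins equivalent nodes only.\<close>
      define M where "M = Suc (\<Sum>u<n. \<Sum>v<n. A u v)"
      have AM: "A u v < M" if "u < n" "v < n" for u v
      proof -
        have "A u v \<le> (\<Sum>v<n. A u v)" using that by (intro member_le_sum) auto
        also have "\<dots> \<le> (\<Sum>u<n. \<Sum>v<n. A u v)" using that by (intro member_le_sum[of u _ "\<lambda>u. \<Sum>v<n. A u v"]) auto
        finally show ?thesis unfolding M_def by simp
      qed
      have ER: "(xs ! u, xs ! v) \<in> R" if "(u, v) \<in> ?E M" for u v
        using that A AM unfolding E by blast
      \<comment> \<open>Node \<open>i\<close> reaches itself by the empty path, so \<open>j\<close>
        has to reach it as well.\<close>
      have "(j, i) \<in> (?E M)\<^sup>*" using reach by blast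
      hence "(xs ! j, xs ! i) \<in> R"
      proof (induction rule: rtrancl_induct)
        case base show ?case using eq by (auto simp: equiv_def refl_on_def)
      next
        case (step u v) thus ?case using ER[OF step.hyps(2)] eq by (auto simp: equiv_def dest: transD)
      qed
      thus "(xs ! i, xs ! j) \<in> R" using eq by (auto simp: equiv_def dest: symD)
    next
      assume ijR: "(xs ! i, xs ! j) \<in> R"
      hence jiR: "(xs ! j, xs ! i) \<in> R" using eq by (auto simp: equiv_def dest: symD)
      \<comment> \<open>Equivalent nodes have edges in both directions at every level, so whatever
        one of them reaches, the other reaches too.\<close>
      have "(i, j) \<in> ?E m" "(j, i) \<in> ?E m" for m using ijR jiR ij unfolding E RP by auto
      thus "\<forall>m v. (i, v) \<in> (?E m)\<^sup>* \<longleftrightarrow> (j, v) \<in> (?E m)\<^sup>*" by (meson converse_rtrancl_into_rtrancl)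
    qed
    finally show ?thesis unfolding g(2) .
  qed
  show ?thesis
    unfolding finitary_reducible_def
  proof (intro exI[of _ c] allI impI)
    fix n and xs :: "nat list" assume n: "length xs = n"
    show "\<exists>ys. rc_eval c [n, list_encode xs] (list_encode ys) \<and> length ys = n \<and>
             (\<forall>i j. i < j \<and> j < n \<longrightarrow> ((xs ! i, xs ! j) \<in> R \<longleftrightarrow> (ys ! i, ys ! j) \<in> F_alg K))"
      using c[of n "list_encode xs"] main[OF n]
      by (intro exI[of _ "map (\<lambda>i. g (pair i (pair n (list_encode xs)))) [0..<n]"]) auto
  qed
qed

end

section \<open>The equivalence relation of algebraically closed fields\<close>

definition cdistinct :: "nat \<Rightarrow> bool" where
  "cdistinct l \<longleftrightarrow> (\<forall>i<clen l. \<forall>j<i. cnth l i \<noteq> cnth l j)"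

lemma cdistinct_iff: "cdistinct l \<longleftrightarrow> distinct (list_decode l)"
proof -
  have "cdistinct l \<longleftrightarrow> (\<forall>i<clen l. \<forall>j<i. list_decode l ! i \<noteq> list_decode l ! j)"
    unfolding cdistinct_def by (intro iff_allI imp_cong refl) (simp add: cnth_def)
  also have "\<dots> \<longleftrightarrow> distinct (list_decode l)"
    unfolding distinct_conv_nth clen_def
  proof (intro iffI allI impI)
    fix i j
    assume *: "\<forall>i<length (list_decode l). \<forall>j<i. list_decode l ! i \<noteq> list_decode l ! j"
      and ij: "i < length (list_decode l)" "j < length (list_decode l)" "i \<noteq> j"
    show "list_decode l ! i \<noteq> list_decode l ! j"
    proof (cases "i < j")
      case True thus ?thesis using *[rule_format, of j i] ij by simp
    next
      case False thus ?thesis using *[rule_format, of i j] ij by simp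
    qed
  qed auto
  finally show ?thesis .
qed

lemma dec_cdistinct [comp]: assumes "computable1 f" shows "dec (\<lambda>x. cdistinct (f x))"
  by (rule dec_compose[OF _ assms]) (unfold cdistinct_def, intro comp)

lemma eqpoll_cong: assumes "A \<approx> A'" "B \<approx> B'" shows "A \<approx> B \<longleftrightarrow> A' \<approx> B'"
proof
  assume "A \<approx> B"
  show "A' \<approx> B'" by (rule eqpoll_trans[OF eqpoll_sym[OF assms(1)] eqpoll_trans[OF \<open>A \<approx> B\<close> assms(2)]])
next
  assume "A' \<approx> B'"
  show "A \<approx> B" by (rule eqpoll_trans[OF assms(1) eqpoll_trans[OF \<open>A' \<approx> B'\<close> eqpoll_sym[OF assms(2)]]])
qed

text \<open>A countable cardinality is determined by the finite sizes below it. This removes the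
  bijection, so that equinumerosity becomes an arithmetical statement.\<close>

lemma eqpoll_nat_iff:
  fixes A B :: "nat set"
  shows "A \<approx> B \<longleftrightarrow> (\<forall>n. (\<exists>D\<subseteq>A. finite D \<and> card D = n) \<longleftrightarrow> (\<exists>D\<subseteq>B. finite D \<and> card D = n))"
proof -
  have fin: "(\<exists>D\<subseteq>A. finite D \<and> card D = n) \<longleftrightarrow> n \<le> card A" if "finite A" for A :: "nat set" and n
  proof
    assume "n \<le> card A"
    then obtain D where D: "D \<subseteq> A" "card D = n" "finite D" by (rule obtain_subset_with_card_n)
    thus "\<exists>D\<subseteq>A. finite D \<and> card D = n" by blast
  qed (use card_mono[OF that] in auto)
  have inf: "\<exists>D\<subseteq>A. finite D \<and> card D = n" if "infinite A" for A :: "nat set" and n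
    using infinite_arbitrarily_large[OF that, of n] by blast
  consider "finite A" "finite B" | "infinite A" "infinite B" | "finite A" "infinite B" | "infinite A" "finite B" by blast
  thus ?thesis
  proof cases
    case 1
    have "(\<forall>n. n \<le> card A \<longleftrightarrow> n \<le> card B) \<longleftrightarrow> card A = card B" by (metis order_antisym order_refl)
    thus ?thesis unfolding eqpoll_iff_card[OF 1] using fin 1 by simp
  next
    case 2
    show ?thesis using infinite_nat_sets_eqpoll[OF 2] inf[OF 2(1)] inf[OF 2(2)] by simp
  next
    case 3
    have "\<not> A \<approx> B" using eqpoll_finite_iff[of A B] 3 by auto
    moreover have "\<not> (\<exists>D\<subseteq>A. finite D \<and> card D = Suc (card A))" unfolding fin[OF 3(1)] by simp
    ultimately show ?thesis using inf[OF 3(2), of "Suc (card A)"] by blast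
  next
    case 4
    have "\<not> A \<approx> B" using eqpoll_finite_iff[of A B] 4 by auto
    moreover have "\<not> (\<exists>D\<subseteq>B. finite D \<and> card D = Suc (card B))" unfolding fin[OF 4(2)] by simp
    ultimately show ?thesis using inf[OF 4(1), of "Suc (card B)"] by blast
  qed
qed

lemma finite_subset_list_code:
  fixes A :: "nat set"
  shows "(\<exists>D\<subseteq>A. finite D \<and> card D = n) \<longleftrightarrow> (\<exists>d. cdistinct d \<and> clen d = n \<and> (\<forall>k<clen d. cnth d k \<in> A))"
proof
  assume "\<exists>D\<subseteq>A. finite D \<and> card D = n"
  then obtain D where D: "D \<subseteq> A" "finite D" "card D = n" by blast
  obtain ds where ds: "set ds = D" "distinct ds" using finite_distinct_list[OF D(2)] by blast
  have "length ds = n" using distinct_card[OF ds(2)] ds(1) D(3) by simp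
  thus "\<exists>d. cdistinct d \<and> clen d = n \<and> (\<forall>k<clen d. cnth d k \<in> A)"
    using ds D(1) by (intro exI[of _ "list_encode ds"]) (auto simp: cdistinct_iff)
next
  assume "\<exists>d. cdistinct d \<and> clen d = n \<and> (\<forall>k<clen d. cnth d k \<in> A)"
  then obtain d where d: "cdistinct d" "clen d = n" "\<forall>k<clen d. cnth d k \<in> A" by blast
  have "set (list_decode d) \<subseteq> A" using d(3) unfolding clen_def cnth_def by (auto simp: in_set_conv_nth)
  moreover have "card (set (list_decode d)) = n" using d(1,2) unfolding cdistinct_iff clen_def by (rule distinct_card[THEN trans])
  ultimately show "\<exists>D\<subseteq>A. finite D \<and> card D = n" by blast
qed

text \<open>The existential witness of a \<open>\<Sigma>\<^sub>2\<close> statement is made unique by pairing it with the list of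
  least refutations of its predecessors.\<close>
lemma Sigma2_cardinality:
  assumes Q: "dec (\<lambda>q. Q (pfst q) (pfst (psnd q)) (pfst (psnd (psnd q))) (psnd (psnd (psnd q))))"
  obtains g where "computable1 g" "inj g" "\<And>p. UNIV - W (g p) \<approx> {n. \<exists>b. \<forall>d. Q n b d p}"
proof -
  have decQ: "dec (\<lambda>x. Q (f x) (g x) (h x) (k x))"
    if "computable1 f" "computable1 g" "computable1 h" "computable1 k" for f g h k
    using dec_compose[OF Q computable1_pair[OF that(1) computable1_pair[OF that(2) computable1_pair[OF that(3,4)]]]] by simp
  define least where "least n b t p \<longleftrightarrow> clen t = b \<and> (\<forall>c<b. \<not> Q n c (cnth t c) p \<and> (\<forall>d<cnth t c. Q n c d p))" for n b t p
  define V where "V z p \<longleftrightarrow> \<not> least (pfst z) (pfst (psnd z)) (psnd (psnd z)) p \<or> (\<exists>d. \<not> Q (pfst z) (pfst (psnd z)) d p)" for z p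
  have "dec (\<lambda>x. least (f x) (g x) (h x) (k x))"
    if "computable1 f" "computable1 g" "computable1 h" "computable1 k" for f g h k
    unfolding least_def
    by (intro comp decQ that computable1_compose[OF that(1)] computable1_compose[OF that(2)] computable1_compose[OF that(3)] computable1_compose[OF that(4)])
  hence least_dec: "dec (\<lambda>x. \<not> least (f x) (g x) (h x) (k x))"
    if "computable1 f" "computable1 g" "computable1 h" "computable1 k" for f g h k using that by (intro comp) blast
  have "ce (\<lambda>q. V (pfst q) (psnd q))" unfolding V_def by (intro comp dec_imp_ce[OF least_dec] dec_imp_ce[OF dec_not[OF decQ]])
  then obtain g where g: "computable1 g" "inj g" "\<And>p. W (g p) = {z. V z p}" by (rule ce_index) blast
  have "UNIV - W (g p) \<approx> {n. \<exists>b. \<forall>d. Q n b d p}" for p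
  proof -
    have W: "UNIV - W (g p) = {z. least (pfst z) (pfst (psnd z)) (psnd (psnd z)) p \<and> (\<forall>d. Q (pfst z) (pfst (psnd z)) d p)}"
      unfolding g(3) V_def by blast
    have uniq: "b = b' \<and> t = t'" if 1: "least n b t p" "\<forall>d. Q n b d p" and 2: "least n b' t' p" "\<forall>d. Q n b' d p" for n b t b' t'
    proof -
      have "\<not> b < b'" using 1(2) 2(1) unfolding least_def by blast
      moreover have "\<not> b' < b" using 2(2) 1(1) unfolding least_def by blast
      ultimately have b: "b = b'" by simp
      have l: "clen t = b" "clen t' = b" using 1(1) 2(1) b unfolding least_def by auto
      have "cnth t c = cnth t' c" if "c < b" for c
      proof -
        have "\<not> cnth t c < cnth t' c" using that 1(1) 2(1) b unfolding least_def by blast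
        moreover have "\<not> cnth t' c < cnth t c" using that 1(1) 2(1) b unfolding least_def by blast
        ultimately show ?thesis by simp
      qed
      hence "list_decode t = list_decode t'"
        using l unfolding clen_def cnth_def by (intro nth_equalityI) auto
      thus ?thesis using b by (simp only: list_decode_eq simp_thms)
    qed
    have ex: "\<exists>b t. least n b t p \<and> (\<forall>d. Q n b d p)" if "\<exists>b. \<forall>d. Q n b d p" for n
    proof -
      define b where "b = (LEAST b. \<forall>d. Q n b d p)"
      have b: "\<forall>d. Q n b d p" unfolding b_def by (rule LeastI_ex[OF that])
      have nb: "\<exists>d. \<not> Q n c d p" if "c < b" for c using not_less_Least[OF that[unfolded b_def]] by blast
      define t where "t = map (\<lambda>c. LEAST d. \<not> Q n c d p) [0..<b]"
      have "least n b (list_encode t) p"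
        unfolding least_def
      proof (intro conjI allI impI)
        fix c assume c: "c < b"
        have t: "cnth (list_encode t) c = (LEAST d. \<not> Q n c d p)" using c unfolding t_def by simp
        show "\<not> Q n c (cnth (list_encode t) c) p" unfolding t by (rule LeastI_ex[OF nb[OF c]])
        fix d assume "d < cnth (list_encode t) c"
        thus "Q n c d p" unfolding t using not_less_Least by blast
      qed (simp add: t_def)
      with b show ?thesis by blast
    qed
    have "bij_betw (\<lambda>z. pfst z) (UNIV - W (g p)) {n. \<exists>b. \<forall>d. Q n b d p}"
    proof (rule bij_betw_imageI)
      show "inj_on (\<lambda>z. pfst z) (UNIV - W (g p))"
      proof (rule inj_onI)
        fix z z' assume "z \<in> UNIV - W (g p)" "z' \<in> UNIV - W (g p)" and eq: "pfst z = pfst z'"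
        hence z: "least (pfst z) (pfst (psnd z)) (psnd (psnd z)) p" "\<forall>d. Q (pfst z) (pfst (psnd z)) d p"
          and z': "least (pfst z) (pfst (psnd z')) (psnd (psnd z')) p" "\<forall>d. Q (pfst z) (pfst (psnd z')) d p"
          unfolding W by auto
        have "psnd z = psnd z'" using uniq[OF z z'] by (metis prod.collapse prod_decode_eq)
        with eq show "z = z'" by (metis prod.collapse prod_decode_eq)
      qed
      show "(\<lambda>z. pfst z) ` (UNIV - W (g p)) = {n. \<exists>b. \<forall>d. Q n b d p}"
      proof (intro equalityI subsetI)
        fix n assume "n \<in> {n. \<exists>b. \<forall>d. Q n b d p}"
        then obtain b t where "least n b t p" "\<forall>d. Q n b d p" using ex by blast
        hence "pair n (pair b t) \<in> UNIV - W (g p)" unfolding W by simp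
        thus "n \<in> (\<lambda>z. pfst z) ` (UNIV - W (g p))" by (rule image_eqI[rotated]) simp
      qed (auto simp: W)
    qed
    thus ?thesis unfolding eqpoll_def by blast
  qed
  with g(1,2) show thesis by (rule that)
qed

section \<open>Bounds for isomorphism of algebraically closed fields\<close>

locale ACF_family =
  fixes L :: "nat \<Rightarrow> 'a ring"
  assumes trdeg: "\<And>e. ACF0_with_trdeg (L e) (UNIV - W e)"
begin

lemma F_AC_iff: "(i, j) \<in> F_AC L \<longleftrightarrow> UNIV - W i \<approx> UNIV - W j"
  unfolding F_AC_def using ACF0_iso_iff[OF trdeg trdeg] by simp

lemma equiv_F_AC: "equiv UNIV (F_AC L)"
proof (rule equivI)
  show "refl (F_AC L)" by (auto intro!: refl_onI simp: F_AC_iff)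
  show "sym (F_AC L)" by (auto intro!: symI intro: eqpoll_sym simp: F_AC_iff)
  show "trans (F_AC L)" by (auto intro!: transI intro: eqpoll_trans simp: F_AC_iff)
qed simp

lemma Pi3_F_AC: "Pi3_set (pair_code (F_AC L))"
proof -
  obtain Q where Q: "dec (\<lambda>p. Q (pfst p) (psnd p))" "\<And>y. pfst y \<in> W (psnd y) \<longleftrightarrow> (\<exists>w. Q w y)"
    by (rule ceE[OF ce_W[OF computable1_pfst_id computable1_psnd_id]]) blast
  have Q2: "y \<in> W i \<longleftrightarrow> (\<exists>w. Q w (pair y i))" for y i using Q(2)[of "pair y i"] by simp
  \<comment> \<open>Given a list \<open>a\<close>, either \<open>pfst b\<close> witnesses that an
    entry of \<open>a\<close> is enumerated into \<open>W i\<close>, or \<open>psnd b\<close> is a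
    repetition-free list of the same length outside \<open>W j\<close>. \<open>N\<close> is the
    failure of both, for repetition-free \<open>a\<close>, and it is c.e.\<close>
  define N where "N b a i j \<longleftrightarrow> cdistinct a \<and> (\<forall>k<clen a. \<not> Q (pfst b) (pair (cnth a k) i)) \<and>
     (cdistinct (psnd b) \<and> clen (psnd b) = clen a \<longrightarrow> (\<exists>k<clen (psnd b). cnth (psnd b) k \<in> W j))" for b a i j
  have Nce: "ce (\<lambda>x. N (f x) (g x) (h x) (k x))"
    if "computable1 f" "computable1 g" "computable1 h" "computable1 k" for f g h k
    unfolding N_def
    by (intro comp that dec_imp_ce[OF dec_cdistinct] dec_imp_ce[OF dec_ball] dec_compose2[OF Q(1)]
        computable1_compose[OF that(1)] computable1_compose[OF that(2)] computable1_compose[OF that(3)] computable1_compose[OF that(4)])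
  have half: "(\<forall>a. \<exists>b. \<not> N b a i j) \<longleftrightarrow>
      (\<forall>n. (\<exists>D\<subseteq>UNIV - W i. finite D \<and> card D = n) \<longrightarrow> (\<exists>D\<subseteq>UNIV - W j. finite D \<and> card D = n))" for i j
  proof -
    have "(\<forall>a. \<exists>b. \<not> N b a i j) \<longleftrightarrow> (\<forall>a. cdistinct a \<longrightarrow> (\<exists>k<clen a. cnth a k \<in> W i) \<or>
       (\<exists>d. cdistinct d \<and> clen d = clen a \<and> (\<forall>k<clen d. cnth d k \<notin> W j)))"
    proof (intro iff_allI)
      fix a
      have "(\<exists>b. \<not> N b a i j) \<longleftrightarrow> (\<exists>w d. cdistinct a \<longrightarrow> (\<exists>k<clen a. Q w (pair (cnth a k) i)) \<or>
          (cdistinct d \<and> clen d = clen a \<and> (\<forall>k<clen d. cnth d k \<notin> W j)))"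
        unfolding N_def ex_pair[symmetric, of "\<lambda>w d. cdistinct a \<longrightarrow> (\<exists>k<clen a. Q w (pair (cnth a k) i)) \<or>
          (cdistinct d \<and> clen d = clen a \<and> (\<forall>k<clen d. cnth d k \<notin> W j))"]
        by (intro iff_exI) blast
      also have "\<dots> \<longleftrightarrow> (cdistinct a \<longrightarrow> (\<exists>k<clen a. cnth a k \<in> W i) \<or>
          (\<exists>d. cdistinct d \<and> clen d = clen a \<and> (\<forall>k<clen d. cnth d k \<notin> W j)))"
        unfolding Q2[of _ i] by blast
      finally show "(\<exists>b. \<not> N b a i j) \<longleftrightarrow> (cdistinct a \<longrightarrow> (\<exists>k<clen a. cnth a k \<in> W i) \<or>
          (\<exists>d. cdistinct d \<and> clen d = clen a \<and> (\<forall>k<clen d. cnth d k \<notin> W j)))" .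
    qed
    also have "\<dots> \<longleftrightarrow> (\<forall>n. (\<exists>a. cdistinct a \<and> clen a = n \<and> (\<forall>k<clen a. cnth a k \<in> UNIV - W i)) \<longrightarrow>
       (\<exists>d. cdistinct d \<and> clen d = n \<and> (\<forall>k<clen d. cnth d k \<in> UNIV - W j)))"
    proof -
      have "(\<forall>a. cdistinct a \<longrightarrow> (\<exists>k<clen a. cnth a k \<in> W i) \<or> D (clen a)) \<longleftrightarrow>
        (\<forall>n. (\<exists>a. cdistinct a \<and> clen a = n \<and> (\<forall>k<clen a. cnth a k \<notin> W i)) \<longrightarrow> D n)" for D :: "nat \<Rightarrow> bool"
        by blast
      from this[of "\<lambda>n. \<exists>d. cdistinct d \<and> clen d = n \<and> (\<forall>k<clen d. cnth d k \<notin> W j)"] show ?thesis by simp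
    qed
    finally show ?thesis unfolding finite_subset_list_code .
  qed
  show ?thesis
  proof (rule Pi3_setI)
    \<comment> \<open>The two directions share \<open>a\<close> but have independent witnesses, so
      \<open>b\<close> is a pair of them.\<close>
    show "ce (\<lambda>q. N (pfst (pfst q)) (pfst (psnd q)) (pfst (psnd (psnd q))) (psnd (psnd (psnd q))) \<or>
       N (psnd (pfst q)) (pfst (psnd q)) (psnd (psnd (psnd q))) (pfst (psnd (psnd q))))"
      by (intro comp Nce)
    show "x \<in> pair_code (F_AC L) \<longleftrightarrow> (\<forall>a. \<exists>b. \<not> (N (pfst b) a (pfst x) (psnd x) \<or> N (psnd b) a (psnd x) (pfst x)))" for x
    proof -
      have "(\<forall>a. \<exists>b. \<not> (N (pfst b) a i j \<or> N (psnd b) a j i)) \<longleftrightarrow> (\<forall>a. \<exists>b. \<not> N b a i j) \<and> (\<forall>a. \<exists>b. \<not> N b a j i)" for i j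
      proof -
        have "(\<exists>b. \<not> (N (pfst b) a i j \<or> N (psnd b) a j i)) \<longleftrightarrow> (\<exists>b. \<not> N b a i j) \<and> (\<exists>b. \<not> N b a j i)" for a
          unfolding ex_pair[of "\<lambda>b c. \<not> (N b a i j \<or> N c a j i)"] by blast
        thus ?thesis by (simp only: all_conj_distrib)
      qed
      thus ?thesis unfolding mem_pair_code F_AC_iff eqpoll_nat_iff by (simp only: half) blast
    qed
  qed
qed

text \<open>The numbers \<open>n\<close> for which all instances up to \<open>n\<close> hold form an
  initial segment, which is infinite exactly when \<open>x\<close> belongs to \<open>B\<close>.
  Index \<open>g 0\<close> supplies an infinite complement for comparison.\<close>

lemma Pi3_hard_F_AC: assumes "Pi3_set B" shows "one_reducible B (pair_code (F_AC L))"
proof -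
  obtain P where P: "dec (\<lambda>q. P (pfst q) (pfst (psnd q)) (pfst (psnd (psnd q))) (psnd (psnd (psnd q))))"
    "\<And>x. x \<in> B \<longleftrightarrow> (\<forall>a. \<exists>b. \<forall>d. P x a b d)"
    by (rule Pi3_setE[OF assms]) blast
  have decP: "dec (\<lambda>x. P (f x) (g x) (h x) (k x))"
    if "computable1 f" "computable1 g" "computable1 h" "computable1 k" for f g h k
    using dec_compose[OF P(1) computable1_pair[OF that(1) computable1_pair[OF that(2) computable1_pair[OF that(3,4)]]]] by simp
  \<comment> \<open>For \<open>p = Suc x\<close> the witnesses of all instances up to
    \<open>n\<close> are collected in one list \<open>b\<close>, which keeps the condition Sigma2;
    \<open>p = 0\<close> gives the full set.\<close>
  define Q where "Q n b d p \<longleftrightarrow> p = 0 \<or> (\<forall>a<Suc n. P (p - 1) a (cnth b a) d)" for n b d p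
  have "dec (\<lambda>q. Q (pfst q) (pfst (psnd q)) (pfst (psnd (psnd q))) (psnd (psnd (psnd q))))"
    unfolding Q_def by (intro comp decP)
  then obtain g where g: "computable1 g" "inj g" "\<And>p. UNIV - W (g p) \<approx> {n. \<exists>b. \<forall>d. Q n b d p}"
    by (rule Sigma2_cardinality) blast
  have Q: "(\<exists>b. \<forall>d. Q n b d (Suc x)) \<longleftrightarrow> (\<forall>a\<le>n. \<exists>b. \<forall>d. P x a b d)" for n x
  proof
    assume "\<forall>a\<le>n. \<exists>b. \<forall>d. P x a b d"
    hence "\<forall>a. \<exists>b. a \<le> n \<longrightarrow> (\<forall>d. P x a b d)" by blast
    then obtain b where "\<forall>a. a \<le> n \<longrightarrow> (\<forall>d. P x a (b a) d)" by metis
    thus "\<exists>b. \<forall>d. Q n b d (Suc x)" unfolding Q_def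
      by (intro exI[of _ "list_encode (map b [0..<Suc n])"]) (auto simp del: upt_Suc list_encode.simps)
  qed (auto simp: Q_def less_Suc_eq_le)
  have key: "(g 0, g (Suc x)) \<in> F_AC L \<longleftrightarrow> x \<in> B" for x
  proof -
    let ?T = "{n. \<exists>b. \<forall>d. Q n b d (Suc x)}"
    have "UNIV - W (g 0) \<approx> (UNIV :: nat set)" using g(3)[of 0] unfolding Q_def by simp
    from eqpoll_cong[OF this g(3)[of "Suc x"]]
    have "(g 0, g (Suc x)) \<in> F_AC L \<longleftrightarrow> (UNIV :: nat set) \<approx> ?T" unfolding F_AC_iff .
    also have "\<dots> \<longleftrightarrow> x \<in> B"
    proof
      assume "x \<in> B"
      hence "?T = UNIV" unfolding Q P(2) by simp
      thus "(UNIV :: nat set) \<approx> ?T" by simp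
    next
      assume T: "(UNIV :: nat set) \<approx> ?T"
      show "x \<in> B"
      proof (rule ccontr)
        assume "x \<notin> B"
        then obtain a where "\<not> (\<exists>b. \<forall>d. P x a b d)" unfolding P(2) by blast
        hence "n < a" if "n \<in> ?T" for n using that unfolding mem_Collect_eq Q by (meson not_le)
        hence "?T \<subseteq> {..<a}" by blast
        hence "finite ?T" by (rule finite_subset) simp
        thus False using eqpoll_finite_iff[OF T] by simp
      qed
    qed
    finally show ?thesis .
  qed
  show ?thesis
    unfolding one_reducible_def
  proof (intro exI[of _ "\<lambda>x. pair (g 0) (g (Suc x))"] conjI allI)
    show "inj (\<lambda>x. pair (g 0) (g (Suc x)))" using g(2) by (auto simp: inj_def)
    show "computable1 (\<lambda>x. pair (g 0) (g (Suc x)))" by (intro comp computable1_compose[OF g(1)])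
    show "x \<in> B \<longleftrightarrow> pair (g 0) (g (Suc x)) \<in> pair_code (F_AC L)" for x
      unfolding mem_pair_code using key[of x] by simp
  qed
qed

text \<open>Three nodes carry at most one nontrivial class. The complement built for a node is infinite if the node
  lies in that class, and otherwise finite of a size that determines the node modulo 3.\<close>
lemma Pi3_ternary: assumes R: "Pi3_eqrel R" shows "nary_reducible 3 R (F_AC L)"
proof -
  have eq: "equiv UNIV R" and "Pi3_set (pair_code R)" using R unfolding Pi3_eqrel_def by auto
  then obtain P where P: "dec (\<lambda>q. P (pfst q) (pfst (psnd q)) (pfst (psnd (psnd q))) (psnd (psnd (psnd q))))"
    "\<And>x. x \<in> pair_code R \<longleftrightarrow> (\<forall>a. \<exists>b. \<forall>d. P x a b d)"
    by (elim Pi3_setE) blast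
  have decP: "dec (\<lambda>x. P (f x) (g x) (h x) (k x))"
    if "computable1 f" "computable1 g" "computable1 h" "computable1 k" for f g h k
    using dec_compose[OF P(1) computable1_pair[OF that(1) computable1_pair[OF that(2) computable1_pair[OF that(3,4)]]]] by simp
  have RP: "(x, y) \<in> R \<longleftrightarrow> (\<forall>a. \<exists>b. \<forall>d. P (pair x y) a b d)" for x y using P(2)[of "pair x y"] unfolding mem_pair_code by simp
  have Rsym: "(x, y) \<in> R \<Longrightarrow> (y, x) \<in> R" for x y using eq by (auto simp: equiv_def dest: symD)
  have Rtrans: "(x, y) \<in> R \<Longrightarrow> (y, z) \<in> R \<Longrightarrow> (x, z) \<in> R" for x y z using eq by (auto simp: equiv_def dest: transD)
  \<comment> \<open>Parameter \<open>p\<close> is a node number \<open>i\<close> with the tuple; the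
    witness \<open>b\<close> is a level \<open>k\<close>, another node \<open>j\<close> and a list
    of \<open>k\<close> witnesses. The bound \<open>3 * k + i\<close> grows with the level up to
    which \<open>i\<close> and \<open>j\<close> look equivalent and stays congruent to
    \<open>i\<close> modulo 3.\<close>
  define Q where "Q n b d p \<longleftrightarrow> n < pfst p \<or> (pfst (psnd b) < 3 \<and> pfst (psnd b) \<noteq> pfst p \<and> n < 3 * pfst b + pfst p \<and>
     (\<forall>a<pfst b. P (pair (cnth (psnd p) (pfst p)) (cnth (psnd p) (pfst (psnd b)))) a (cnth (psnd (psnd b)) a) d))" for n b d p
  have "dec (\<lambda>q. Q (pfst q) (pfst (psnd q)) (pfst (psnd (psnd q))) (psnd (psnd (psnd q))))"
    unfolding Q_def by (intro comp decP)
  then obtain g where g: "computable1 g" "inj g" "\<And>p. UNIV - W (g p) \<approx> {n. \<exists>b. \<forall>d. Q n b d p}"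
    by (rule Sigma2_cardinality) blast
  define level where "level x y k \<longleftrightarrow> (\<forall>a<k. \<exists>b. \<forall>d. P (pair x y) a b d)" for x y k
  define T where "T xs i = {n. n < i \<or> (\<exists>k j. j < 3 \<and> j \<noteq> i \<and> n < 3 * k + i \<and> level (xs ! i) (xs ! j) k)}" for xs :: "nat list" and i
  have T: "{n. \<exists>b. \<forall>d. Q n b d (pair i (list_encode xs))} = T xs i" if xs: "length xs = 3" and i: "i < 3" for xs i
  proof -
    have "(\<exists>b. \<forall>d. Q n b d (pair i (list_encode xs))) \<longleftrightarrow> n < i \<or>
        (\<exists>k j. j < 3 \<and> j \<noteq> i \<and> n < 3 * k + i \<and> level (xs ! i) (xs ! j) k)" for n
    proof
      assume "\<exists>b. \<forall>d. Q n b d (pair i (list_encode xs))"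
      then obtain b where b: "\<And>d. Q n b d (pair i (list_encode xs))" by blast
      show "n < i \<or> (\<exists>k j. j < 3 \<and> j \<noteq> i \<and> n < 3 * k + i \<and> level (xs ! i) (xs ! j) k)"
      proof (cases "n < i")
        case False
        have b': "pfst (psnd b) < 3 \<and> pfst (psnd b) \<noteq> i \<and> n < 3 * pfst b + i \<and>
          (\<forall>a<pfst b. P (pair (cnth (list_encode xs) i) (cnth (list_encode xs) (pfst (psnd b)))) a (cnth (psnd (psnd b)) a) d)" for d
          using b[of d] False unfolding Q_def prod_encode_inverse fst_conv snd_conv by blast
        have j: "pfst (psnd b) < 3" "pfst (psnd b) \<noteq> i" "n < 3 * pfst b + i" using b'[of 0] by auto
        have "cnth (list_encode xs) i = xs ! i" "cnth (list_encode xs) (pfst (psnd b)) = xs ! pfst (psnd b)"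
          using j(1) xs i by simp_all
        with b' have "level (xs ! i) (xs ! pfst (psnd b)) (pfst b)" unfolding level_def by auto
        with j show ?thesis by blast
      qed simp
    next
      assume "n < i \<or> (\<exists>k j. j < 3 \<and> j \<noteq> i \<and> n < 3 * k + i \<and> level (xs ! i) (xs ! j) k)"
      thus "\<exists>b. \<forall>d. Q n b d (pair i (list_encode xs))"
      proof (elim disjE exE conjE)
        assume "n < i" thus ?thesis unfolding Q_def by simp
      next
        fix k j assume kj: "j < 3" "j \<noteq> i" "n < 3 * k + i" "level (xs ! i) (xs ! j) k"
        have "\<forall>a. \<exists>b. a < k \<longrightarrow> (\<forall>d. P (pair (xs ! i) (xs ! j)) a b d)" using kj(4) unfolding level_def by blast
        then obtain b where "\<forall>a. a < k \<longrightarrow> (\<forall>d. P (pair (xs ! i) (xs ! j)) a (b a) d)" by metis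
        thus ?thesis using kj(1-3) xs i unfolding Q_def
          by (intro exI[of _ "pair k (pair j (list_encode (map b [0..<k])))"]) simp
      qed
    qed
    thus ?thesis unfolding T_def by blast
  qed
  have T_UNIV: "T xs i = UNIV" if j: "j < 3" "j \<noteq> i" "(xs ! i, xs ! j) \<in> R" for xs i j
  proof -
    have "level (xs ! i) (xs ! j) k" for k using j(3) unfolding RP level_def by blast
    moreover have "n < 3 * Suc n + i" for n by simp
    ultimately show ?thesis unfolding T_def using j(1,2) by blast
  qed
  have T_fin: "\<exists>M. T xs i = {..<3 * M + i}" if i: "i < 3" and no: "\<And>j. j < 3 \<Longrightarrow> j \<noteq> i \<Longrightarrow> (xs ! i, xs ! j) \<notin> R" for xs i
  proof -
    define ks where "ks = {k. \<exists>j<3. j \<noteq> i \<and> level (xs ! i) (xs ! j) k}"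
    have "\<exists>a. \<forall>k. level (xs ! i) (xs ! j) k \<longrightarrow> k \<le> a" if jj: "j < 3" "j \<noteq> i" for j
    proof -
      obtain a where "\<not> (\<exists>b. \<forall>d. P (pair (xs ! i) (xs ! j)) a b d)" using no[OF jj] unfolding RP by blast
      hence "k \<le> a" if "level (xs ! i) (xs ! j) k" for k using that unfolding level_def by (metis not_le)
      thus ?thesis by blast
    qed
    hence "\<forall>j. \<exists>a. j < 3 \<and> j \<noteq> i \<longrightarrow> (\<forall>k. level (xs ! i) (xs ! j) k \<longrightarrow> k \<le> a)" by blast
    then obtain a where a: "\<And>j k. j < 3 \<Longrightarrow> j \<noteq> i \<Longrightarrow> level (xs ! i) (xs ! j) k \<Longrightarrow> k \<le> a j" by metis
    have "ks \<subseteq> (\<Union>j<3. {..a j})" unfolding ks_def using a by auto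
    hence fin: "finite ks" by (rule finite_subset) simp
    \<comment> \<open>Level 0 holds vacuously between \<open>i\<close> and any other node, so
      \<open>ks\<close> is nonempty and has a maximum.\<close>
    have "\<exists>j<3. j \<noteq> i" by (rule exI[of _ "if i = 0 then 1 else 0"]) simp
    hence "0 \<in> ks" unfolding ks_def level_def by simp
    hence ne: "ks \<noteq> {}" by blast
    have "T xs i = {..<3 * Max ks + i}"
    proof (intro equalityI subsetI)
      fix n assume "n \<in> T xs i"
      then consider "n < i" | k where "k \<in> ks" "n < 3 * k + i" unfolding T_def ks_def by blast
      thus "n \<in> {..<3 * Max ks + i}"
      proof cases
        case 2
        have "k \<le> Max ks" by (rule Max_ge[OF fin 2(1)])
        with 2(2) show ?thesis by simp
      qed simp
    next
      fix n assume "n \<in> {..<3 * Max ks + i}"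
      moreover have "Max ks \<in> ks" by (rule Max_in[OF fin ne])
      ultimately show "n \<in> T xs i" unfolding T_def ks_def by auto
    qed
    thus ?thesis by blast
  qed
  have main: "(xs ! i, xs ! j) \<in> R \<longleftrightarrow> T xs i \<approx> T xs j" if ij: "i < j" "j < 3" for xs i j
  proof
    assume r: "(xs ! i, xs ! j) \<in> R"
    have "T xs i = UNIV" "T xs j = UNIV" using T_UNIV[of j i xs] T_UNIV[of i j xs] r Rsym[OF r] ij by auto
    thus "T xs i \<approx> T xs j" by simp
  next
    assume e: "T xs i \<approx> T xs j"
    show "(xs ! i, xs ! j) \<in> R"
    proof (cases "\<exists>u<3. u \<noteq> i \<and> (xs ! i, xs ! u) \<in> R")
      case True
      then obtain u where u: "u < 3" "u \<noteq> i" "(xs ! i, xs ! u) \<in> R" by blast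
      have "infinite (T xs j)" using T_UNIV[OF u] e eqpoll_finite_iff by fastforce
      hence "\<exists>v<3. v \<noteq> j \<and> (xs ! j, xs ! v) \<in> R" using T_fin[OF ij(2), of xs] by fastforce
      then obtain v where v: "v < 3" "v \<noteq> j" "(xs ! j, xs ! v) \<in> R" by blast
      \<comment> \<open>With three nodes, if neither partner is the other node of the pair, both
        partners are the third node.\<close>
      have "u = j \<or> v = i \<or> u = v" using u v ij by linarith
      thus ?thesis
      proof (elim disjE)
        assume "u = v" thus ?thesis using Rtrans[OF u(3)] Rsym[OF v(3)] by simp
      qed (use u v Rsym in auto)
    next
      case False
      then obtain M where M: "T xs i = {..<3 * M + i}" using T_fin[of i xs] ij by auto
      hence "finite (T xs j)" using e eqpoll_finite_iff by fastforce
      hence "\<not> (\<exists>v<3. v \<noteq> j \<and> (xs ! j, xs ! v) \<in> R)" using T_UNIV[of _ j xs] by fastforce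
      then obtain M' where M': "T xs j = {..<3 * M' + j}" using T_fin[of j xs] ij by auto
      have "card (T xs i) = card (T xs j)" using e M M' by (simp add: eqpoll_iff_card)
      hence "3 * M + i = 3 * M' + j" unfolding M M' by simp
      hence False using ij by presburger
      thus ?thesis ..
    qed
  qed
  have F: "(g (pair i (list_encode xs)), g (pair j (list_encode xs))) \<in> F_AC L \<longleftrightarrow> (xs ! i, xs ! j) \<in> R"
    if xs: "length xs = 3" and ij: "i < j" "j < 3" for xs i j
  proof -
    have i: "i < 3" using ij by simp
    show ?thesis unfolding F_AC_iff main[OF ij] T[OF xs i, symmetric] T[OF xs ij(2), symmetric]
      by (rule eqpoll_cong[OF g(3) g(3)])
  qed
  have "computable1 (\<lambda>l. list_encode (map (\<lambda>i. g (pair i l)) [0..<3]))"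
    by (intro comp computable1_compose[OF g(1)])
  then obtain c where c: "\<And>l. rc_eval c [l] (list_encode (map (\<lambda>i. g (pair i l)) [0..<3]))"
    unfolding computable1_def by blast
  show ?thesis
    unfolding nary_reducible_def
  proof (intro exI[of _ c] allI impI)
    fix xs :: "nat list" assume xs: "length xs = 3"
    have nth: "map (\<lambda>i. g (pair i (list_encode xs))) [0..<3] ! i = g (pair i (list_encode xs))" if "i < 3" for i
      using that by simp
    show "\<exists>ys. rc_eval c [list_encode xs] (list_encode ys) \<and> length ys = 3 \<and>
             (\<forall>i j. i < j \<and> j < 3 \<longrightarrow> ((xs ! i, xs ! j) \<in> R \<longleftrightarrow> (ys ! i, ys ! j) \<in> F_AC L))"
      using c[of "list_encode xs"] F[OF xs]
      by (intro exI[of _ "map (\<lambda>i. g (pair i (list_encode xs))) [0..<3]"] conjI allI impI)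
         (simp_all add: nth del: upt_rec_numeral)
  qed
qed

end

section \<open>A relation against all 4-ary reductions\<close>

definition block :: "nat \<Rightarrow> nat list" where "block e = [4 * e, 4 * e + 1, 4 * e + 2, 4 * e + 3]"

text \<open>Program \<open>e\<close>, run on its block, fails at pair \<open>p\<close> of that block: it outputs two sets whose
  complements have the same finite cardinality.\<close>
definition finite_match :: "nat \<Rightarrow> bool" where
  "finite_match p \<longleftrightarrow> (\<exists>v. rc_eval (rc_decode (p div 2)) [list_encode (block (p div 2))] v \<and>
     finite (UNIV - W (cnth v (2 * (p mod 2)))) \<and>
     UNIV - W (cnth v (2 * (p mod 2))) \<approx> UNIV - W (cnth v (Suc (2 * (p mod 2)))))"

text \<open>The numbers fall into pairs \<open>2 * p\<close>, \<open>Suc (2 * p)\<close>, and pair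
  \<open>p\<close> belongs to program \<open>p div 2\<close>; a block of four thus consists of two
  pairs that are never equivalent to each other. The members of a pair are equivalent by default and
  are separated by a finite match.\<close>

definition diagonal :: "(nat \<times> nat) set" where
  "diagonal = {(x, y). x = y \<or> (x div 2 = y div 2 \<and> \<not> finite_match (x div 2))}"

lemma equiv_diagonal: "equiv UNIV diagonal"
proof (rule equivI)
  show "refl diagonal" by (auto simp: diagonal_def intro!: refl_onI)
  show "sym diagonal" by (auto simp: diagonal_def intro!: symI)
  show "trans diagonal" by (auto simp: diagonal_def intro!: transI)
qed simp

lemma computable1_div2: assumes "computable1 f" shows "computable1 (\<lambda>x. f x div 2)"
proof (rule computable1_compose[OF _ assms])
  have "n div 2 = (LEAST k. n < 2 * k + 2)" for n :: nat
    by (rule Least_equality[symmetric]) auto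
  moreover have "computable1 (\<lambda>n. LEAST k. n < 2 * k + 2)"
  proof (rule computable1_Least)
    show "dec (\<lambda>p. psnd p < 2 * pfst p + 2)" by (intro comp)
    show "\<exists>k. n < 2 * k + 2" for n :: nat by (rule exI[of _ n]) simp
  qed
  ultimately show "computable1 (\<lambda>n. n div 2)" by presburger
qed

lemma computable1_mod2: assumes "computable1 f" shows "computable1 (\<lambda>x. f x mod 2)"
proof -
  have "n mod 2 = n - 2 * (n div 2)" for n :: nat by (simp add: minus_mult_div_eq_mod)
  thus ?thesis using computable1_diff[OF assms computable1_mult[OF computable1_const computable1_div2[OF assms]]] by simp
qed

lemma Pi3_diagonal: "Pi3_set (pair_code diagonal)"
proof -
  obtain Q where Q: "dec (\<lambda>p. Q (pfst p) (psnd p))" "\<And>y. pfst y \<in> W (psnd y) \<longleftrightarrow> (\<exists>w. Q w y)"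
    by (rule ceE[OF ce_W[OF computable1_pfst_id computable1_psnd_id]]) blast
  have Q2: "y \<in> W i \<longleftrightarrow> (\<exists>w. Q w (pair y i))" for y i using Q(2)[of "pair y i"] by simp
  define out where "out v p \<longleftrightarrow> rc_eval (rc_decode (p div 2)) (list_decode (ccons (list_encode (block (p div 2))) 0)) v" for v p
  \<comment> \<open>Tests at point \<open>z\<close> and stage \<open>w\<close> whether the
    complement of \<open>W e\<close> is the list \<open>D\<close>: points outside \<open>D\<close>
    must be enumerated, a c.e. demand, and points of \<open>D\<close> must not be enumerated with
    witness \<open>w\<close>, a decidable one.\<close>
  define comp_is where "comp_is z w D e \<longleftrightarrow> (cmem z D \<or> z \<in> W e) \<and> (cmem z D \<longrightarrow> \<not> Q w (pair z e))" for z w D e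
  have comp_is: "(\<forall>z w. comp_is z w D e) \<longleftrightarrow> UNIV - W e = set (list_decode D)" for D e
    unfolding comp_is_def cmem_iff using Q2[of _ e] by blast
  \<comment> \<open>\<open>a\<close> codes an output of the program and lists of the two
    complements, \<open>b\<close> a point and a stage to be tested. As \<open>N\<close> is c.e., the
    prefix exists-forall before it describes a Sigma3 property.\<close>
  define N where "N b a p \<longleftrightarrow> out (pfst a) p \<and> cdistinct (pfst (psnd a)) \<and> cdistinct (psnd (psnd a)) \<and>
     clen (pfst (psnd a)) = clen (psnd (psnd a)) \<and>
     comp_is (pfst b) (psnd b) (pfst (psnd a)) (cnth (pfst a) (2 * (p mod 2))) \<and>
     comp_is (pfst b) (psnd b) (psnd (psnd a)) (cnth (pfst a) (Suc (2 * (p mod 2))))" for b a p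
  have fm: "finite_match p \<longleftrightarrow> (\<exists>a. \<forall>b. N b a p)" for p
  proof -
    let ?A = "\<lambda>v. UNIV - W (cnth v (2 * (p mod 2)))" and ?B = "\<lambda>v. UNIV - W (cnth v (Suc (2 * (p mod 2))))"
    have out: "out v p \<longleftrightarrow> rc_eval (rc_decode (p div 2)) [list_encode (block (p div 2))] v" for v
      unfolding out_def by simp
    have "(\<forall>b. N b a p) \<longleftrightarrow> out (pfst a) p \<and> cdistinct (pfst (psnd a)) \<and> cdistinct (psnd (psnd a)) \<and>
       clen (pfst (psnd a)) = clen (psnd (psnd a)) \<and> ?A (pfst a) = set (list_decode (pfst (psnd a))) \<and>
       ?B (pfst a) = set (list_decode (psnd (psnd a)))" for a
    proof -
      have "(\<forall>b. comp_is (pfst b) (psnd b) D e) \<longleftrightarrow> UNIV - W e = set (list_decode D)" for D e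
        unfolding all_pair[of "\<lambda>z w. comp_is z w D e"] by (rule comp_is)
      thus ?thesis unfolding N_def by (simp only: all_simps all_conj_distrib)
    qed
    hence "(\<exists>a. \<forall>b. N b a p) \<longleftrightarrow> (\<exists>a. out (pfst a) p \<and> cdistinct (pfst (psnd a)) \<and> cdistinct (psnd (psnd a)) \<and>
       clen (pfst (psnd a)) = clen (psnd (psnd a)) \<and> ?A (pfst a) = set (list_decode (pfst (psnd a))) \<and>
       ?B (pfst a) = set (list_decode (psnd (psnd a))))" by presburger
    also have "\<dots> \<longleftrightarrow> (\<exists>v D E. out v p \<and> cdistinct D \<and> cdistinct E \<and> clen D = clen E \<and>
        ?A v = set (list_decode D) \<and> ?B v = set (list_decode E))"
    proof -
      have "(\<exists>c. out v p \<and> cdistinct (pfst c) \<and> cdistinct (psnd c) \<and> clen (pfst c) = clen (psnd c) \<and>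
        ?A v = set (list_decode (pfst c)) \<and> ?B v = set (list_decode (psnd c))) \<longleftrightarrow>
        (\<exists>D E. out v p \<and> cdistinct D \<and> cdistinct E \<and> clen D = clen E \<and>
        ?A v = set (list_decode D) \<and> ?B v = set (list_decode E))" for v
        by (rule ex_pair)
      thus ?thesis
        unfolding ex_pair[of "\<lambda>v c. out v p \<and> cdistinct (pfst c) \<and> cdistinct (psnd c) \<and> clen (pfst c) = clen (psnd c) \<and>
          ?A v = set (list_decode (pfst c)) \<and> ?B v = set (list_decode (psnd c))"] by simp
    qed
    also have "\<dots> \<longleftrightarrow> (\<exists>v. out v p \<and> finite (?A v) \<and> ?A v \<approx> ?B v)"
    proof (intro iff_exI iffI)
      fix v assume "\<exists>D E. out v p \<and> cdistinct D \<and> cdistinct E \<and> clen D = clen E \<and>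
        ?A v = set (list_decode D) \<and> ?B v = set (list_decode E)"
      then obtain D E where DE: "out v p" "cdistinct D" "cdistinct E" "clen D = clen E"
        "?A v = set (list_decode D)" "?B v = set (list_decode E)" by blast
      have "card (set (list_decode D)) = card (set (list_decode E))"
        using DE(2-4) by (simp add: cdistinct_iff clen_def distinct_card)
      thus "out v p \<and> finite (?A v) \<and> ?A v \<approx> ?B v" unfolding DE(5,6) using DE(1) by (simp add: eqpoll_iff_card)
    next
      fix v assume v: "out v p \<and> finite (?A v) \<and> ?A v \<approx> ?B v"
      hence fin: "finite (?A v)" "finite (?B v)" using eqpoll_finite_iff[of "?A v" "?B v"] by simp_all
      obtain ds es where ds: "set ds = ?A v" "distinct ds" and es: "set es = ?B v" "distinct es"
        using finite_distinct_list[OF fin(1)] finite_distinct_list[OF fin(2)] by blast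
      have "length ds = length es"
        using v fin ds es by (metis distinct_card eqpoll_iff_card)
      thus "\<exists>D E. out v p \<and> cdistinct D \<and> cdistinct E \<and> clen D = clen E \<and>
        ?A v = set (list_decode D) \<and> ?B v = set (list_decode E)"
        using v ds es by (intro exI[of _ "list_encode ds"] exI[of _ "list_encode es"]) (simp add: cdistinct_iff)
    qed
    finally show ?thesis unfolding finite_match_def out by blast
  qed
  have comp_is_ce: "ce (\<lambda>x. comp_is (f x) (g x) (h x) (k x))"
    if "computable1 f" "computable1 g" "computable1 h" "computable1 k" for f g h k
    unfolding comp_is_def by (intro comp that dec_imp_ce[OF dec_not[OF dec_compose2[OF Q(1)]]])
  have blk: "list_encode (block e) = ccons (4 * e) (ccons (4 * e + 1) (ccons (4 * e + 2) (ccons (4 * e + 3) 0)))" for e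
    by (simp add: block_def ccons_def)
  have out_ce: "ce (\<lambda>x. out (f x) (g x))" if "computable1 f" "computable1 g" for f g
    unfolding out_def blk by (intro comp that computable1_div2)
  have Nce: "ce (\<lambda>x. N (f x) (g x) (h x))" if "computable1 f" "computable1 g" "computable1 h" for f g h
    unfolding N_def by (intro comp that comp_is_ce out_ce computable1_mod2 dec_imp_ce[OF dec_cdistinct])
  show ?thesis
  proof (rule Pi3_setI)
    show "ce (\<lambda>q. pfst (psnd (psnd q)) \<noteq> psnd (psnd (psnd q)) \<and>
        (pfst (psnd (psnd q)) div 2 \<noteq> psnd (psnd (psnd q)) div 2 \<or> N (pfst q) (pfst (psnd q)) (pfst (psnd (psnd q)) div 2)))"
      by (intro comp Nce computable1_div2)
    show "x \<in> pair_code diagonal \<longleftrightarrow> (\<forall>a. \<exists>b. \<not> (pfst x \<noteq> psnd x \<and> (pfst x div 2 \<noteq> psnd x div 2 \<or> N b a (pfst x div 2))))" for x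
      unfolding mem_pair_code diagonal_def mem_Collect_eq prod.case fm by blast
  qed
qed

text \<open>A reduction succeeding on its own block would make all four complements infinite.\<close>
lemma (in ACF_family) diagonal_not_4ary: "\<not> nary_reducible 4 diagonal (F_AC L)"
proof
  assume "nary_reducible 4 diagonal (F_AC L)"
  then obtain c where c: "\<And>xs. length xs = 4 \<Longrightarrow>
        (\<exists>ys. rc_eval c [list_encode xs] (list_encode ys) \<and> length ys = 4 \<and>
             (\<forall>i j. i < j \<and> j < 4 \<longrightarrow> ((xs ! i, xs ! j) \<in> diagonal \<longleftrightarrow> (ys ! i, ys ! j) \<in> F_AC L)))"
    unfolding nary_reducible_def by blast
  define e where "e = rc_encode c"
  have len: "length (block e) = 4" by (simp add: block_def)
  obtain ys where ys: "rc_eval c [list_encode (block e)] (list_encode ys)" "length ys = 4"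
    "\<And>i j. i < j \<Longrightarrow> j < 4 \<Longrightarrow> (block e ! i, block e ! j) \<in> diagonal \<longleftrightarrow> (ys ! i, ys ! j) \<in> F_AC L"
    using c[OF len] by blast
  have fm: "finite_match p \<longleftrightarrow> finite (UNIV - W (ys ! (2 * (p mod 2)))) \<and>
      UNIV - W (ys ! (2 * (p mod 2))) \<approx> UNIV - W (ys ! Suc (2 * (p mod 2)))" if p: "p div 2 = e" for p
  proof -
    have dec: "rc_decode (p div 2) = c" unfolding p e_def by simp
    have uniq: "rc_eval c [list_encode (block e)] v \<longleftrightarrow> v = list_encode ys" for v
      using ys(1) rc_eval_deterministic by blast
    have "cnth (list_encode ys) (2 * (p mod 2)) = ys ! (2 * (p mod 2))"
      "cnth (list_encode ys) (Suc (2 * (p mod 2))) = ys ! Suc (2 * (p mod 2))"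
      using ys(2) by (intro cnth_list_encode; simp; presburger)+
    thus ?thesis unfolding finite_match_def dec unfolding p uniq by simp
  qed
  have inf: "infinite (UNIV - W (ys ! (2 * m)))" if m: "m < 2" for m
  proof -
    have p: "(2 * e + m) div 2 = e" "(2 * e + m) mod 2 = m" using m by auto
    have nth: "block e ! (2 * m) = 2 * (2 * e + m)" "block e ! Suc (2 * m) = Suc (2 * (2 * e + m))"
      using m by (auto simp: block_def less_2_cases_iff)
    have "(block e ! (2 * m), block e ! Suc (2 * m)) \<in> diagonal \<longleftrightarrow> \<not> finite_match (2 * e + m)"
      unfolding nth diagonal_def by simp
    moreover have "(block e ! (2 * m), block e ! Suc (2 * m)) \<in> diagonal \<longleftrightarrow>
        UNIV - W (ys ! (2 * m)) \<approx> UNIV - W (ys ! Suc (2 * m))"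
      using ys(3)[of "2 * m" "Suc (2 * m)"] m unfolding F_AC_iff by simp
    \<comment> \<open>A finite match would make the pair inequivalent although its complements are
      equinumerous. So there is none; the pair is then equivalent, and its equinumerous complements
      cannot be finite.\<close>
    ultimately show ?thesis unfolding fm[OF p(1)] p(2) by blast
  qed
  have "UNIV - W (ys ! 0) \<approx> UNIV - W (ys ! 2)" using infinite_nat_sets_eqpoll[OF inf[of 0] inf[of 1]] by simp
  hence "(block e ! 0, block e ! 2) \<in> diagonal" using ys(3)[of 0 2] unfolding F_AC_iff by simp
  \<comment> \<open>Positions 0 and 2 of a block belong to different pairs.\<close>
  thus False unfolding diagonal_def block_def by simp
qed

theorem theorem4p6:
  fixes K :: "nat ring" and L :: "nat \<Rightarrow> 'a ring"
  assumes "computable_presentation_of_Qbar K"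
    and "\<forall>e. ACF0_with_trdeg (L e) (UNIV - W e)"
  shows "Pi2_complete_set (pair_code (F_alg K))
       \<and> Pi2_eqrel (F_alg K)
       \<and> (\<forall>R. Pi2_eqrel R \<longrightarrow> finitary_reducible R (F_alg K))
       \<and> Pi3_complete_set (pair_code (F_AC L))
       \<and> Pi3_eqrel (F_AC L)
       \<and> (\<forall>R. Pi3_eqrel R \<longrightarrow> nary_reducible 3 R (F_AC L))
       \<and> \<not> (\<forall>R. Pi3_eqrel R \<longrightarrow> nary_reducible 4 R (F_AC L))"
proof -
  interpret presented_Qbar K by unfold_locales (rule assms(1))
  interpret ACF_family L by unfold_locales (use assms(2) in blast)
  have "Pi3_eqrel diagonal" unfolding Pi3_eqrel_def using equiv_diagonal Pi3_diagonal by blast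
  thus ?thesis
    unfolding Pi2_complete_set_def Pi3_complete_set_def Pi2_eqrel_def[of "F_alg K"] Pi3_eqrel_def[of "F_AC L"]
    using Pi2_F_alg Pi2_hard_F_alg equiv_F_alg Pi2_finitary Pi3_F_AC Pi3_hard_F_AC equiv_F_AC Pi3_ternary
      diagonal_not_4ary by blast
qed

end
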